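(* Let $n \geq 3$ and let $\ell$ be an integer with $\frac{8n}{9}+\frac{4}{9}\sqrt{8n+5}+1 < \ell \leq n$. Let $T$ be a tree on $n$ vertices. Then $T$ is reconstructible from its $\ell$-deck: every graph $G$ on $n$ vertices with $\mathcal{D}_\ell(G)=\mathcal{D}_\ell(T)$ is isomorphic to $T$.
   Context: All graphs are finite, simple and undirected. For a graph $G$ and an integer $\ell$, the $\ell$-deck $\mathcal{D}_\ell(G)$ is the multiset of isomorphism classes of all induced subgraphs of $G$ on exactly $\ell$ vertices (one for each $\ell$-subset of $V(G)$); its elements are called cards. *)

theory Defs
  imports Complex_Main "HOL-Library.Multiset" "Graph_Theory.Graph_Theory"
begin

text \<open>
  A finite simple undirected graph is a \<^locale>\<open>pair_graph\<close>: a finite, loop-free, symmetric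
  digraph without parallel arcs, every edge \<open>uv\<close> being represented by the two arcs
  \<open>(u, v)\<close> and \<open>(v, u)\<close>.

  The predicates \<^const>\<open>forest\<close> and \<^const>\<open>tree\<close> of the library are meant for directed graphs:
  the two arcs of a single edge already form a cycle \<open>u, v, u\<close> there. In this encoding the
  cycles of the undirected graph are the directed cycles of length at least 3.
\<close>

definition undirected_tree :: "'a pair_pre_digraph \<Rightarrow> bool" where
  "undirected_tree G \<longleftrightarrow> pair_graph G \<and> Digraph_Component.connected (with_proj G) \<and>
     \<not> (\<exists>p. pre_digraph.cycle (with_proj G) p \<and> 3 \<le> length p)"

text \<open>
  Isomorphism classes are represented by sets of graphs with vertices in \<^typ>\<open>nat\<close>, so that decks
  of graphs over different vertex types can be compared. Every finite graph has an isomorphic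
  copy on natural numbers, so two cards have equal classes iff they are isomorphic
  (lemma \<open>iso_class_eq_iff\<close> below).
\<close>

definition iso_class :: "('a, 'b) pre_digraph \<Rightarrow> nat pair_pre_digraph set" where
  "iso_class G = {H. digraph_iso G (with_proj H)}"

definition deck :: "nat \<Rightarrow> 'a pair_pre_digraph \<Rightarrow> nat pair_pre_digraph set multiset" where
  "deck l G = image_mset (\<lambda>S. iso_class (with_proj G \<restriction> S))
                (mset_set {S. S \<subseteq> pverts G \<and> card S = l})"

lemma digraph_iso_with_proj_iff:
  assumes "pair_wf_digraph G"
  shows "digraph_iso (with_proj G) (with_proj H) \<longleftrightarrow>
    (\<exists>f. inj_on f (pverts G) \<and> pverts H = f ` pverts G \<and> parcs H = map_prod f f ` parcs G)"
    (is "?L \<longleftrightarrow> ?R")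
proof
  assume ?L
  then obtain h where h: "pre_digraph.digraph_isomorphism (with_proj G) h"
    and H: "with_proj H = app_iso h (with_proj G)"
    unfolding digraph_iso_def by blast
  let ?f = "iso_verts h"
  have t: "iso_tail h = fst" "iso_head h = snd"
    using arg_cong[OF H, of tail] arg_cong[OF H, of head] by simp_all
  have "iso_arcs h a = map_prod ?f ?f a" if "a \<in> parcs G" for a
    using h that t by (cases a; cases "iso_arcs h a")
      (auto simp: pre_digraph.digraph_isomorphism_def dest!: bspec[where x = a])
  moreover have "parcs H = iso_arcs h ` parcs G" "pverts H = ?f ` pverts G"
    using arg_cong[OF H, of arcs] arg_cong[OF H, of verts] by simp_all
  moreover have "inj_on ?f (pverts G)"
    using h unfolding pre_digraph.digraph_isomorphism_def by simp
  ultimately show ?R by (intro exI[of _ ?f]) (simp cong: image_cong)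
next
  assume ?R
  then obtain f where f: "inj_on f (pverts G)" "pverts H = f ` pverts G"
    "parcs H = map_prod f f ` parcs G" by blast
  let ?h = "\<lparr>iso_verts = f, iso_arcs = map_prod f f, iso_head = snd, iso_tail = fst\<rparr>"
  have sub: "parcs G \<subseteq> pverts G \<times> pverts G"
    using assms by (auto dest: pair_wf_digraph.in_arcsD1 pair_wf_digraph.in_arcsD2)
  have "inj_on (map_prod f f) (parcs G)"
    using map_prod_inj_on[OF f(1) f(1)] sub by (rule inj_on_subset)
  then have "pre_digraph.digraph_isomorphism (with_proj G) ?h"
    using f assms by (simp add: pre_digraph.digraph_isomorphism_def wf_digraph_wp_iff)
  moreover have "with_proj H = app_iso ?h (with_proj G)"
    using f by (simp add: with_proj_def app_iso_def)
  ultimately show ?L unfolding digraph_iso_def by blast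
qed

lemma iso_class_eq_iff:
  fixes G :: "'a pair_pre_digraph" and H :: "'b pair_pre_digraph"
  assumes G: "pair_graph G" and H: "pair_graph H"
  shows "iso_class (with_proj G) = iso_class (with_proj H) \<longleftrightarrow>
    digraph_iso (with_proj G) (with_proj H)"
proof -
  have wf: "pair_wf_digraph G" "pair_wf_digraph H"
    using G H by (simp_all add: pair_graph_def pair_digraph_def pair_fin_digraph_def)
  then have wf': "wf_digraph (with_proj G)" "wf_digraph (with_proj H)"
    by (simp_all add: wf_digraph_wp_iff)
  have "finite (pverts G)"
    using G by (simp add: pair_graph_def pair_digraph_def pair_fin_digraph_def
        pair_fin_digraph_axioms_def)
  then obtain f :: "'a \<Rightarrow> nat" where "inj_on f (pverts G)"
    using finite_imp_inj_to_nat_seg[of "pverts G"] by auto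
  then have K: "digraph_iso (with_proj G)
      (with_proj \<lparr>pverts = f ` pverts G, parcs = map_prod f f ` parcs G\<rparr>)" (is "digraph_iso _ ?K")
    unfolding digraph_iso_with_proj_iff[OF wf(1)] by (intro exI[of _ f]) simp
  show ?thesis
  proof
    assume "iso_class (with_proj G) = iso_class (with_proj H)"
    with K have "digraph_iso (with_proj H) ?K" by (auto simp: iso_class_def)
    then show "digraph_iso (with_proj G) (with_proj H)"
      by (rule digraph_iso_trans[OF K digraph_iso_swap[OF wf'(2)]])
  next
    assume GH: "digraph_iso (with_proj G) (with_proj H)"
    show "iso_class (with_proj G) = iso_class (with_proj H)"
      unfolding iso_class_def
      by (intro Collect_cong iffI)
        (erule digraph_iso_trans[OF digraph_iso_swap[OF wf'(1) GH]] digraph_iso_trans[OF GH])+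
  qed
qed

end

theory Submission
  imports Defs "HOL-Library.FuncSet"
begin

text \<open>Put \<open>r = n - l\<close>; the hypothesis yields \<open>9 * r + 10 \<le> n\<close>. Three facts are read off the deck by
  counting induced copies of patterns with at most \<open>l\<close> vertices.

  First, \<open>G\<close> is a tree: a shortest cycle fits into a card or else carries so many induced paths
  that \<open>G\<close> has more of them than a tree can have.

  Second, call the component \<open>limb u w\<close> of \<open>w\<close> in \<open>T - u w\<close> a limb. If all limbs of a certain
  height behind a path of length \<open>j\<close> have fewer than \<open>l - j\<close> vertices, then the deck determines how often
  each isomorphism type of such a limb occurs behind a path of length \<open>j\<close>.

  Third, if \<open>z\<close> is a vertex all of whose branches have height at most \<open>J\<close>, and the branches of
  height \<open>J\<close> are known, then the numbers of limbs behind paths of length \<open>J + 1\<close> determine the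
  lower branches at \<open>z\<close>, by descending height.

  The counts needed in the third fact are available unless the tree has a thin limb, one with at most
  \<open>r\<close> vertices more than its height and at least half as high as the diameter. Without thin limbs \<open>z\<close>
  is the centre of the tree. Otherwise \<open>z\<close> is the root of a thin limb of maximal height \<open>J\<close>. The thin
  limb is then recognised by a pattern containing it, unless nearly all vertices lie on a diametral path;
  in that case the two halves of the tree are determined directly.\<close>

section \<open>Distances and limbs\<close>

text \<open>A pattern also occurs inside larger limbs than its own, so limbs are counted from the
  largest downwards. This can start only if the largest limb behind a path, together with the path,
  is smaller than a card. If it is not, the opposite limb, which contains the path, has hardly any
  other vertices: this is where thin limbs come from.

  The path length \<open>J + 1\<close> exceeds every distance from \<open>z\<close>, so all limbs
  counted behind such paths point away from \<open>z\<close>. Their number splits into a part known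
  from the higher branches and terms that depend only on the branches of the current height.

  The constant 9: the pattern recognising a thin limb fits into a card if diameter plus limb size
  plus \<open>2 * r + 2\<close> is at most \<open>n + J\<close>. A thin limb has at most
  \<open>J + r\<close> vertices, so otherwise the diameter is at least \<open>n - 3 * r - 1\<close>.
  The argument along a diametral path takes a diameter of at least \<open>6 * r + 6\<close>. With
  \<open>9 * r + 10 \<le> n\<close> one of the two applies. The same bound makes the roughly
  \<open>2 * l * l\<close> induced paths of a long chordless cycle outnumber the
  \<open>n * n\<close> pairs of vertices of a tree.\<close>

definition gdist :: "('a \<Rightarrow> 'a \<Rightarrow> bool) \<Rightarrow> 'a \<Rightarrow> 'a \<Rightarrow> nat" where
  "gdist E x y = (LEAST n. (E ^^ n) x y)"

text \<open>Acyclicity is encoded by \<open>unique_closer\<close>: every vertex has at most one neighbour that is not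
  farther from \<open>x\<close>.\<close>

locale tree_graph =
  fixes V :: "'a set" and E :: "'a \<Rightarrow> 'a \<Rightarrow> bool"
  assumes finite_V: "finite V" and adj_sym: "E u v \<Longrightarrow> E v u" and adj_irrefl: "\<not> E u u"
    and adj_V: "E u v \<Longrightarrow> u \<in> V"
    and connected: "x \<in> V \<Longrightarrow> y \<in> V \<Longrightarrow> \<exists>n. (E ^^ n) x y"
    and unique_closer: "x \<in> V \<Longrightarrow> E u v \<Longrightarrow> E u w \<Longrightarrow>
      gdist E x v \<le> gdist E x u \<Longrightarrow> gdist E x w \<le> gdist E x u \<Longrightarrow> v = w"
begin

abbreviation d where "d \<equiv> gdist E"

lemma adj_V': "E u v \<Longrightarrow> v \<in> V"
  using adj_V adj_sym by blast

lemma relpow_d: "x \<in> V \<Longrightarrow> y \<in> V \<Longrightarrow> (E ^^ d x y) x y"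
  unfolding gdist_def using connected LeastI_ex by metis

lemma d_le: "(E ^^ n) x y \<Longrightarrow> d x y \<le> n"
  unfolding gdist_def by (rule Least_le)

lemma d_self [simp]: "d x x = 0"
  using d_le[of 0 x x] by simp

lemma d_eq_0: "x \<in> V \<Longrightarrow> y \<in> V \<Longrightarrow> d x y = 0 \<longleftrightarrow> x = y"
  using relpow_d[of x y] by auto

lemma relpow_sym: "(E ^^ n) x y \<Longrightarrow> (E ^^ n) y x"
proof (induction n arbitrary: y)
  case (Suc n)
  then obtain z where "(E ^^ n) x z" "E z y" by (auto elim: relpowp_Suc_E)
  with Suc.IH adj_sym show ?case by (meson relpowp_Suc_I2)
qed auto

lemma d_sym: "d x y = d y x"
  unfolding gdist_def using relpow_sym by metis

lemma d_triangle: "x \<in> V \<Longrightarrow> y \<in> V \<Longrightarrow> z \<in> V \<Longrightarrow> d x z \<le> d x y + d y z"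
  by (intro d_le) (auto simp: relpowp_add intro: relpow_d)

lemma d_adj: "E u v \<Longrightarrow> d u v = 1"
  using d_le[of 1 u v] d_eq_0[of u v] adj_V adj_V' adj_irrefl by fastforce

lemma ex_closer:
  assumes "x \<in> V" "u \<in> V" "u \<noteq> x"
  obtains w where "E u w" "d x u = d x w + 1"
proof -
  have "d x u \<noteq> 0" using assms d_eq_0 by metis
  then obtain n where n: "d x u = Suc n" using not0_implies_Suc by blast
  then obtain w where w: "(E ^^ n) x w" "E w u"
    using relpow_d[OF assms(1,2)] by (metis relpowp_Suc_E)
  then have "d x w \<le> n" by (simp add: d_le)
  moreover have "d x u \<le> d x w + 1"
    using d_triangle[OF assms(1) _ assms(2), of w] d_adj[OF w(2)] adj_V[OF w(2)] by simp
  ultimately show ?thesis using that w adj_sym n by force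
qed

text \<open>If both ends of the edge were equally far from \<open>x\<close>, then \<open>u\<close>
  would have two neighbours that are not farther: \<open>w\<close> and the one given by
  \<open>ex_closer\<close>.\<close>

lemma d_step:
  assumes "x \<in> V" "E u w"
  shows "d x w = d x u + 1 \<or> d x u = d x w + 1"
proof (rule ccontr)
  assume *: "\<not> ?thesis"
  have V: "u \<in> V" "w \<in> V" using assms adj_V adj_V' by auto
  have "d x w \<le> d x u + 1" "d x u \<le> d x w + 1"
    using d_triangle[OF assms(1) V(1) V(2)] d_triangle[OF assms(1) V(2) V(1)]
      d_adj[OF assms(2)] d_adj[OF adj_sym[OF assms(2)]] by auto
  with * have eq: "d x w = d x u" by linarith
  have "u \<noteq> x" using eq d_eq_0[OF assms(1) V(2)] d_adj[OF assms(2)] by auto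
  then obtain v where v: "E u v" "d x u = d x v + 1" using ex_closer assms(1) V by blast
  then have "v = w" using unique_closer[OF assms(1) v(1) assms(2)] eq by simp
  with v eq show False by simp
qed

text \<open>For an edge \<open>u w\<close>, this is the component of \<open>w\<close> after deletion of the edge.\<close>

definition limb :: "'a \<Rightarrow> 'a \<Rightarrow> 'a set" where
  "limb u w = {x \<in> V. d x w < d x u}"

lemma limb_V: "limb u w \<subseteq> V" by (auto simp: limb_def)
lemma finite_limb [simp]: "finite (limb u w)" using limb_V finite_V finite_subset by blast

lemma limb_self: "E u w \<Longrightarrow> w \<in> limb u w"
  using d_adj[of w u] adj_V' adj_sym by (auto simp: limb_def)

lemma limb_not: "u \<notin> limb u w"
  by (auto simp: limb_def)

lemma limb_dist: "E u w \<Longrightarrow> x \<in> limb u w \<Longrightarrow> d x u = d x w + 1"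
  using d_step[of x u w] by (auto simp: limb_def)

lemma limb_compl: "E u w \<Longrightarrow> limb w u = V - limb u w"
proof -
  assume "E u w"
  then have "x \<in> limb w u \<longleftrightarrow> x \<notin> limb u w" if "x \<in> V" for x
    using d_step[OF that, of u w] that by (auto simp: limb_def)
  then show ?thesis using limb_V by blast
qed

lemma limb_card: "E u w \<Longrightarrow> card (limb u w) + card (limb w u) = card V"
  using limb_compl[of u w] card_Diff_subset[of "limb u w" V] limb_V card_mono[OF finite_V limb_V, of u w] by simp

lemma ex_branch:
  assumes "x \<in> V" "u \<in> V" "x \<noteq> u"
  obtains w where "E u w" "x \<in> limb u w"
proof -
  obtain w where "E u w" "d x u = d x w + 1" using ex_closer[OF assms(1,2)] assms(3) by metis
  then show ?thesis using that[of w] assms(1) by (simp add: limb_def)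
qed

lemma branch_unique:
  assumes "E u w" "E u w'" "x \<in> limb u w" "x \<in> limb u w'"
  shows "w = w'"
  using unique_closer[OF _ assms(1,2), of x] assms(3,4) by (auto simp: limb_def)

text \<open>Induction away from \<open>w\<close>: the predecessor \<open>y'\<close> of
  \<open>y\<close> already has a neighbour nearer to \<open>x\<close> (\<open>u\<close> itself if
  \<open>y' = w\<close>), so by \<open>unique_closer\<close> the vertex \<open>y\<close> has to be
  farther than \<open>y'\<close>.\<close>

lemma cross:
  assumes "E u w" "x \<in> limb w u" "y \<in> limb u w"
  shows "d x y = d x w + d w y"
  using assms(3)
proof (induction "d w y" arbitrary: y rule: less_induct)
  case less
  have V: "u \<in> V" "w \<in> V" "x \<in> V" "y \<in> V" using assms less.prems adj_V adj_V' limb_V by blast+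
  show ?case
  proof (cases "y = w")
    case False
    then obtain y' where y': "E y y'" "d w y = d w y' + 1" using ex_closer V by metis
    have y'V: "y' \<in> V" using y' adj_V' by blast
    have "d u y = d w y + 1" using limb_dist[OF assms(1) less.prems] by (simp add: d_sym)
    then have "d u y' \<ge> d w y' + 1" using y'(2) d_step[OF V(1) y'(1)] by linarith
    then have y'L: "y' \<in> limb u w" using y'V by (simp add: limb_def d_sym)
    have IH: "d x y' = d x w + d w y'" using less.hyps[OF _ y'L] y'(2) by simp
    obtain v where v: "E y' v" "d x v < d x y'" "v \<noteq> y"
    proof (cases "y' = w")
      case True
      have "d x u < d x w" "y \<noteq> u" using assms less.prems limb_not by (auto simp: limb_def)
      then show ?thesis using that[of u] True assms(1) adj_sym by blast
    next
      case y'w: False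
      then obtain v where v: "E y' v" "d w y' = d w v + 1" using ex_closer V y'V by metis
      have "d u y' = d w y' + 1" using limb_dist[OF assms(1) y'L] by (simp add: d_sym)
      then have "d u v \<ge> d w v + 1" using v(2) d_step[OF V(1) v(1)] by linarith
      then have "v \<in> limb u w" using v adj_V' by (simp add: limb_def d_sym)
      then have "d x v = d x w + d w v" using less.hyps[of v] v y' by simp
      then have "d x v < d x y'" using IH v(2) by simp
      moreover have "v \<noteq> y" using v(2) y'(2) by auto
      ultimately show ?thesis using that v(1) by blast
    qed
    have "\<not> d x y \<le> d x y'"
      using unique_closer[OF V(3) v(1) adj_sym[OF y'(1)]] v by auto
    then have "d x y = d x y' + 1" using d_step[OF V(3) y'(1)] by auto
    then show ?thesis using IH y' by simp
  qed simp
qed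

lemma cross':
  assumes "E u w" "x \<in> limb w u" "y \<in> limb u w"
  shows "d x y = d x u + d u y"
  using cross[OF assms] limb_dist[OF assms(1,3)] limb_dist[OF adj_sym[OF assms(1)] assms(2)]
  by (simp add: d_sym)

lemma branches_cross:
  assumes "E z v" "x \<in> limb z v" "y \<in> V - limb z v"
  shows "d x y = d x z + d z y"
  using cross'[of z v y x] assms limb_compl[of z v] by (simp add: d_sym)

lemma limb_branches:
  assumes "u \<in> V"
  shows "V = insert u (\<Union>w\<in>{w. E u w}. limb u w)"
proof
  show "V \<subseteq> insert u (\<Union>w\<in>{w. E u w}. limb u w)"
  proof
    fix x assume "x \<in> V"
    show "x \<in> insert u (\<Union>w\<in>{w. E u w}. limb u w)"
    proof (cases "x = u")
      case False
      then show ?thesis using ex_branch[OF \<open>x \<in> V\<close> assms] by blast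
    qed simp
  qed
  show "insert u (\<Union>w\<in>{w. E u w}. limb u w) \<subseteq> V" using assms limb_V by blast
qed

lemma limb_rec:
  assumes "E u w"
  shows "limb u w = insert w (\<Union>v\<in>{v. E w v} - {u}. limb w v)" (is "?L = ?R")
proof -
  have "w \<in> V" using assms adj_V' by blast
  have "limb w v \<inter> limb w u = {}" if "E w v" "v \<noteq> u" for v
    using branch_unique[OF that(1) adj_sym[OF assms]] that(2) by blast
  then have "?R \<inter> limb w u = {}" using limb_not by blast
  moreover have "?R \<union> limb w u = V"
    using limb_branches[OF \<open>w \<in> V\<close>] adj_sym[OF assms] by blast
  ultimately have "?R = V - limb w u" by blast
  then show ?thesis using limb_compl[OF adj_sym[OF assms]] by simp
qed

lemma limb_subset:
  assumes "E u w" "E w v" "v \<noteq> u"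
  shows "limb w v \<subseteq> limb u w"
  using limb_rec[OF assms(1)] assms by blast

lemma finite_nbr [simp]: "finite {v. E u v}"
  using finite_subset[OF _ finite_V] adj_V' by (metis mem_Collect_eq subsetI)

text \<open>The vertex set of the path between \<open>x\<close> and \<open>y\<close>. Describing it
  by distances spares any handling of vertex lists.\<close>

definition interval :: "'a \<Rightarrow> 'a \<Rightarrow> 'a set" where
  "interval x y = {q \<in> V. d x q + d q y = d x y}"

lemma interval_sym: "interval x y = interval y x"
  by (auto simp: interval_def d_sym add.commute)

lemma interval_V: "interval x y \<subseteq> V" by (auto simp: interval_def)
lemma finite_interval [simp]: "finite (interval x y)" using interval_V finite_V finite_subset by blast

lemma interval_ends: "x \<in> V \<Longrightarrow> y \<in> V \<Longrightarrow> x \<in> interval x y" "x \<in> V \<Longrightarrow> y \<in> V \<Longrightarrow> y \<in> interval x y"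
  by (auto simp: interval_def)

lemma limb_convex:
  assumes "E u w" "x \<in> limb u w" "y \<in> limb u w"
  shows "interval x y \<subseteq> limb u w"
proof
  fix q assume q: "q \<in> interval x y"
  show "q \<in> limb u w"
  proof (rule ccontr)
    assume "q \<notin> limb u w"
    then have "q \<in> limb w u" using limb_compl[OF assms(1)] q interval_V by blast
    then have "d q x = d q w + d w x" "d q y = d q w + d w y" "d q w = d q u + 1"
      using cross[OF assms(1)] assms limb_dist[OF adj_sym[OF assms(1)]] by auto
    moreover have "d x y \<le> d x w + d w y"
      using d_triangle[of x w y] assms limb_V adj_V' by blast
    ultimately show False using q by (simp add: interval_def d_sym)
  qed
qed

text \<open>Consider the branch at \<open>q\<close> that contains \<open>q'\<close>. An end outside
  it would reach \<open>q'\<close> only through \<open>q\<close>, hence be strictly farther from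
  \<open>q'\<close> than from \<open>q\<close>. So both ends lie in this branch, and by convexity
  \<open>q\<close> would too.\<close>

lemma interval_unique:
  assumes "q \<in> interval x y" "q' \<in> interval x y" "d x q = d x q'" "x \<in> V" "y \<in> V"
  shows "q = q'"
proof (rule ccontr)
  assume "q \<noteq> q'"
  have V: "q \<in> V" "q' \<in> V" using assms interval_V by auto
  then obtain v where v: "E q v" "q' \<in> limb q v" using ex_branch \<open>q \<noteq> q'\<close> by metis
  have pos: "d q q' > 0" using d_eq_0 V \<open>q \<noteq> q'\<close> by blast
  have "x \<in> limb q v" if "y \<notin> limb q v \<or> True"
  proof (rule ccontr)
    assume "x \<notin> limb q v"
    then have "d x q' = d x q + d q q'" using branches_cross[OF v, of x] assms(4) by (simp add: d_sym)
    then show False using pos assms(3) by simp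
  qed
  moreover have "y \<in> limb q v"
  proof (rule ccontr)
    assume "y \<notin> limb q v"
    then have "d y q' = d y q + d q q'" using branches_cross[OF v, of y] assms(5) by (simp add: d_sym)
    moreover have "d q y = d q' y" using assms(1-3) by (simp add: interval_def)
    ultimately show False using pos by (simp add: d_sym)
  qed
  ultimately have "q \<in> limb q v" using limb_convex[OF v(1)] assms(1) by blast
  then show False using limb_not by blast
qed

lemma interval_ex:
  assumes "x \<in> V" "y \<in> V" "i \<le> d x y"
  obtains q where "q \<in> interval x y" "d x q = i"
proof -
  obtain j where j: "d x y = i + j" using assms(3) le_Suc_ex by blast
  then obtain q where q: "(E ^^ i) x q" "(E ^^ j) q y"
    using relpow_d[OF assms(1,2)] by (auto simp: relpowp_add)
  have qV: "q \<in> V"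
  proof (cases i)
    case 0 then show ?thesis using q assms by simp
  next
    case (Suc m) then show ?thesis using q(1) adj_V' by (auto elim: relpowp_Suc_E)
  qed
  have "d x q \<le> i" "d q y \<le> j" using q d_le by auto
  moreover have "d x y \<le> d x q + d q y" using d_triangle assms qV by blast
  ultimately show ?thesis using that[of q] qV j by (simp add: interval_def)
qed

lemma interval_card:
  assumes "x \<in> V" "y \<in> V"
  shows "card (interval x y) = d x y + 1"
proof -
  have "bij_betw (d x) (interval x y) {..d x y}"
    unfolding bij_betw_def
  proof
    show "inj_on (d x) (interval x y)" using interval_unique assms by (auto intro: inj_onI)
    show "d x ` interval x y = {..d x y}"
    proof
      show "d x ` interval x y \<subseteq> {..d x y}" by (auto simp: interval_def)
      show "{..d x y} \<subseteq> d x ` interval x y"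
      proof
        fix i assume "i \<in> {..d x y}"
        then obtain q where "q \<in> interval x y" "d x q = i" using interval_ex[OF assms, of i] by auto
        then show "i \<in> d x ` interval x y" by blast
      qed
    qed
  qed
  then show ?thesis using bij_betw_same_card by fastforce
qed

lemma interval_step:
  assumes "x \<in> V" "E q q'" "d x q' = d x q + 1" "y \<in> V" "q' \<in> interval x y"
  shows "q \<in> interval x y"
proof -
  have "d q y \<le> d q' y + 1"
    using d_triangle[of q q' y] d_adj[OF assms(2)] adj_V adj_V' assms by force
  moreover have "d x y \<le> d x q + d q y" using d_triangle assms adj_V by blast
  ultimately show ?thesis using assms adj_V[of q q'] by (simp add: interval_def)
qed

text \<open>Vertex sets of subtrees containing \<open>w\<close>: closed under steps towards
  \<open>w\<close>. By \<open>closed_any\<close> the base point may be any vertex of the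
  set.\<close>

definition closed :: "'a \<Rightarrow> 'a set \<Rightarrow> bool" where
  "closed w C \<longleftrightarrow> w \<in> C \<and> C \<subseteq> V \<and> (\<forall>y\<in>C. \<forall>y'. E y y' \<and> d w y = d w y' + 1 \<longrightarrow> y' \<in> C)"

lemma closed_interval:
  assumes "closed w C" "x \<in> C"
  shows "interval w x \<subseteq> C"
proof
  fix q assume "q \<in> interval w x"
  then show "q \<in> C"
  proof (induction "d q x" arbitrary: q)
    case 0
    then show ?case using assms d_eq_0[of q x] interval_V closed_def by (metis subset_iff)
  next
    case (Suc n)
    have V: "w \<in> V" "x \<in> V" "q \<in> V" using assms Suc closed_def interval_V by blast+
    have "d w q < d w x" using Suc by (simp add: interval_def)
    then obtain q' where q': "q' \<in> interval w x" "d w q' = d w q + 1"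
      using interval_ex[OF V(1,2), of "d w q + 1"] by auto
    then have "n = d q' x" using Suc by (simp add: interval_def)
    then have "q' \<in> C" using Suc.hyps(1) q' by blast
    have "q' \<noteq> w" using q' by auto
    then obtain q'' where q'': "E q' q''" "d w q' = d w q'' + 1"
      using ex_closer V q' interval_V by blast
    then have "q'' \<in> C" using \<open>q' \<in> C\<close> assms(1) closed_def by blast
    have "q'' \<in> interval w x" using interval_step[OF V(1) adj_sym[OF q''(1)] q''(2) V(2) q'(1)] .
    then have "q'' = q" using interval_unique[OF _ Suc.prems _ V(1,2)] q' q'' by simp
    then show ?case using \<open>q'' \<in> C\<close> by simp
  qed
qed

text \<open>A step towards \<open>x\<close> either leads towards \<open>w\<close> as well, or it
  leads to a vertex on the path from \<open>w\<close> to \<open>x\<close>, which lies in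
  \<open>C\<close> by \<open>closed_interval\<close>.\<close>

lemma closed_any:
  assumes "closed w C" "x \<in> C"
  shows "closed x C"
  unfolding closed_def
proof (intro conjI ballI allI impI)
  show "x \<in> C" "C \<subseteq> V" using assms closed_def by auto
  fix y y' assume y: "y \<in> C" "E y y' \<and> d x y = d x y' + 1"
  have V: "w \<in> V" "x \<in> V" using assms closed_def by auto
  show "y' \<in> C"
  proof (cases "d w y = d w y' + 1")
    case True then show ?thesis using assms y closed_def by blast
  next
    case False
    then have "d w y' = d w y + 1" using d_step[OF V(1), of y y'] y by auto
    then have "w \<in> limb y' y" "x \<in> limb y y'" using y V by (auto simp: limb_def)
    then have "d w x = d w y' + d y' x" using cross[of y y' w x] y by simp
    then have "y' \<in> interval w x" using y adj_V'[of y y'] by (simp add: interval_def)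
    then show ?thesis using closed_interval assms by blast
  qed
qed

text \<open>Adding a vertex of \<open>B - C\<close> nearest to \<open>w\<close> keeps the set a
  subtree. The lemma serves to cut a piece of prescribed size, containing prescribed vertices, out
  of a limb that is too large for a card.\<close>

lemma closed_extend:
  assumes "closed w A" "closed w B" "A \<subseteq> B" "card A \<le> s" "s \<le> card B"
  obtains C where "closed w C" "A \<subseteq> C" "C \<subseteq> B" "card C = s"
proof -
  have "\<exists>C. closed w C \<and> A \<subseteq> C \<and> C \<subseteq> B \<and> card C = s"
    using assms(4,5)
  proof (induction s)
    case 0
    then have "A = {}" using assms(1) finite_V finite_subset unfolding closed_def by fastforce
    then show ?case using assms(1) by (simp add: closed_def)
  next
    case (Suc s)
    show ?case
    proof (cases "card A = Suc s")
      case True then show ?thesis using assms by blast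
    next
      case False
      then obtain C where C: "closed w C" "A \<subseteq> C" "C \<subseteq> B" "card C = s" using Suc by auto
      have fin: "finite C" "finite B" using C assms finite_V finite_subset closed_def by metis+
      have "C \<noteq> B" using C Suc by auto
      then have "B - C \<noteq> {}" using C by blast
      then obtain q where q: "q \<in> B - C" "\<And>q'. q' \<in> B - C \<Longrightarrow> d w q \<le> d w q'"
        using ex_has_least_nat[of "\<lambda>q. q \<in> B - C" _ "d w"] by blast
      have "closed w (insert q C)"
        unfolding closed_def
      proof (intro conjI ballI allI impI)
        show "w \<in> insert q C" "insert q C \<subseteq> V" using C assms(2) q(1) unfolding closed_def by auto
        fix y y' assume y: "y \<in> insert q C" "E y y' \<and> d w y = d w y' + 1"
        show "y' \<in> insert q C"
        proof (cases "y = q")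
          case True
          then have "y' \<in> B" using assms(2) y q(1) unfolding closed_def by blast
          then show ?thesis using q(2)[of y'] y True by auto
        next
          case False
          then show ?thesis using C(1) y unfolding closed_def by blast
        qed
      qed
      moreover have "card (insert q C) = Suc s" using q fin C by auto
      ultimately show ?thesis using C q by (intro exI[of _ "insert q C"]) auto
    qed
  qed
  then show ?thesis using that by blast
qed

lemma closed_interval': "x \<in> V \<Longrightarrow> y \<in> V \<Longrightarrow> closed x (interval x y)"
  unfolding closed_def by (simp add: interval_ends interval_V) (metis interval_step adj_sym Suc_eq_plus1)

lemma closed_Un: "closed w A \<Longrightarrow> closed w B \<Longrightarrow> closed w (A \<union> B)"
  unfolding closed_def by blast

lemma closed_limb:
  assumes "E u w" shows "closed w (limb u w)"
  unfolding closed_def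
proof (intro conjI ballI allI impI)
  show "w \<in> limb u w" "limb u w \<subseteq> V" using assms limb_self limb_V by auto
  fix y y' assume y: "y \<in> limb u w" "E y y' \<and> d w y = d w y' + 1"
  have "y' \<in> interval w y" using y d_adj[of y y'] adj_V'[of y y'] by (simp add: interval_def d_sym)
  then show "y' \<in> limb u w" using limb_convex[OF assms limb_self[OF assms] y(1)] by blast
qed

lemma closed_insert_limb:
  assumes "E u w" shows "closed u (insert u (limb u w))"
proof -
  have V: "u \<in> V" "w \<in> V" using assms adj_V adj_V' by auto
  have "interval w u \<subseteq> insert u (limb u w)"
  proof
    fix q assume q: "q \<in> interval w u"
    then have "d w q + d q u = 1" using d_adj[OF adj_sym[OF assms]] by (simp add: interval_def)
    then have "d w q = 0 \<or> d q u = 0" by linarith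
    then have "q = w \<or> q = u" using q d_eq_0 V interval_V by blast
    then show "q \<in> insert u (limb u w)" using limb_self[OF assms] by blast
  qed
  then have "insert u (limb u w) = limb u w \<union> interval w u" using interval_ends V by blast
  then have "closed w (insert u (limb u w))"
    using closed_Un[OF closed_limb[OF assms] closed_interval'[OF V(2,1)]] by simp
  then show ?thesis using closed_any by blast
qed

section \<open>Diameter and eccentricity\<close>

definition diam :: nat where "diam = Max ((\<lambda>(x, y). d x y) ` (V \<times> V))"

lemma d_le_diam: "x \<in> V \<Longrightarrow> y \<in> V \<Longrightarrow> d x y \<le> diam"
  unfolding diam_def using finite_V by (intro Max_ge) auto

lemma diam_ex:
  assumes "V \<noteq> {}" obtains a b where "a \<in> V" "b \<in> V" "d a b = diam"
proof -
  have "diam \<in> (\<lambda>(x, y). d x y) ` (V \<times> V)"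
    unfolding diam_def using finite_V assms by (intro Max_in) auto
  then show ?thesis using that by auto
qed

text \<open>Suppose \<open>x\<close> is farther from \<open>z\<close> than both ends. An end outside
  the branch of \<open>x\<close> at \<open>z\<close> would then have distance more than the diameter
  from \<open>x\<close>. So \<open>a\<close>, \<open>b\<close> and \<open>x\<close> share a branch,
  and the situation persists after one step from \<open>z\<close> into it, which cannot go on
  forever.\<close>

lemma ecc_diam:
  assumes "a \<in> V" "b \<in> V" "d a b = diam" "z \<in> V" "x \<in> V"
  shows "d z x \<le> max (d z a) (d z b)"
proof (rule ccontr)
  assume "\<not> ?thesis"
  then have "d z a < d z x" "d z b < d z x" by auto
  then show False using assms(4)
  proof (induction "d z a" arbitrary: z)
    case 0
    then have "z = a" using assms d_eq_0 by metis
    then show ?case using 0 assms d_le_diam[of a x] by simp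
  next
    case (Suc n)
    have "z \<noteq> x" using Suc by auto
    then obtain v where v: "E z v" "x \<in> limb z v" using ex_branch Suc assms by metis
    have "a \<in> limb z v"
    proof (rule ccontr)
      assume "a \<notin> limb z v"
      then have "d x a = d x z + d z a" using branches_cross[OF v] assms by simp
      moreover have "d a b \<le> d a z + d z b" using d_triangle assms Suc by blast
      ultimately show False using d_le_diam[of x a] assms Suc by (simp add: d_sym)
    qed
    moreover have "b \<in> limb z v"
    proof (rule ccontr)
      assume "b \<notin> limb z v"
      then have "d x b = d x z + d z b" using branches_cross[OF v] assms by simp
      moreover have "d a b \<le> d a z + d z b" using d_triangle assms Suc by blast
      ultimately show False using d_le_diam[of x b] assms Suc by (simp add: d_sym)
    qed
    ultimately have "d v a + 1 = d z a" "d v b + 1 = d z b" "d v x + 1 = d z x"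
      using limb_dist[OF v(1)] v(2) by (auto simp: d_sym)
    then show False using Suc.hyps(1)[of v] Suc v adj_V' by auto
  qed
qed

end

section \<open>Isomorphism types of limbs\<close>

datatype rtree = Node "rtree multiset"

text \<open>The isomorphism type of the limb at \<open>w\<close>, seen from its neighbour \<open>u\<close> and cut off below distance \<open>m\<close>
  from \<open>w\<close>.\<close>

primrec tcode :: "('a \<Rightarrow> 'a \<Rightarrow> bool) \<Rightarrow> nat \<Rightarrow> 'a \<Rightarrow> 'a \<Rightarrow> rtree" where
  "tcode E 0 u w = Node {#}"
| "tcode E (Suc m) u w = Node (image_mset (tcode E m w) (mset_set ({v. E w v} - {u})))"

primrec height :: "rtree \<Rightarrow> nat" where
  "height (Node M) = Suc (Max (insert 0 (set_mset (image_mset height M))))"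

lemma less_height_Node: "i < height (Node M) \<longleftrightarrow> i = 0 \<or> (\<exists>C\<in>#M. i - 1 < height C)"
proof -
  have "i < height (Node M) \<longleftrightarrow> (\<exists>a\<in>insert 0 (height ` set_mset M). i \<le> a)"
    by (simp add: less_Suc_eq_le Max_ge_iff del: Max_insert)
  also have "\<dots> \<longleftrightarrow> i = 0 \<or> (\<exists>C\<in>#M. i \<le> height C)" by auto
  also have "\<dots> \<longleftrightarrow> i = 0 \<or> (\<exists>C\<in>#M. i - 1 < height C)"
  proof -
    have "height C > 0" for C by (cases C) simp
    then show ?thesis by (cases i) (auto simp: Suc_le_eq)
  qed
  finally show ?thesis .
qed

definition iemb :: "('a \<Rightarrow> 'a \<Rightarrow> bool) \<Rightarrow> 'a set \<Rightarrow> ('b \<Rightarrow> 'b \<Rightarrow> bool) \<Rightarrow> ('a \<Rightarrow> 'b) \<Rightarrow> bool" where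
  "iemb E S E' f \<longleftrightarrow> inj_on f S \<and> (\<forall>x\<in>S. \<forall>y\<in>S. E' (f x) (f y) \<longleftrightarrow> E x y)"

lemma iemb_subset: "iemb E S E' f \<Longrightarrow> A \<subseteq> S \<Longrightarrow> iemb E A E' f"
  unfolding iemb_def by (meson inj_on_subset subset_iff)

lemma image_mset_set_eq_bij:
  assumes "finite A" "finite B" "image_mset f (mset_set A) = image_mset g (mset_set B)"
  obtains s where "bij_betw s A B" "\<And>a. a \<in> A \<Longrightarrow> f a = g (s a)"
proof -
  have "\<exists>s. bij_betw s A B \<and> (\<forall>a\<in>A. f a = g (s a))"
    using assms
  proof (induction A arbitrary: B rule: finite_induct)
    case empty
    then have "B = {}" by (simp add: mset_set_empty_iff)
    then show ?case by (simp add: bij_betw_def)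
  next
    case (insert a A)
    have "f a \<in># image_mset g (mset_set B)"
      using insert.prems(2) insert.hyps by (metis (no_types) finite_insert insertI1 image_eqI
          finite_set_mset_mset_set set_image_mset)
    then obtain b where b: "b \<in> B" "f a = g b" using insert.prems(1) by auto
    have "mset_set B = add_mset b (mset_set (B - {b}))"
      using b insert.prems(1) by (simp add: mset_set.remove)
    then have "image_mset f (mset_set A) = image_mset g (mset_set (B - {b}))"
      using insert b by simp
    then obtain s where s: "bij_betw s A (B - {b})" "\<forall>a\<in>A. f a = g (s a)"
      using insert.IH[of "B - {b}"] insert.prems(1) by auto
    have "bij_betw (s(a := b)) (insert a A) (insert b (B - {b}))"
      using s(1) insert.hyps(2) by (auto simp: bij_betw_def inj_on_def)
    then show ?case using s b insert.hyps(2)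
      by (intro exI[of _ "s(a := b)"]) (auto simp: insert_absorb simp del: fun_upd_apply; auto)
  qed
  then show ?thesis using that by blast
qed

context tree_graph
begin

lemma limb_dist': "E u w \<Longrightarrow> x \<in> limb u w \<Longrightarrow> d u x = d w x + 1"
  using limb_dist[of u w x] by (simp only: d_sym)

text \<open>The vertex set whose rooted isomorphism type is \<open>tcode E m u w\<close>;
  \<open>code_iso\<close> and \<open>iso_code\<close> make this precise.\<close>

definition trunc :: "nat \<Rightarrow> 'a \<Rightarrow> 'a \<Rightarrow> 'a set" where
  "trunc m u w = {y \<in> limb u w. d w y \<le> m}"

lemma trunc_V: "trunc m u w \<subseteq> V" using limb_V by (auto simp: trunc_def)
lemma finite_trunc [simp]: "finite (trunc m u w)" by (simp add: trunc_def)
lemma trunc_self: "E u w \<Longrightarrow> w \<in> trunc m u w" using limb_self by (simp add: trunc_def)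
lemma trunc_limb: "trunc m u w \<subseteq> limb u w" by (auto simp: trunc_def)
lemma trunc_0: "E u w \<Longrightarrow> trunc 0 u w = {w}"
  using limb_self limb_V adj_V' by (fastforce simp: trunc_def d_eq_0)

lemma trunc_Suc:
  assumes "E u w"
  shows "trunc (Suc m) u w = insert w (\<Union>v\<in>{v. E w v} - {u}. trunc m w v)" (is "?L = ?R")
proof (intro set_eqI iffI)
  fix y assume y: "y \<in> ?L"
  show "y \<in> ?R"
  proof (cases "y = w")
    case False
    then obtain v where v: "v \<in> {v. E w v} - {u}" "y \<in> limb w v"
      using y limb_rec[OF assms] by (auto simp: trunc_def)
    then have "y \<in> trunc m w v" using y limb_dist[of w v y] by (auto simp: trunc_def d_sym)
    then show ?thesis using v by blast
  qed simp
next
  fix y assume y: "y \<in> ?R"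
  show "y \<in> ?L"
  proof (cases "y = w")
    case True then show ?thesis using assms trunc_self by simp
  next
    case False
    then obtain v where v: "E w v" "v \<noteq> u" "y \<in> trunc m w v" using y by blast
    then have "y \<in> limb u w" using limb_subset[OF assms v(1,2)] trunc_limb by blast
    then show ?thesis using v limb_dist'[OF v(1)] by (simp add: trunc_def)
  qed
qed

lemma trunc_closed:
  assumes "E u w" shows "closed w (trunc m u w)"
  using closed_limb[OF assms] unfolding closed_def trunc_def by auto

text \<open>Distances stay below the number of vertices, so the parameter \<open>card V\<close>
  amounts to no truncation. This is the reason for its use in \<open>code\<close>.\<close>

lemma trunc_big:
  assumes "E u w" "card V \<le> m" shows "trunc m u w = limb u w"
proof -
  have "d w y \<le> m" if "y \<in> limb u w" for y
  proof -
    have "card (interval w y) \<le> card V" using interval_V finite_V card_mono by blast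
    moreover have "card (interval w y) = d w y + 1"
      using assms(1) that limb_V adj_V' by (intro interval_card) blast+
    ultimately show ?thesis using assms(2) by simp
  qed
  then show ?thesis by (auto simp: trunc_def)
qed

lemma less_height_tcode:
  "E u w \<Longrightarrow> i < height (tcode E m u w) \<longleftrightarrow> (\<exists>y\<in>trunc m u w. d w y = i)"
proof (induction m arbitrary: u w i)
  case 0
  then show ?case by (auto simp: trunc_0)
next
  case (Suc m)
  have "i < height (tcode E (Suc m) u w) \<longleftrightarrow> i = 0 \<or> (\<exists>v\<in>{v. E w v} - {u}. i - 1 < height (tcode E m w v))"
    by (simp add: less_height_Node del: height.simps)
  also have "\<dots> \<longleftrightarrow> i = 0 \<or> (\<exists>v\<in>{v. E w v} - {u}. \<exists>y\<in>trunc m w v. d v y = i - 1)"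
    using Suc.IH by auto
  also have "\<dots> \<longleftrightarrow> (\<exists>y\<in>trunc (Suc m) u w. d w y = i)"
  proof (cases "i = 0")
    case True
    then show ?thesis using trunc_self[OF Suc.prems, of "Suc m"] d_self by blast
  next
    case False
    have *: "d w y = d v y + 1" if "E w v" "y \<in> trunc m w v" for v y
      using limb_dist'[OF that(1)] that(2) trunc_limb by blast
    show ?thesis unfolding trunc_Suc[OF Suc.prems] using False * by fastforce
  qed
  finally show ?case .
qed

text \<open>Counted from \<open>u\<close>, so that it is the height of the code in vertices.\<close>

definition depth :: "'a \<Rightarrow> 'a \<Rightarrow> nat" where
  "depth u w = Max (d u ` limb u w)"

lemma depth_ge: "x \<in> limb u w \<Longrightarrow> d u x \<le> depth u w"
  unfolding depth_def by (intro Max_ge) auto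

lemma depth_ex:
  assumes "E u w" obtains x where "x \<in> limb u w" "d u x = depth u w"
proof -
  have "depth u w \<in> d u ` limb u w"
    unfolding depth_def using limb_self[OF assms] by (intro Max_in) auto
  then show ?thesis using that by auto
qed

lemma depth_pos: "E u w \<Longrightarrow> depth u w \<ge> 1"
  using depth_ge[OF limb_self, of u w] d_adj by force

lemma depth_le_card:
  assumes "E u w" shows "depth u w \<le> card (limb u w)"
proof -
  obtain x where x: "x \<in> limb u w" "d u x = depth u w" using depth_ex assms .
  have "interval w x \<subseteq> limb u w" using limb_convex[OF assms limb_self[OF assms] x(1)] .
  then have "card (interval w x) \<le> card (limb u w)" by (simp add: card_mono)
  then show ?thesis using interval_card[of w x] x limb_dist[OF assms x(1)] assms adj_V' limb_V
    by (simp add: d_sym subset_iff)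
qed

abbreviation code :: "'a \<Rightarrow> 'a \<Rightarrow> rtree" where "code \<equiv> tcode E (card V)"

lemma height_tcode_depth:
  assumes "E u w" "depth u w \<le> Suc m"
  shows "height (tcode E m u w) = depth u w"
proof -
  have "i < height (tcode E m u w) \<longleftrightarrow> i < depth u w" for i
  proof -
    have trunc: "trunc m u w = limb u w"
      using depth_ge[of _ u w] limb_dist[OF assms(1)] assms(2) by (force simp: trunc_def d_sym)
    have "(\<exists>y\<in>limb u w. d w y = i) \<longleftrightarrow> i < depth u w"
    proof
      assume "\<exists>y\<in>limb u w. d w y = i"
      then show "i < depth u w" using depth_ge[of _ u w] limb_dist[OF assms(1)] by (force simp: d_sym)
    next
      assume i: "i < depth u w"
      obtain x where x: "x \<in> limb u w" "d u x = depth u w" using depth_ex assms(1) .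
      then have "i \<le> d w x" using limb_dist'[OF assms(1) x(1)] i by simp
      then obtain q where "q \<in> interval w x" "d w q = i"
        using interval_ex[of w x i] x limb_V adj_V'[OF assms(1)] by blast
      then show "\<exists>y\<in>limb u w. d w y = i"
        using limb_convex[OF assms(1) limb_self[OF assms(1)] x(1)] by blast
    qed
    then show ?thesis using less_height_tcode[OF assms(1)] trunc by simp
  qed
  then show ?thesis by (meson linorder_neqE_nat less_irrefl)
qed

lemma depth_le: "E u w \<Longrightarrow> depth u w \<le> card V"
  using depth_le_card[of u w] card_mono[OF finite_V limb_V, of u w] by simp

lemma height_code: "E u w \<Longrightarrow> height (code u w) = depth u w"
  using height_tcode_depth depth_le by (simp add: le_SucI)

lemma depth_child: "E u w \<Longrightarrow> E w v \<Longrightarrow> v \<noteq> u \<Longrightarrow> depth w v < depth u w"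
proof -
  assume *: "E u w" "E w v" "v \<noteq> u"
  obtain x where x: "x \<in> limb w v" "d w x = depth w v" using depth_ex *(2) .
  then have "x \<in> limb u w" using limb_subset[OF *] by blast
  then show ?thesis using depth_ge[of x u w] limb_dist'[OF *(1), of x] x by simp
qed

lemma tcode_stable:
  "E u w \<Longrightarrow> depth u w \<le> Suc m \<Longrightarrow> depth u w \<le> Suc m' \<Longrightarrow> tcode E m u w = tcode E m' u w"
proof (induction m arbitrary: m' u w)
  case 0
  have *: "{v. E w v} - {u} = {}" using depth_child[OF 0(1)] 0(2) depth_pos by fastforce
  show ?case by (cases m') (simp_all only: tcode.simps * mset_set.empty image_mset_empty)
next
  case (Suc m)
  show ?case
  proof (cases m')
    case 0
    have *: "{v. E w v} - {u} = {}" using depth_child[OF Suc.prems(1)] Suc.prems(3) 0 depth_pos by fastforce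
    show ?thesis by (simp only: 0 tcode.simps * mset_set.empty image_mset_empty)
  next
    case (Suc k)
    have "tcode E m w v = tcode E k w v" if "v \<in> {v. E w v} - {u}" for v
      using that depth_child[of u w v] Suc.prems Suc by (intro Suc.IH) auto
    then show ?thesis using Suc
      by (auto intro!: image_mset_cong)
  qed
qed

text \<open>Unfolding \<open>tcode\<close> lowers the parameter for the children by one. Starting
  from \<open>Suc (card V)\<close>, which gives the same code by \<open>tcode_stable\<close>, leaves
  the children with exactly \<open>card V\<close>.\<close>

lemma code_rec:
  assumes "E u w"
  shows "code u w = Node (image_mset (code w) (mset_set ({v. E w v} - {u})))"
proof -
  have "code u w = tcode E (Suc (card V)) u w"
    using assms depth_le by (intro tcode_stable) (auto simp: le_SucI)
  then show ?thesis by simp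
qed

end

section \<open>Codes as complete invariants of truncated limbs\<close>

locale two_trees = A: tree_graph V E + B: tree_graph V' E'
  for V :: "'a set" and E and V' :: "'b set" and E'
begin

text \<open>Along a path of \<open>C\<close> the image never turns back, since \<open>f\<close> is
  injective, and in a tree a walk that never turns back is a shortest path. Hence all notions
  defined by distances transfer along copies of subtrees.\<close>

lemma iemb_dist:
  assumes "A.closed w C" "iemb E C E' f" "f ` C \<subseteq> V'" "x \<in> C" "y \<in> C"
  shows "B.d (f x) (f y) = A.d x y"
proof -
  have cl: "A.closed x C" using A.closed_any assms(1,4) .
  have CV: "C \<subseteq> V" using cl A.closed_def by blast
  show ?thesis using assms(5)
  proof (induction "A.d x y" arbitrary: y rule: less_induct)
    case less
    show ?case
    proof (cases "y = x")
      case False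
      then obtain y' where y': "E y y'" "A.d x y = A.d x y' + 1"
        using A.ex_closer[of x y] CV less.prems assms(4) by blast
      have y'C: "y' \<in> C" using cl y' less.prems A.closed_def by blast
      have IH: "B.d (f x) (f y') = A.d x y'" using less.hyps y' y'C by simp
      have E': "E' (f y') (f y)" using y' y'C less.prems assms(2) A.adj_sym by (simp add: iemb_def)
      have V': "f x \<in> V'" using assms by blast
      show ?thesis
      proof (cases "y' = x")
        case True
        then show ?thesis using E' y' B.d_adj by simp
      next
        case False
        then obtain v where v: "E y' v" "A.d x y' = A.d x v + 1"
          using A.ex_closer[of x y'] CV y'C assms(4) by blast
        have vC: "v \<in> C" using cl v y'C A.closed_def by blast
        have "B.d (f x) (f v) = A.d x v" using less.hyps v y' vC by simp
        moreover have "E' (f y') (f v)" using v vC y'C assms(2) by (simp add: iemb_def)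
        moreover have "f v \<noteq> f y"
          using v y' vC less.prems assms(2) by (auto simp: iemb_def dest: inj_onD)
        ultimately have "\<not> B.d (f x) (f y) \<le> B.d (f x) (f y')"
          using B.unique_closer[OF V' _ E', of "f v"] IH v(2) by auto
        then show ?thesis using B.d_step[OF V' E'] IH y'(2) by simp
      qed
    qed simp
  qed
qed

text \<open>Equal multisets of codes allow the branches to be matched one to one; the isomorphisms
  of matched branches fit together because distinct branches have no edges between them. The sets
  \<open>A0\<close> and \<open>B0\<close> are arbitrary, so this covers a limb (all neighbours but
  one) as well as a choice of branches at a vertex.\<close>

lemma gluing:
  assumes "A0 \<subseteq> {v. E w v}" "B0 \<subseteq> {v. E' w' v}"
    and "image_mset (tcode E m w) (mset_set A0) = image_mset (tcode E' m w') (mset_set B0)"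
    and IH: "\<And>v v'. v \<in> A0 \<Longrightarrow> v' \<in> B0 \<Longrightarrow> tcode E m w v = tcode E' m w' v' \<Longrightarrow>
      \<exists>f. bij_betw f (A.trunc m w v) (B.trunc m w' v') \<and> f v = v' \<and> iemb E (A.trunc m w v) E' f"
  shows "\<exists>g. bij_betw g (insert w (\<Union>v\<in>A0. A.trunc m w v)) (insert w' (\<Union>v\<in>B0. B.trunc m w' v)) \<and>
    g w = w' \<and> iemb E (insert w (\<Union>v\<in>A0. A.trunc m w v)) E' g"
proof -
  have fin: "finite A0" "finite B0" using assms(1,2) finite_subset A.finite_nbr B.finite_nbr by metis+
  obtain s where s: "bij_betw s A0 B0" "\<And>v. v \<in> A0 \<Longrightarrow> tcode E m w v = tcode E' m w' (s v)"
    using image_mset_set_eq_bij[OF fin assms(3)] by blast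
  have sB: "s v \<in> B0" if "v \<in> A0" for v using s(1) that bij_betwE by blast
  have "\<forall>v\<in>A0. \<exists>f. bij_betw f (A.trunc m w v) (B.trunc m w' (s v)) \<and> f v = s v \<and> iemb E (A.trunc m w v) E' f"
    using IH sB s(2) by blast
  then obtain F where F: "\<And>v. v \<in> A0 \<Longrightarrow> bij_betw (F v) (A.trunc m w v) (B.trunc m w' (s v))"
    "\<And>v. v \<in> A0 \<Longrightarrow> F v v = s v" "\<And>v. v \<in> A0 \<Longrightarrow> iemb E (A.trunc m w v) E' (F v)"
    by (metis (no_types))
  define br where "br y = (THE v. E w v \<and> y \<in> A.limb w v)" for y
  have br: "br y = v" if "v \<in> A0" "y \<in> A.trunc m w v" for v y
    unfolding br_def using that assms(1) A.trunc_limb A.branch_unique by (intro the_equality) blast+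
  define g where "g y = (if y = w then w' else F (br y) y)" for y
  have w_not: "w \<notin> A.trunc m w v" "w' \<notin> B.trunc m w' v'" for v v'
    using A.limb_not A.trunc_limb B.limb_not B.trunc_limb by blast+
  have g: "g y = F v y" if "v \<in> A0" "y \<in> A.trunc m w v" for v y
    using that br w_not unfolding g_def by auto
  have g_in: "g y \<in> B.trunc m w' (s v)" if "v \<in> A0" "y \<in> A.trunc m w v" for v y
    using g[OF that] F(1)[OF that(1)] that(2) bij_betwE by metis
  have gw: "g w = w'" by (simp add: g_def)
  let ?S = "insert w (\<Union>v\<in>A0. A.trunc m w v)"
  have far: "\<not> E y1 y2" if "E w v1" "E w v2" "v1 \<noteq> v2" "y1 \<in> A.limb w v1" "y2 \<in> A.limb w v2" for y1 y2 v1 v2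
  proof
    assume e: "E y1 y2"
    have "y2 \<notin> A.limb w v1" using that A.branch_unique by blast
    then have "A.d y1 y2 = A.d y1 w + A.d w y2"
      using A.branches_cross[OF that(1,4), of y2] that(5) A.limb_V by blast
    moreover have "A.d y1 w \<ge> 1" "A.d w y2 \<ge> 1"
      using A.limb_dist that by (fastforce simp: A.d_sym)+
    ultimately show False using A.d_adj[OF e] by simp
  qed
  have far': "\<not> E' y1 y2" if "E' w' v1" "E' w' v2" "v1 \<noteq> v2" "y1 \<in> B.limb w' v1" "y2 \<in> B.limb w' v2" for y1 y2 v1 v2
  proof
    assume e: "E' y1 y2"
    have "y2 \<notin> B.limb w' v1" using that B.branch_unique by blast
    then have "B.d y1 y2 = B.d y1 w' + B.d w' y2"
      using B.branches_cross[OF that(1,4), of y2] that(5) B.limb_V by blast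
    moreover have "B.d y1 w' \<ge> 1" "B.d w' y2 \<ge> 1"
      using B.limb_dist that by (fastforce simp: B.d_sym)+
    ultimately show False using B.d_adj[OF e] by simp
  qed
  have inj: "inj_on g ?S"
  proof (rule inj_onI)
    fix y1 y2 assume y: "y1 \<in> ?S" "y2 \<in> ?S" "g y1 = g y2"
    have nw: "g y \<noteq> w'" if "y \<in> ?S" "y \<noteq> w" for y using that g_in w_not by fastforce
    show "y1 = y2"
    proof (cases "y1 = w \<or> y2 = w")
      case True then show ?thesis using nw y gw by metis
    next
      case False
      then obtain v1 v2 where v: "v1 \<in> A0" "y1 \<in> A.trunc m w v1" "v2 \<in> A0" "y2 \<in> A.trunc m w v2"
        using y by blast
      have "s v1 = s v2"
        using B.branch_unique[of w' "s v1" "s v2" "g y1"] g_in[OF v(1,2)] g_in[OF v(3,4)] y(3)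
          sB v assms(2) B.trunc_limb by (metis mem_Collect_eq subset_iff)
      then have "v1 = v2" using s(1) v by (auto simp: bij_betw_def dest: inj_onD)
      then show ?thesis using F(1)[OF v(1)] v y(3) g by (auto simp: bij_betw_def dest: inj_onD)
    qed
  qed
  have "g ` ?S = insert w' (\<Union>v\<in>A0. g ` A.trunc m w v)" using gw by auto
  also have "(\<Union>v\<in>A0. g ` A.trunc m w v) = (\<Union>v\<in>A0. B.trunc m w' (s v))"
    using g F(1) by (intro SUP_cong refl) (metis (no_types, lifting) bij_betw_def image_cong)
  also have "\<dots> = (\<Union>v\<in>B0. B.trunc m w' v)" using s(1) by (auto simp: bij_betw_def)
  finally have img: "g ` ?S = insert w' (\<Union>v\<in>B0. B.trunc m w' v)" .
  have edge_w: "E' w' (g y) \<longleftrightarrow> E w y" if yS: "y \<in> ?S" for y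
  proof (cases "y = w")
    case True then show ?thesis using gw A.adj_irrefl B.adj_irrefl by simp
  next
    case False
    then obtain v where v: "v \<in> A0" "y \<in> A.trunc m w v" using yS by blast
    have Ev: "E w v" "E' w' (s v)" using v assms(1,2) sB by auto
    have L: "y \<in> A.limb w v" "g y \<in> B.limb w' (s v)"
      using v g_in[OF v] A.trunc_limb B.trunc_limb by blast+
    have "E w y \<longleftrightarrow> y = v"
      using A.branch_unique[OF Ev(1) _ L(1) A.limb_self] Ev by auto
    moreover have "E' w' (g y) \<longleftrightarrow> g y = s v"
      using B.branch_unique[OF Ev(2) _ L(2) B.limb_self] Ev by auto
    moreover have "g v = s v" "v \<in> A.trunc m w v" using g[OF v(1)] F(2) v A.trunc_self Ev by auto
    then have "g y = s v \<longleftrightarrow> y = v" using inj yS v by (metis UN_I inj_onD insertI2)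
    ultimately show ?thesis by simp
  qed
  have "iemb E ?S E' g"
    unfolding iemb_def
  proof (intro conjI ballI)
    fix y1 y2 assume y: "y1 \<in> ?S" "y2 \<in> ?S"
    show "E' (g y1) (g y2) \<longleftrightarrow> E y1 y2"
    proof (cases "y1 = w \<or> y2 = w")
      case True then show ?thesis using edge_w y gw A.adj_sym B.adj_sym by metis
    next
      case False
      then obtain v1 v2 where v: "v1 \<in> A0" "y1 \<in> A.trunc m w v1" "v2 \<in> A0" "y2 \<in> A.trunc m w v2"
        using y by blast
      show ?thesis
      proof (cases "v1 = v2")
        case True
        then show ?thesis using F(3)[OF v(1)] g v by (simp add: iemb_def)
      next
        case False
        then have "s v1 \<noteq> s v2" using s(1) v by (auto simp: bij_betw_def dest: inj_onD)
        moreover have "E w v1" "E w v2" "E' w' (s v1)" "E' w' (s v2)"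
          using v sB assms(1,2) by auto
        ultimately show ?thesis using far[of v1 v2 y1 y2] far'[of "s v1" "s v2" "g y1" "g y2"]
            False v g_in A.trunc_limb B.trunc_limb by blast
      qed
    qed
  qed (rule inj)
  then show ?thesis using inj img gw by (auto simp: bij_betw_def)
qed

lemma code_iso:
  "E u w \<Longrightarrow> E' u' w' \<Longrightarrow> tcode E m u w = tcode E' m u' w' \<Longrightarrow>
    \<exists>f. bij_betw f (A.trunc m u w) (B.trunc m u' w') \<and> f w = w' \<and> iemb E (A.trunc m u w) E' f"
proof (induction m arbitrary: u w u' w')
  case 0
  then show ?case
    by (intro exI[of _ "\<lambda>_. w'"]) (auto simp: A.trunc_0 B.trunc_0 iemb_def A.adj_irrefl B.adj_irrefl bij_betw_def)
next
  case (Suc m)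
  have "image_mset (tcode E m w) (mset_set ({v. E w v} - {u}))
      = image_mset (tcode E' m w') (mset_set ({v. E' w' v} - {u'}))" using Suc.prems(3) by simp
  then show ?case
    unfolding A.trunc_Suc[OF Suc.prems(1)] B.trunc_Suc[OF Suc.prems(2)]
    by (intro gluing) (use Suc.IH in auto)
qed

text \<open>Induction on \<open>m\<close>: being distance preserving, \<open>f\<close> maps the
  neighbours of \<open>w\<close> inside the limb to those of \<open>w'\<close> and each truncated
  branch onto the corresponding one.\<close>

lemma iso_code:
  "E u w \<Longrightarrow> E' u' w' \<Longrightarrow> bij_betw f (A.trunc m u w) (B.trunc m u' w') \<Longrightarrow> f w = w' \<Longrightarrow>
    iemb E (A.trunc m u w) E' f \<Longrightarrow> tcode E m u w = tcode E' m u' w'"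
proof (induction m arbitrary: u w u' w')
  case 0
  then show ?case by simp
next
  case (Suc m)
  note LTS = A.trunc_Suc[OF Suc.prems(1), of m] B.trunc_Suc[OF Suc.prems(2), of m]
  let ?S = "A.trunc (Suc m) u w" and ?S' = "B.trunc (Suc m) u' w'"
  have dist: "B.d (f x) (f y) = A.d x y" if "x \<in> ?S" "y \<in> ?S" for x y
    using iemb_dist[OF A.trunc_closed[OF Suc.prems(1)] Suc.prems(5) _ that]
      Suc.prems(3) B.trunc_V by (metis bij_betw_def)
  have wS: "w \<in> ?S" "w' \<in> ?S'" using Suc.prems A.trunc_self B.trunc_self by auto
  have nb: "{v. E w v} - {u} = {v \<in> ?S. E w v}"
  proof -
    have "u \<notin> ?S" using A.trunc_limb A.limb_not by blast
    moreover have "{v. E w v} - {u} \<subseteq> ?S" unfolding LTS using A.trunc_self by blast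
    ultimately show ?thesis by blast
  qed
  have nb': "{v. E' w' v} - {u'} = {v \<in> ?S'. E' w' v}"
  proof -
    have "u' \<notin> ?S'" using B.trunc_limb B.limb_not by blast
    moreover have "{v. E' w' v} - {u'} \<subseteq> ?S'" unfolding LTS using B.trunc_self by blast
    ultimately show ?thesis by blast
  qed
  have im: "f ` ({v. E w v} - {u}) = {v. E' w' v} - {u'}"
  proof -
    have "f ` {v \<in> ?S. E w v} = {v \<in> f ` ?S. E' w' v}"
    proof -
      have "E' w' (f v) \<longleftrightarrow> E w v" if "v \<in> ?S" for v
        using Suc.prems(4,5) wS(1) that unfolding iemb_def by blast
      then show ?thesis by blast
    qed
    then show ?thesis unfolding nb nb' using Suc.prems(3) by (simp add: bij_betw_def)
  qed
  have inj: "inj_on f ({v. E w v} - {u})"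
  proof (rule inj_on_subset)
    show "inj_on f ?S" using Suc.prems(3) by (simp add: bij_betw_def)
    show "{v. E w v} - {u} \<subseteq> ?S" using nb by blast
  qed
  have "tcode E m w v = tcode E' m w' (f v)" if v: "v \<in> {v. E w v} - {u}" for v
  proof (rule Suc.IH)
    have fv: "f v \<in> {v. E' w' v} - {u'}" using im v by blast
    show "E w v" "E' w' (f v)" "f v = f v" using v fv by auto
    have sub: "A.trunc m w v \<subseteq> ?S" "B.trunc m w' (f v) \<subseteq> ?S'"
      unfolding LTS using v fv by blast+
    have vS: "v \<in> ?S" using v nb by blast
    show "iemb E (A.trunc m w v) E' f" using Suc.prems(5) sub iemb_subset by blast
    \<comment> \<open>Branches rewritten by distances to vertices of \<open>?S\<close> only, in the
      form that \<open>dist\<close> carries over to the other tree.\<close>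
    have L: "A.trunc m w v = {y \<in> ?S. A.d y v < A.d y w \<and> A.d v y \<le> m}"
      using sub(1) A.trunc_V[of "Suc m" u w] by (auto simp: A.trunc_def[of m w v] A.limb_def[of w v])
    have L': "B.trunc m w' (f v) = {y \<in> ?S'. B.d y (f v) < B.d y w' \<and> B.d (f v) y \<le> m}"
      using sub(2) B.trunc_V[of "Suc m" u' w']
      by (auto simp: B.trunc_def[of m w' "f v"] B.limb_def[of w' "f v"])
    have "f ` A.trunc m w v = B.trunc m w' (f v)"
    proof -
      have "f ` {y \<in> ?S. A.d y v < A.d y w \<and> A.d v y \<le> m}
          = {y \<in> f ` ?S. B.d y (f v) < B.d y w' \<and> B.d (f v) y \<le> m}"
        using dist wS(1) vS Suc.prems(4) by auto
      then show ?thesis using L L' Suc.prems(3) by (simp add: bij_betw_def)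
    qed
    moreover have "inj_on f (A.trunc m w v)"
      using Suc.prems(3) inj_on_subset[OF _ sub(1), of f] unfolding bij_betw_def by blast
    ultimately show "bij_betw f (A.trunc m w v) (B.trunc m w' (f v))" by (simp add: bij_betw_def)
  qed
  then have "image_mset (tcode E m w) (mset_set ({v. E w v} - {u}))
      = image_mset (\<lambda>v. tcode E' m w' (f v)) (mset_set ({v. E w v} - {u}))"
    by (intro image_mset_cong) simp
  also have "\<dots> = image_mset (tcode E' m w') (image_mset f (mset_set ({v. E w v} - {u})))"
    by (simp add: image_mset.compositionality comp_def)
  also have "\<dots> = image_mset (tcode E' m w') (mset_set ({v. E' w' v} - {u'}))"
    using image_mset_mset_set[OF inj] im by simp
  finally show ?case by simp
qed

end

section \<open>Induced embeddings and anchored limbs\<close>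

primrec rsize :: "rtree \<Rightarrow> nat" where
  "rsize (Node M) = Suc (\<Sum>\<^sub># (image_mset rsize M))"

definition Embs :: "'c set \<Rightarrow> ('c \<Rightarrow> 'c \<Rightarrow> bool) \<Rightarrow> 'a set \<Rightarrow> ('a \<Rightarrow> 'a \<Rightarrow> bool) \<Rightarrow> ('c \<Rightarrow> 'a) set" where
  "Embs X F V E = {f \<in> X \<rightarrow>\<^sub>E V. iemb F X E f}"

text \<open>The triple \<open>p0\<close> marks the start of the path and the two ends of the edge
  before the limb. Fixing its image \<open>p\<close> sorts the copies of a pattern by the anchored
  limb that they occupy.\<close>

definition anchored_Embs :: "'c set \<Rightarrow> ('c \<Rightarrow> 'c \<Rightarrow> bool) \<Rightarrow> 'c \<times> 'c \<times> 'c \<Rightarrow> 'a set \<Rightarrow> ('a \<Rightarrow> 'a \<Rightarrow> bool) \<Rightarrow>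
    'a \<times> 'a \<times> 'a \<Rightarrow> ('c \<Rightarrow> 'a) set" where
  "anchored_Embs X F p0 V E p = {f \<in> Embs X F V E. map_prod f (map_prod f f) p0 = p}"

lemma finite_Embs: "finite X \<Longrightarrow> finite V \<Longrightarrow> finite (Embs X F V E)"
  unfolding Embs_def using finite_PiE[of X "\<lambda>_. V"] by simp

lemma finite_anchored_Embs: "finite X \<Longrightarrow> finite V \<Longrightarrow> finite (anchored_Embs X F p0 V E p)"
  by (rule finite_subset[OF _ finite_Embs[of X V F E]]) (auto simp: anchored_Embs_def)

lemma iemb_comp:
  "iemb F X E f \<Longrightarrow> f ` X \<subseteq> M \<Longrightarrow> iemb E M E' g \<Longrightarrow> iemb F X E' (restrict (g \<circ> f) X)"
  unfolding iemb_def by (auto simp: inj_on_def image_subset_iff)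

lemma iemb_inv:
  assumes "bij_betw g M M'" "iemb E M E' g"
  shows "iemb E' M' E (inv_into M g)"
proof -
  have "inv_into M g y \<in> M" "g (inv_into M g y) = y" if "y \<in> M'" for y
    using assms(1) that by (auto simp: bij_betw_def inv_into_into f_inv_into_f)
  then show ?thesis using assms(2) bij_betw_inv_into[OF assms(1)]
    unfolding iemb_def bij_betw_def by metis
qed

lemma card_anchored_Embs_le:
  assumes "finite X" "finite M'" "bij_betw g M M'" "iemb E M E' g" "p0 \<in> X \<times> X \<times> X"
  shows "card (anchored_Embs X F p0 M E p) \<le> card (anchored_Embs X F p0 M' E' (map_prod g (map_prod g g) p))"
proof (rule card_inj_on_le)
  let ?c = "\<lambda>f. restrict (g \<circ> f) X"
  show "inj_on ?c (anchored_Embs X F p0 M E p)"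
  proof (rule inj_onI)
    fix f1 f2 assume f: "f1 \<in> anchored_Embs X F p0 M E p" "f2 \<in> anchored_Embs X F p0 M E p" "?c f1 = ?c f2"
    have f12: "f1 \<in> X \<rightarrow>\<^sub>E M" "f2 \<in> X \<rightarrow>\<^sub>E M" using f by (auto simp: anchored_Embs_def Embs_def)
    have "f1 y = f2 y" if "y \<in> X" for y
    proof -
      have "g (f1 y) = g (f2 y)" using fun_cong[OF f(3), of y] that by simp
      then show ?thesis using assms(3) f12 that by (auto simp: bij_betw_def dest: inj_onD)
    qed
    then show "f1 = f2" using f12 by (intro PiE_ext) auto
  qed
  show "?c ` anchored_Embs X F p0 M E p \<subseteq> anchored_Embs X F p0 M' E' (map_prod g (map_prod g g) p)"
  proof
    fix h assume "h \<in> ?c ` anchored_Embs X F p0 M E p"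
    then obtain f where f: "f \<in> anchored_Embs X F p0 M E p" "h = ?c f" by blast
    then have fM: "f ` X \<subseteq> M" by (auto simp: anchored_Embs_def Embs_def)
    have "g ` M = M'" using assms(3) by (simp add: bij_betw_def)
    then have "h \<in> X \<rightarrow>\<^sub>E M'" unfolding f(2) using fM by (intro restrict_PiE_iff[THEN iffD2]) auto
    moreover have "iemb F X E' h"
      using iemb_comp[OF _ fM assms(4)] f by (auto simp: anchored_Embs_def Embs_def)
    ultimately show "h \<in> anchored_Embs X F p0 M' E' (map_prod g (map_prod g g) p)"
      using f assms(5) by (cases p0) (auto simp: anchored_Embs_def Embs_def)
  qed
  show "finite (anchored_Embs X F p0 M' E' (map_prod g (map_prod g g) p))"
    using assms(1,2) by (rule finite_anchored_Embs)
qed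

lemma card_anchored_Embs_eq:
  assumes "finite X" "finite M'" "bij_betw g M M'" "iemb E M E' g" "p0 \<in> X \<times> X \<times> X" "p \<in> M \<times> M \<times> M"
  shows "card (anchored_Embs X F p0 M E p) = card (anchored_Embs X F p0 M' E' (map_prod g (map_prod g g) p))"
proof (rule antisym[OF card_anchored_Embs_le])
  let ?g = "inv_into M g"
  have fin: "finite M" using assms(2,3) bij_betw_finite by blast
  have "?g (g y) = y" if "y \<in> M" for y using that assms(3) by (auto simp: bij_betw_def)
  then have "map_prod ?g (map_prod ?g ?g) (map_prod g (map_prod g g) p) = p"
    using assms(6) by auto
  then show "card (anchored_Embs X F p0 M' E' (map_prod g (map_prod g g) p)) \<le> card (anchored_Embs X F p0 M E p)"
    using card_anchored_Embs_le[OF assms(1) fin bij_betw_inv_into[OF assms(3)] iemb_inv[OF assms(3,4)] assms(5),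
        of F "map_prod g (map_prod g g) p"] by simp
qed (use assms in auto)

section \<open>Limbs behind paths and their patterns\<close>

context tree_graph
begin

lemma trunc_disjoint:
  assumes "E w v" "E w v'" "v \<noteq> v'"
  shows "trunc m w v \<inter> trunc m w v' = {}"
  using branch_unique[OF assms(1,2)] assms(3) trunc_limb by blast

lemma rsize_tcode: "E u w \<Longrightarrow> rsize (tcode E m u w) = card (trunc m u w)"
proof (induction m arbitrary: u w)
  case 0
  then show ?case by (simp add: trunc_0)
next
  case (Suc m)
  have "card (\<Union>v\<in>{v. E w v} - {u}. trunc m w v) = (\<Sum>v\<in>{v. E w v} - {u}. card (trunc m w v))"
    by (intro card_UN_disjoint) (auto simp: trunc_disjoint)
  also have "\<dots> = (\<Sum>v\<in>{v. E w v} - {u}. rsize (tcode E m w v))"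
    using Suc.IH by (intro sum.cong) auto
  finally have "card (\<Union>v\<in>{v. E w v} - {u}. trunc m w v) = (\<Sum>v\<in>{v. E w v} - {u}. rsize (tcode E m w v))" .
  moreover have "w \<notin> (\<Union>v\<in>{v. E w v} - {u}. trunc m w v)" using limb_not trunc_limb by blast
  ultimately show ?case
    by (simp add: trunc_Suc[OF Suc.prems] card_insert_if sum_unfold_sum_mset image_mset.compositionality comp_def)
qed

text \<open>A limb with a path of length \<open>j\<close> from \<open>x\<close> to its root \<open>w\<close> in front of it. The set \<open>pattern m (x, u, w)\<close>
  consists of this path and the limb cut off at depth \<open>m\<close>.\<close>

definition anchored :: "nat \<Rightarrow> ('a \<times> 'a \<times> 'a) set" where
  "anchored j = {(x, u, w). E u w \<and> x \<in> limb w u \<and> d x w = j}"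

lemma finite_anchored [simp]: "finite (anchored j)"
proof -
  have "anchored j \<subseteq> V \<times> V \<times> V" using adj_V adj_V' by (auto simp: anchored_def limb_def)
  then show ?thesis using finite_V finite_subset by blast
qed

lemma anchored_D:
  assumes "(x, u, w) \<in> anchored j"
  shows "E u w" "x \<in> limb w u" "d x w = j" "d x u + 1 = j" "x \<in> V" "u \<in> V" "w \<in> V"
  using assms limb_dist[of w u x] adj_sym[of u w] adj_V adj_V' limb_V[of w u] by (auto simp: anchored_def)

definition pattern :: "nat \<Rightarrow> 'a \<times> 'a \<times> 'a \<Rightarrow> 'a set" where
  "pattern m = (\<lambda>(x, u, w). interval x u \<union> trunc m u w)"

abbreviation pcode :: "nat \<Rightarrow> 'a \<times> 'a \<times> 'a \<Rightarrow> rtree" where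
  "pcode m \<equiv> (\<lambda>(x, u, w). tcode E m u w)"

abbreviation code_count :: "nat \<Rightarrow> nat \<Rightarrow> rtree \<Rightarrow> nat" where
  "code_count j m Y \<equiv> card {p \<in> anchored j. pcode m p = Y}"

lemma interval_back: "(x, u, w) \<in> anchored j \<Longrightarrow> interval x u \<subseteq> limb w u"
  using limb_convex[of w u x u] anchored_D[of x u w j] adj_sym limb_self by blast

lemma pattern_mem:
  assumes "(x, u, w) \<in> anchored j"
  shows "x \<in> pattern m (x, u, w)" "u \<in> pattern m (x, u, w)" "w \<in> pattern m (x, u, w)" "pattern m (x, u, w) \<subseteq> V"
  using anchored_D[OF assms] interval_ends trunc_self trunc_V interval_V by (auto simp: pattern_def)

lemma finite_pattern [simp]: "finite (pattern m p)"
  by (cases p) (simp add: pattern_def)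

lemma interval_trunc_disjoint:
  assumes "(x, u, w) \<in> anchored j"
  shows "interval x u \<inter> trunc m u w = {}"
proof -
  have "limb u w \<inter> limb w u = {}" by (auto simp: limb_def)
  then show ?thesis using interval_back[OF assms] trunc_limb by blast
qed

lemma card_pattern:
  assumes "(x, u, w) \<in> anchored j"
  shows "card (pattern m (x, u, w)) = j + card (trunc m u w)"
  using interval_trunc_disjoint[OF assms] interval_card[of x u] anchored_D[OF assms]
  by (simp add: pattern_def card_Un_disjoint)

lemma closed_pattern:
  assumes "(x, u, w) \<in> anchored j"
  shows "closed w (pattern m (x, u, w))"
proof -
  have p: "E u w" "x \<in> V" "u \<in> V" "w \<in> V" using anchored_D[OF assms] by auto
  have "closed x (interval x w)" using closed_interval' p by blast
  then have 1: "closed w (interval x w)" using closed_any interval_ends p by blast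
  have "interval x w = insert w (interval x u)"
  proof (intro set_eqI iffI)
    fix q assume q: "q \<in> insert w (interval x u)"
    show "q \<in> interval x w"
    proof (cases "q = w")
      case True then show ?thesis using interval_ends p by simp
    next
      case False
      then have "q \<in> interval x u" "q \<in> limb w u" using q interval_back[OF assms] by auto
      moreover have "d q w = d q u + 1" using limb_dist[OF adj_sym[OF p(1)]] calculation(2) by blast
      ultimately show ?thesis using anchored_D[OF assms] by (simp add: interval_def)
    qed
  next
    fix q assume q: "q \<in> interval x w"
    show "q \<in> insert w (interval x u)"
    proof (cases "q = w")
      case False
      have "q \<notin> limb u w"
      proof
        assume "q \<in> limb u w"
        then have "d x q = d x w + d w q" using cross[OF p(1) anchored_D(2)[OF assms]] by blast
        then have "d w q = 0" using q by (simp add: interval_def d_sym)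
        then show False using False d_eq_0 p q interval_V by blast
      qed
      then have "q \<in> limb w u" using limb_compl[OF p(1)] q interval_V by blast
      then have "d q w = d q u + 1" using limb_dist[OF adj_sym[OF p(1)]] by blast
      then show ?thesis using q anchored_D[OF assms] by (simp add: interval_def)
    qed simp
  qed
  then have "pattern m (x, u, w) = interval x w \<union> trunc m u w" using trunc_self[OF p(1)] by (auto simp: pattern_def)
  then show ?thesis using closed_Un[OF 1 trunc_closed[OF p(1)]] by simp
qed

lemma interval_adj:
  assumes "x \<in> V" "u \<in> V" "y \<in> interval x u" "y' \<in> interval x u"
  shows "E y y' \<longleftrightarrow> d x y' = d x y + 1 \<or> d x y = d x y' + 1"
proof
  assume "E y y'" then show "d x y' = d x y + 1 \<or> d x y = d x y' + 1" using d_step assms by blast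
next
  have *: "E y y'" if y: "y \<in> interval x u" "y' \<in> interval x u" "d x y' = d x y + 1" for y y'
  proof -
    have "y' \<noteq> x" using y by auto
    then obtain q where q: "E y' q" "d x y' = d x q + 1"
      using ex_closer[of x y'] assms y interval_V by blast
    then have "q \<in> interval x u" using interval_step[OF assms(1) adj_sym q(2) assms(2) y(2)] by blast
    then have "q = y" using interval_unique y q assms by simp
    then show ?thesis using q adj_sym by blast
  qed
  assume "d x y' = d x y + 1 \<or> d x y = d x y' + 1"
  then show "E y y'" using *[of y y'] *[of y' y] assms adj_sym by blast
qed

end

context two_trees
begin

text \<open>The paths are matched by the distance from their starting points, the limbs by
  \<open>code_iso\<close>; the only edge between the two pieces is the one from \<open>u\<close> to
  \<open>w\<close>.\<close>

lemma seg_iso: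
  assumes p: "(x, u, w) \<in> A.anchored j" and p': "(x', u', w') \<in> B.anchored j"
    and c: "tcode E m u w = tcode E' m u' w'"
  shows "\<exists>g. bij_betw g (A.pattern m (x, u, w)) (B.pattern m (x', u', w')) \<and>
    map_prod g (map_prod g g) (x, u, w) = (x', u', w') \<and> iemb E (A.pattern m (x, u, w)) E' g"
proof -
  note pD = A.anchored_D[OF p] and pD' = B.anchored_D[OF p']
  obtain f where f: "bij_betw f (A.trunc m u w) (B.trunc m u' w')" "f w = w'" "iemb E (A.trunc m u w) E' f"
    using code_iso[OF pD(1) pD'(1) c] by blast
  have len: "A.d x u = B.d x' u'" using pD(4) pD'(4) by simp
  have "\<exists>q. q \<in> B.interval x' u' \<and> B.d x' q = A.d x y" if "y \<in> A.interval x u" for y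
  proof -
    have "A.d x y \<le> B.d x' u'" using that len by (simp add: A.interval_def)
    then show ?thesis using B.interval_ex[OF pD'(5,6)] by metis
  qed
  then obtain h where h: "\<And>y. y \<in> A.interval x u \<Longrightarrow> h y \<in> B.interval x' u'"
    "\<And>y. y \<in> A.interval x u \<Longrightarrow> B.d x' (h y) = A.d x y" by metis
  have h_inj: "inj_on h (A.interval x u)"
    using h A.interval_unique pD(5,6) by (intro inj_onI) metis
  have "h ` A.interval x u = B.interval x' u'"
  proof (rule card_subset_eq)
    show "h ` A.interval x u \<subseteq> B.interval x' u'" using h by blast
    show "card (h ` A.interval x u) = card (B.interval x' u')"
      using card_image[OF h_inj] A.interval_card B.interval_card pD pD' len by simp
  qed simp
  then have h_bij: "bij_betw h (A.interval x u) (B.interval x' u')" using h_inj by (simp add: bij_betw_def)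
  have hx: "h x = x'"
    using h[of x] A.interval_ends[OF pD(5,6)] B.d_eq_0[OF pD'(5), of "h x"] B.interval_V by auto
  have hu: "h u = u'"
    using h[of u] A.interval_ends[OF pD(5,6)] B.interval_ends[OF pD'(5,6)] B.interval_unique pD'(5,6) len by metis
  have disj: "A.interval x u \<inter> A.trunc m u w = {}" "B.interval x' u' \<inter> B.trunc m u' w' = {}"
    using A.interval_trunc_disjoint[OF p] B.interval_trunc_disjoint[OF p'] by auto
  define g where "g y = (if y \<in> A.interval x u then h y else f y)" for y
  have gI: "g y = h y" if "y \<in> A.interval x u" for y using that by (simp add: g_def)
  have gL: "g y = f y" if "y \<in> A.trunc m u w" for y using that disj by (auto simp: g_def)
  have bij: "bij_betw g (A.interval x u \<union> A.trunc m u w) (B.interval x' u' \<union> B.trunc m u' w')"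
    using bij_betw_cong[of "A.interval x u" g h] bij_betw_cong[of "A.trunc m u w" g f] gI gL h_bij f(1) disj
    by (intro bij_betw_combine) auto
  have AI: "E y q \<longleftrightarrow> y = u \<and> q = w" if "y \<in> A.interval x u" "q \<in> A.trunc m u w" for y q
  proof
    assume e: "E y q"
    have "y \<in> A.limb w u" "q \<in> A.limb u w" using that A.interval_back[OF p] A.trunc_limb by blast+
    then have "A.d y q = A.d y w + A.d w q" "A.d y w = A.d y u + 1"
      using A.cross[OF pD(1)] A.limb_dist[OF A.adj_sym[OF pD(1)]] by auto
    then have "A.d y u = 0" "A.d w q = 0" using A.d_adj[OF e] by auto
    then show "y = u \<and> q = w" using A.d_eq_0 pD(6,7) that A.interval_V A.trunc_V by blast
  qed (use pD in auto)
  have BI: "E' y q \<longleftrightarrow> y = u' \<and> q = w'" if "y \<in> B.interval x' u'" "q \<in> B.trunc m u' w'" for y q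
  proof
    assume e: "E' y q"
    have "y \<in> B.limb w' u'" "q \<in> B.limb u' w'" using that B.interval_back[OF p'] B.trunc_limb by blast+
    then have "B.d y q = B.d y w' + B.d w' q" "B.d y w' = B.d y u' + 1"
      using B.cross[OF pD'(1)] B.limb_dist[OF B.adj_sym[OF pD'(1)]] by auto
    then have "B.d y u' = 0" "B.d w' q = 0" using B.d_adj[OF e] by auto
    then show "y = u' \<and> q = w'" using B.d_eq_0 pD'(6,7) that B.interval_V B.trunc_V by blast
  qed (use pD' in auto)
  have uw: "u \<in> A.interval x u" "w \<in> A.trunc m u w"
    using A.interval_ends pD A.trunc_self by auto
  have mixed: "E' (g y) (g q) \<longleftrightarrow> E y q" if "y \<in> A.interval x u" "q \<in> A.trunc m u w" for y q
  proof -
    have "E' (g y) (g q) \<longleftrightarrow> h y = u' \<and> f q = w'"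
      using BI[of "h y" "f q"] gI gL that h(1) f(1) bij_betwE by metis
    also have "h y = u' \<longleftrightarrow> y = u" using h_inj that uw hu by (metis inj_onD)
    also have "f q = w' \<longleftrightarrow> q = w"
      using f(1,2) that uw by (metis bij_betw_def inj_onD)
    finally show ?thesis using AI that by simp
  qed
  have "iemb E (A.interval x u \<union> A.trunc m u w) E' g"
    unfolding iemb_def
  proof (intro conjI ballI)
    show "inj_on g (A.interval x u \<union> A.trunc m u w)" using bij by (simp add: bij_betw_def)
    fix y q assume yq: "y \<in> A.interval x u \<union> A.trunc m u w" "q \<in> A.interval x u \<union> A.trunc m u w"
    show "E' (g y) (g q) = E y q"
    proof (cases "y \<in> A.interval x u")
      case True
      show ?thesis
      proof (cases "q \<in> A.interval x u")
        case q: True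
        then show ?thesis using A.interval_adj[OF pD(5,6) True q] B.interval_adj[OF pD'(5,6) h(1)[OF True] h(1)[OF q]]
            h(2) gI True by simp
      qed (use mixed yq True in auto)
    next
      case y: False
      show ?thesis
      proof (cases "q \<in> A.interval x u")
        case True
        then show ?thesis using mixed[of q y] y yq A.adj_sym B.adj_sym by blast
      next
        case False
        then show ?thesis using f(3) gL y yq by (auto simp: iemb_def)
      qed
    qed
  qed
  moreover have "g x = x'" "g u = u'" "g w = w'"
    using gI gL hx hu f(2) uw A.interval_ends pD by auto
  ultimately show ?thesis using bij unfolding A.pattern_def B.pattern_def by (intro exI[of _ g]) simp
qed

lemma emb_anchored:
  assumes p0: "(x0, u0, w0) \<in> A.anchored j" and f: "iemb E (A.pattern m (x0, u0, w0)) E' f"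
    "f ` A.pattern m (x0, u0, w0) \<subseteq> V'"
  shows "(f x0, f u0, f w0) \<in> B.anchored j"
    and "f ` A.trunc m u0 w0 \<subseteq> B.trunc m (f u0) (f w0)"
    and "f ` A.pattern m (x0, u0, w0) \<subseteq> B.pattern m (f x0, f u0, f w0)"
proof -
  let ?X = "A.pattern m (x0, u0, w0)"
  note pD = A.anchored_D[OF p0] and mem = A.pattern_mem[OF p0, of m]
  have dist: "B.d (f y) (f q) = A.d y q" if "y \<in> ?X" "q \<in> ?X" for y q
    using iemb_dist[OF A.closed_pattern[OF p0] f that] .
  have V': "f y \<in> V'" if "y \<in> ?X" for y using f(2) that by blast
  have E': "E' (f u0) (f w0)" using f(1) mem pD(1) unfolding iemb_def by blast
  then show "(f x0, f u0, f w0) \<in> B.anchored j"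
    using dist mem pD V' by (auto simp: B.anchored_def B.limb_def A.limb_def)
  show trunc: "f ` A.trunc m u0 w0 \<subseteq> B.trunc m (f u0) (f w0)"
  proof
    fix z assume "z \<in> f ` A.trunc m u0 w0"
    then obtain y where y: "z = f y" "y \<in> A.trunc m u0 w0" by blast
    then have "y \<in> ?X" by (auto simp: A.pattern_def)
    then show "z \<in> B.trunc m (f u0) (f w0)"
      using y dist mem V' by (auto simp: B.trunc_def A.trunc_def B.limb_def A.limb_def)
  qed
  have "f ` A.interval x0 u0 \<subseteq> B.interval (f x0) (f u0)"
  proof
    fix z assume "z \<in> f ` A.interval x0 u0"
    then obtain y where y: "z = f y" "y \<in> A.interval x0 u0" by blast
    then have "y \<in> ?X" by (auto simp: A.pattern_def)
    then show "z \<in> B.interval (f x0) (f u0)"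
      using y dist mem V' by (auto simp: B.interval_def A.interval_def)
  qed
  then show "f ` ?X \<subseteq> B.pattern m (f x0, f u0, f w0)"
    using trunc by (auto simp: A.pattern_def B.pattern_def)
qed

text \<open>A copy determines the image of the marked triple. By \<open>emb_anchored\<close> this is
  again anchored with the same \<open>j\<close>, and the copy stays inside the pattern of that
  triple.\<close>

lemma emb_decomp:
  assumes p0: "p0 \<in> A.anchored j"
  shows "card (Embs (A.pattern m p0) E V' E') = (\<Sum>p\<in>B.anchored j. card (anchored_Embs (A.pattern m p0) E p0 (B.pattern m p) E' p))"
proof -
  let ?X = "A.pattern m p0"
  obtain x0 u0 w0 where p0': "p0 = (x0, u0, w0)" by (cases p0)
  have XX: "p0 \<in> ?X \<times> ?X \<times> ?X" using A.pattern_mem p0 unfolding p0' by blast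
  have Embs: "Embs ?X E V' E' = (\<Union>p\<in>B.anchored j. anchored_Embs ?X E p0 (B.pattern m p) E' p)"
  proof (intro set_eqI iffI)
    fix f assume f: "f \<in> Embs ?X E V' E'"
    then have "iemb E ?X E' f" "f ` ?X \<subseteq> V'" by (auto simp: Embs_def)
    from emb_anchored[OF p0[unfolded p0'] this[unfolded p0']] f
    show "f \<in> (\<Union>p\<in>B.anchored j. anchored_Embs ?X E p0 (B.pattern m p) E' p)"
      unfolding p0' by (intro UN_I[of "(f x0, f u0, f w0)"]) (auto simp: Embs_def anchored_Embs_def)
  next
    fix f assume "f \<in> (\<Union>p\<in>B.anchored j. anchored_Embs ?X E p0 (B.pattern m p) E' p)"
    then obtain p where "p \<in> B.anchored j" "f \<in> anchored_Embs ?X E p0 (B.pattern m p) E' p" by blast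
    moreover have "B.pattern m p \<subseteq> V'" using B.pattern_mem(4) calculation(1) by (metis prod_cases3)
    ultimately show "f \<in> Embs ?X E V' E'" by (auto simp: Embs_def anchored_Embs_def)
  qed
  have "finite (anchored_Embs ?X E p0 (B.pattern m p) E' p)" for p
    by (intro finite_anchored_Embs) auto
  then show ?thesis unfolding Embs
    by (intro card_UN_disjoint) (auto simp: anchored_Embs_def)
qed

text \<open>These inequalities make the later system of counts triangular: a copy occupies only
  limbs at least as large and as high, and if the sizes agree it fills the limb, so that the codes
  coincide.\<close>

lemma anchored_Embs_props:
  assumes p0: "(x0, u0, w0) \<in> A.anchored j" and f: "f \<in> anchored_Embs (A.pattern m (x0, u0, w0)) E (x0, u0, w0) (B.pattern m p) E' p"
    and p: "p \<in> B.anchored j"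
  shows "rsize (A.pcode m (x0, u0, w0)) \<le> rsize (B.pcode m p)"
    and "height (A.pcode m (x0, u0, w0)) \<le> height (B.pcode m p)"
    and "rsize (A.pcode m (x0, u0, w0)) = rsize (B.pcode m p) \<Longrightarrow> A.pcode m (x0, u0, w0) = B.pcode m p"
proof -
  let ?X = "A.pattern m (x0, u0, w0)"
  obtain x u w where p': "p = (x, u, w)" by (cases p)
  have fp: "f x0 = x" "f u0 = u" "f w0 = w" using f p' by (auto simp: anchored_Embs_def)
  have fV: "iemb E ?X E' f" "f ` ?X \<subseteq> V'"
    using f B.pattern_mem(4)[OF p[unfolded p']] by (auto simp: anchored_Embs_def Embs_def p')
  note im = emb_anchored[OF p0 fV, unfolded fp]
  note e = A.anchored_D(1)[OF p0] B.anchored_D(1)[OF im(1)]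
  have sub: "A.trunc m u0 w0 \<subseteq> ?X" by (auto simp: A.pattern_def)
  have ie: "iemb E (A.trunc m u0 w0) E' f" using iemb_subset[OF fV(1) sub] .
  then have inj: "inj_on f (A.trunc m u0 w0)" by (simp add: iemb_def)
  have card: "card (f ` A.trunc m u0 w0) = card (A.trunc m u0 w0)" using card_image[OF inj] .
  have "card (A.trunc m u0 w0) \<le> card (B.trunc m u w)"
    using card card_mono[OF B.finite_trunc im(2)] by simp
  then show "rsize (A.pcode m (x0, u0, w0)) \<le> rsize (B.pcode m p)"
    using A.rsize_tcode[OF e(1)] B.rsize_tcode[OF e(2)] by (simp add: p')
  show "height (A.pcode m (x0, u0, w0)) \<le> height (B.pcode m p)"
  proof (rule ccontr)
    assume "\<not> ?thesis"
    then have "height (tcode E' m u w) < height (tcode E m u0 w0)" by (simp add: p')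
    then obtain y where y: "y \<in> A.trunc m u0 w0" "A.d w0 y = height (tcode E' m u w)"
      using A.less_height_tcode[OF e(1)] by blast
    have "B.d w (f y) = A.d w0 y"
      using iemb_dist[OF A.closed_pattern[OF p0] fV, of w0 y] y sub A.pattern_mem[OF p0] fp by auto
    then have "height (tcode E' m u w) < height (tcode E' m u w)"
      unfolding B.less_height_tcode[OF e(2)] using y im(2) by (intro bexI[of _ "f y"]) auto
    then show False by simp
  qed
  assume "rsize (A.pcode m (x0, u0, w0)) = rsize (B.pcode m p)"
  then have "card (A.trunc m u0 w0) = card (B.trunc m u w)"
    using A.rsize_tcode[OF e(1)] B.rsize_tcode[OF e(2)] by (simp add: p')
  then have "f ` A.trunc m u0 w0 = B.trunc m u w"
    using card card_subset_eq[OF B.finite_trunc im(2)] by simp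
  then show "A.pcode m (x0, u0, w0) = B.pcode m p"
    using iso_code[OF e _ fp(3) ie] inj by (simp add: p' bij_betw_def)
qed

text \<open>Composition with the isomorphism of \<open>seg_iso\<close> is a bijection of the copies,
  so their number depends on the target only through its code, even across the two trees.\<close>

lemma anchored_Embs_eq:
  assumes "finite X" "p0 \<in> X \<times> X \<times> X" "p \<in> A.anchored j" "q \<in> B.anchored j" "A.pcode m p = B.pcode m q"
  shows "card (anchored_Embs X F p0 (A.pattern m p) E p) = card (anchored_Embs X F p0 (B.pattern m q) E' q)"
proof -
  obtain x u w x' u' w' where pq: "p = (x, u, w)" "q = (x', u', w')" by (cases p; cases q)
  obtain g where g: "bij_betw g (A.pattern m p) (B.pattern m q)" "map_prod g (map_prod g g) p = q"
    "iemb E (A.pattern m p) E' g"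
    using seg_iso[of x u w j x' u' w' m] assms(3-5) unfolding pq by auto
  have "p \<in> A.pattern m p \<times> A.pattern m p \<times> A.pattern m p" using A.pattern_mem assms(3) unfolding pq by blast
  then show ?thesis using card_anchored_Embs_eq[OF assms(1) _ g(1,3) assms(2)] g(2) by simp
qed

end

section \<open>Counting anchored limbs\<close>

text \<open>The hypothesis on decks enters only through \<open>emb_eq\<close>.\<close>

locale deck_trees = two_trees V E V' E'
  for V :: "'a set" and E and V' :: "'a set" and E' +
  fixes l :: nat
  assumes card_eq: "card V = card V'"
    and emb_eq: "\<And>(X :: 'a set) F. finite X \<Longrightarrow> card X \<le> l \<Longrightarrow> card (Embs X F V E) = card (Embs X F V' E')"
begin

lemma deck_trees_swap: "deck_trees V' E' V E l"
  by (intro deck_trees.intro two_trees.intro deck_trees_axioms.intro A.tree_graph_axioms B.tree_graph_axioms)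
    (use card_eq emb_eq in auto)

lemma two_trees_AA: "two_trees V E V E" by (intro two_trees.intro A.tree_graph_axioms)
lemma two_trees_BB: "two_trees V' E' V' E'" by (intro two_trees.intro B.tree_graph_axioms)
lemma embeds:
  assumes "X \<subseteq> V" "card X \<le> l"
  obtains f where "iemb E X E' f" "f ` X \<subseteq> V'"
proof -
  have fin: "finite X" using assms(1) A.finite_V finite_subset by blast
  have "restrict (\<lambda>x. x) X \<in> Embs X E V E" using assms(1) by (auto simp: Embs_def iemb_def inj_on_def)
  then have "card (Embs X E V E) \<noteq> 0" using finite_Embs[OF fin A.finite_V] by auto
  then have "card (Embs X E V' E') \<noteq> 0" using emb_eq[OF fin assms(2)] by simp
  then obtain f where "f \<in> Embs X E V' E'" by fastforce
  then show ?thesis using that by (auto simp: Embs_def)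
qed

text \<open>One step of solving a triangular linear system. The number of copies of the pattern is a
  sum over codes \<open>Y\<close> of \<open>code_count\<close> times a coefficient
  \<open>rho Y\<close> common to both trees. Only \<open>?Y0\<close> and larger codes of height
  above \<open>h0\<close> contribute; the larger ones agree by \<open>above\<close>, and the
  coefficient of \<open>?Y0\<close> is positive.\<close>

lemma limb_count_step:
  assumes p0: "p0 \<in> A.anchored j" and le: "j + rsize (A.pcode m p0) \<le> l" and h0: "h0 < height (A.pcode m p0)"
    and above: "\<And>Y. h0 < height Y \<Longrightarrow> rsize (A.pcode m p0) < rsize Y \<Longrightarrow>
      A.code_count j m Y = B.code_count j m Y"
  shows "A.code_count j m (A.pcode m p0) = B.code_count j m (A.pcode m p0)"
proof -
  interpret AA: two_trees V E V E by (rule two_trees_AA)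
  interpret BB: two_trees V' E' V' E' by (rule two_trees_BB)
  let ?Y0 = "A.pcode m p0" and ?X = "A.pattern m p0"
  obtain x0 u0 w0 where p0': "p0 = (x0, u0, w0)" by (cases p0)
  have XX: "p0 \<in> ?X \<times> ?X \<times> ?X" using A.pattern_mem p0 unfolding p0' by blast
  let ?RA = "\<lambda>p. card (anchored_Embs ?X E p0 (A.pattern m p) E p)" and ?RB = "\<lambda>p. card (anchored_Embs ?X E p0 (B.pattern m p) E' p)"
  have "card ?X = j + rsize ?Y0"
    using A.card_pattern[of x0 u0 w0 j m] A.rsize_tcode A.anchored_D(1) p0 unfolding p0' by fastforce
  then have sums: "(\<Sum>p\<in>A.anchored j. ?RA p) = (\<Sum>p\<in>B.anchored j. ?RB p)"
    using AA.emb_decomp[OF p0] emb_decomp[OF p0] emb_eq[of ?X E] le by simp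
  define YY where "YY = {Y. h0 < height Y \<and> rsize ?Y0 < rsize Y}"
  define C where "C = A.pcode m ` A.anchored j \<union> B.pcode m ` B.anchored j"
  have finC: "finite C" by (simp add: C_def)
  \<comment> \<open>The number of copies in an anchored limb of code \<open>Y\<close>, computed in a
    representative from the first tree if there is one and from the second otherwise.\<close>
  define rho where "rho Y = (if \<exists>p\<in>A.anchored j. A.pcode m p = Y then ?RA (SOME p. p \<in> A.anchored j \<and> A.pcode m p = Y)
    else ?RB (SOME p. p \<in> B.anchored j \<and> B.pcode m p = Y))" for Y
  have rhoA: "?RA p = rho (A.pcode m p)" if "p \<in> A.anchored j" for p
  proof -
    let ?q = "SOME q. q \<in> A.anchored j \<and> A.pcode m q = A.pcode m p"
    have "\<exists>q. q \<in> A.anchored j \<and> A.pcode m q = A.pcode m p" using that by blast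
    from someI_ex[OF this] have "?q \<in> A.anchored j \<and> A.pcode m ?q = A.pcode m p" .
    then have "?RA p = ?RA ?q" using AA.anchored_Embs_eq[OF _ XX that, of ?q m E] by simp
    then show ?thesis using that by (auto simp: rho_def)
  qed
  have rhoB: "?RB p = rho (B.pcode m p)" if "p \<in> B.anchored j" for p
  proof (cases "\<exists>q\<in>A.anchored j. A.pcode m q = B.pcode m p")
    case True
    let ?q = "SOME q. q \<in> A.anchored j \<and> A.pcode m q = B.pcode m p"
    have "\<exists>q. q \<in> A.anchored j \<and> A.pcode m q = B.pcode m p" using True by blast
    from someI_ex[OF this] have "?q \<in> A.anchored j \<and> A.pcode m ?q = B.pcode m p" .
    then have "?RA ?q = ?RB p" using anchored_Embs_eq[OF _ XX _ that, of ?q m E] by simp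
    then show ?thesis using True by (simp add: rho_def)
  next
    case False
    let ?q = "SOME q. q \<in> B.anchored j \<and> B.pcode m q = B.pcode m p"
    have "\<exists>q. q \<in> B.anchored j \<and> B.pcode m q = B.pcode m p" using that by blast
    from someI_ex[OF this] have "?q \<in> B.anchored j \<and> B.pcode m ?q = B.pcode m p" .
    then have "?RB p = ?RB ?q" using BB.anchored_Embs_eq[OF _ XX that, of ?q m E] by simp
    then show ?thesis using False by (auto simp: rho_def)
  qed
  have zeroA: "?RA p = 0" if "p \<in> A.anchored j" "A.pcode m p \<noteq> ?Y0" "A.pcode m p \<notin> YY" for p
  proof (rule ccontr)
    assume "?RA p \<noteq> 0"
    then obtain f where "f \<in> anchored_Embs ?X E p0 (A.pattern m p) E p" by fastforce
    then show False using AA.anchored_Embs_props[OF p0[unfolded p0'], of f m p] that h0 le_neq_implies_less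
      unfolding p0' YY_def by auto
  qed
  have zeroB: "?RB p = 0" if "p \<in> B.anchored j" "B.pcode m p \<noteq> ?Y0" "B.pcode m p \<notin> YY" for p
  proof (rule ccontr)
    assume "?RB p \<noteq> 0"
    then obtain f where "f \<in> anchored_Embs ?X E p0 (B.pattern m p) E' p" by fastforce
    then show False using anchored_Embs_props[OF p0[unfolded p0'], of f m p] that h0 le_neq_implies_less
      unfolding p0' YY_def by auto
  qed
  let ?D = "insert ?Y0 (C \<inter> YY)"
  have fib: "(\<Sum>p\<in>S. R p) = (\<Sum>Y\<in>?D. card {p \<in> S. c p = Y} * rho Y)"
    if S: "finite S" "c ` S \<subseteq> C" and R: "\<And>p. p \<in> S \<Longrightarrow> R p = rho (c p)"
      "\<And>p. p \<in> S \<Longrightarrow> c p \<noteq> ?Y0 \<Longrightarrow> c p \<notin> YY \<Longrightarrow> R p = 0"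
    for S :: "('a \<times> 'a \<times> 'a) set" and R c
  proof -
    let ?S = "{p \<in> S. c p \<in> ?D}"
    have "(\<Sum>p\<in>S. R p) = (\<Sum>p\<in>?S. R p)"
    proof (rule sum.mono_neutral_right)
      show "\<forall>p\<in>S - ?S. R p = 0"
      proof
        fix p assume p: "p \<in> S - ?S"
        then have "c p \<in> C" using S(2) by blast
        then show "R p = 0" using R(2)[of p] p by blast
      qed
    qed (use S(1) in auto)
    also have "\<dots> = (\<Sum>Y\<in>?D. \<Sum>p\<in>{p \<in> ?S. c p = Y}. R p)"
      using S(1) finC by (intro sum.group[symmetric]) auto
    also have "\<dots> = (\<Sum>Y\<in>?D. card {p \<in> S. c p = Y} * rho Y)"
    proof (intro sum.cong refl)
      fix Y assume "Y \<in> ?D"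
      then have "{p \<in> ?S. c p = Y} = {p \<in> S. c p = Y}" by auto
      then show "(\<Sum>p\<in>{p \<in> ?S. c p = Y}. R p) = card {p \<in> S. c p = Y} * rho Y"
        using R(1) by simp
    qed
    finally show ?thesis .
  qed
  let ?cA = "\<lambda>Y. A.code_count j m Y" and ?cB = "\<lambda>Y. B.code_count j m Y"
  have "(\<Sum>Y\<in>?D. ?cA Y * rho Y) = (\<Sum>Y\<in>?D. ?cB Y * rho Y)"
    using fib[of "A.anchored j" "A.pcode m" ?RA] fib[of "B.anchored j" "B.pcode m" ?RB] rhoA rhoB zeroA zeroB sums
    by (simp add: C_def)
  moreover have "?Y0 \<notin> C \<inter> YY" by (simp add: YY_def)
  moreover have "(\<Sum>Y\<in>C \<inter> YY. ?cA Y * rho Y) = (\<Sum>Y\<in>C \<inter> YY. ?cB Y * rho Y)"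
    using above by (intro sum.cong refl) (simp add: YY_def)
  ultimately have "?cA ?Y0 * rho ?Y0 = ?cB ?Y0 * rho ?Y0" using finC by simp
  moreover have "rho ?Y0 > 0"
  proof -
    have "restrict (\<lambda>x. x) ?X \<in> anchored_Embs ?X E p0 (A.pattern m p0) E p0"
      using XX by (auto simp: anchored_Embs_def Embs_def iemb_def inj_on_def)
    then have "?RA p0 > 0" using finite_anchored_Embs[of ?X "A.pattern m p0"] by (auto simp: card_gt_0_iff)
    then show ?thesis using rhoA[OF p0] by simp
  qed
  ultimately show ?thesis by simp
qed

text \<open>Otherwise the oversized limb of the second tree contains a subtree of exactly
  \<open>l - j\<close> vertices that still reaches depth \<open>h0\<close>. With the
  \<open>j\<close> vertices of the path it fills a card, so it occurs in the first tree and produces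
  there an anchored limb violating \<open>small\<close>.\<close>

lemma limb_size_B:
  assumes small: "\<And>p. p \<in> A.anchored j \<Longrightarrow> h0 < height (A.pcode m p) \<Longrightarrow> j + rsize (A.pcode m p) < l"
    and h0: "j + h0 < l" "h0 \<le> m" and p: "p \<in> B.anchored j" "h0 < height (B.pcode m p)"
  shows "j + rsize (B.pcode m p) < l"
proof (rule ccontr)
  assume big: "\<not> ?thesis"
  interpret BA: deck_trees V' E' V E l by (rule deck_trees_swap)
  obtain x u w where p': "p = (x, u, w)" by (cases p)
  note pD = B.anchored_D[OF p(1)[unfolded p']]
  have rsize: "rsize (B.pcode m p) = card (B.trunc m u w)" using B.rsize_tcode[OF pD(1)] by (simp add: p')
  obtain y where y: "y \<in> B.trunc m u w" "B.d w y = h0"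
    using B.less_height_tcode[OF pD(1)] p(2) by (auto simp: p')
  have cl: "B.closed w (B.trunc m u w)" using B.trunc_closed[OF pD(1)] .
  have yV: "y \<in> V'" using y(1) B.trunc_V by blast
  have c1: "card (B.interval w y) \<le> l - j" using B.interval_card[OF pD(7) yV] y h0 by simp
  have c2: "l - j \<le> card (B.trunc m u w)" using big rsize by simp
  \<comment> \<open>Growing the piece from the path between \<open>w\<close> and \<open>y\<close>
    preserves the height above \<open>h0\<close>.\<close>
  obtain C where C: "B.closed w C" "B.interval w y \<subseteq> C" "C \<subseteq> B.trunc m u w" "card C = l - j"
    using B.closed_extend[OF B.closed_interval'[OF pD(7) yV] cl B.closed_interval[OF cl y(1)] c1 c2] .
  let ?X = "B.interval x u \<union> C"
  have "B.interval x u \<inter> C = {}" using C(3) B.interval_trunc_disjoint[OF p(1)[unfolded p'], of m] by blast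
  then have cardX: "card ?X = l"
    using C(4) h0 B.interval_card[OF pD(5,6)] pD(4) C(3) finite_subset[OF C(3)]
    by (simp add: card_Un_disjoint)
  have subM: "?X \<subseteq> B.pattern m (x, u, w)" using C(3) by (auto simp: B.pattern_def)
  have XV: "?X \<subseteq> V'" using subM B.pattern_mem(4)[OF p(1)[unfolded p']] by blast
  obtain f where f: "iemb E' ?X E f" "f ` ?X \<subseteq> V" using BA.embeds[OF XV] cardX by auto
  have clX: "B.closed w ?X"
  proof -
    have "B.closed w (B.pattern 0 (x, u, w))" using B.closed_pattern[OF p(1)[unfolded p']] .
    moreover have "B.pattern 0 (x, u, w) \<union> C = ?X"
      using B.trunc_0[OF pD(1)] C(1) by (auto simp: B.pattern_def B.closed_def)
    ultimately show ?thesis using B.closed_Un C(1) by metis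
  qed
  have dist: "A.d (f a) (f b) = B.d a b" if "a \<in> ?X" "b \<in> ?X" for a b
    using BA.iemb_dist[OF clX f that] .
  have mem: "x \<in> ?X" "u \<in> ?X" "w \<in> ?X" "y \<in> ?X"
    using B.interval_ends pD C yV unfolding B.closed_def by blast+
  have e: "E (f u) (f w)" using f(1) mem pD(1) unfolding iemb_def by blast
  have q: "(f x, f u, f w) \<in> A.anchored j"
    using e dist mem pD f(2) by (auto simp: A.anchored_def A.limb_def B.limb_def)
  have fC: "f ` C \<subseteq> A.trunc m (f u) (f w)"
  proof
    fix z assume "z \<in> f ` C"
    then obtain b where b: "z = f b" "b \<in> C" by blast
    then show "z \<in> A.trunc m (f u) (f w)"
      using C(3) dist mem f(2) by (auto simp: A.trunc_def B.trunc_def A.limb_def B.limb_def subset_iff)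
  qed
  have "y \<in> C" using C(2) B.interval_ends pD yV by blast
  then have "f y \<in> A.trunc m (f u) (f w)" "A.d (f w) (f y) = h0" using fC dist mem y by auto
  then have "h0 < height (A.pcode m (f x, f u, f w))" using A.less_height_tcode[OF e] by auto
  then have "j + rsize (A.pcode m (f x, f u, f w)) < l" using small q by blast
  moreover have "card C \<le> card (A.trunc m (f u) (f w))"
  proof (rule card_inj_on_le[OF _ fC])
    show "inj_on f C" using f(1) inj_on_subset[of f ?X C] unfolding iemb_def by blast
  qed simp
  ultimately show False using A.rsize_tcode[OF e] C(4) h0 by simp
qed

text \<open>For a largest code \<open>Y\<close> with different counts, a copy of the pattern of \<open>Y\<close> spans an anchored limb of
  code \<open>Y\<close> or of a larger code. The larger ones contribute equally to both trees.\<close>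

lemma limb_count:
  assumes small: "\<And>p. p \<in> A.anchored j \<Longrightarrow> h0 < height (A.pcode m p) \<Longrightarrow> j + rsize (A.pcode m p) < l"
    and h0: "j + h0 < l" "h0 \<le> m" and Y: "h0 < height Y"
  shows "A.code_count j m Y = B.code_count j m Y" (is "?cA Y = ?cB Y")
proof (rule ccontr)
  interpret BA: deck_trees V' E' V E l by (rule deck_trees_swap)
  assume "?cA Y \<noteq> ?cB Y"
  define D where "D = {Y. h0 < height Y \<and> ?cA Y \<noteq> ?cB Y}"
  have "D \<subseteq> A.pcode m ` A.anchored j \<union> B.pcode m ` B.anchored j"
  proof
    fix Y assume Y: "Y \<in> D"
    show "Y \<in> A.pcode m ` A.anchored j \<union> B.pcode m ` B.anchored j"
    proof (rule ccontr)
      assume "\<not> ?thesis"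
      then have "{p \<in> A.anchored j. A.pcode m p = Y} = {}" "{p \<in> B.anchored j. B.pcode m p = Y} = {}" by blast+
      then have "?cA Y = ?cB Y" by (simp only: card.empty)
      then show False using Y by (simp add: D_def)
    qed
  qed
  then have "finite D" by (rule finite_subset) simp
  moreover have "D \<noteq> {}" using \<open>?cA Y \<noteq> ?cB Y\<close> Y by (auto simp: D_def)
  ultimately have "Max (rsize ` D) \<in> rsize ` D" "\<And>Y. Y \<in> D \<Longrightarrow> rsize Y \<le> Max (rsize ` D)" by auto
  then obtain Y0 where Y0: "Y0 \<in> D" "\<And>Y. Y \<in> D \<Longrightarrow> rsize Y \<le> rsize Y0" by fastforce
  have above: "?cA Y = ?cB Y" if "h0 < height Y" "rsize Y0 < rsize Y" for Y
    using Y0(2)[of Y] that by (force simp: D_def)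
  have "Y0 \<in> A.pcode m ` A.anchored j \<union> B.pcode m ` B.anchored j" using \<open>D \<subseteq> _\<close> Y0 by blast
  then show False
  proof
    assume "Y0 \<in> A.pcode m ` A.anchored j"
    then obtain p0 where "p0 \<in> A.anchored j" "Y0 = A.pcode m p0" by blast
    then show False using limb_count_step[of p0 j m h0] above small[of p0] Y0(1) by (auto simp: D_def)
  next
    assume "Y0 \<in> B.pcode m ` B.anchored j"
    then obtain p0 where p0: "p0 \<in> B.anchored j" "Y0 = B.pcode m p0" by blast
    have "j + rsize (B.pcode m p0) < l"
      using limb_size_B[OF small h0 p0(1)] Y0(1) p0(2) by (auto simp: D_def)
    then show False using BA.limb_count_step[of p0 j m h0] above p0 Y0(1) by (auto simp: D_def)
  qed
qed

end

section \<open>Reconstruction from the highest branches at a vertex\<close>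

text \<open>The number of nodes at depth \<open>i\<close>, with the root at depth 0.\<close>

primrec levels :: "rtree \<Rightarrow> nat \<Rightarrow> nat" where
  "levels (Node M) = (\<lambda>i. if i = 0 then 1 else \<Sum>\<^sub># (image_mset (\<lambda>f. f (i - 1)) (image_mset levels M)))"

context tree_graph
begin

lemma levels_tcode: "E u w \<Longrightarrow> levels (tcode E m u w) i = card {y \<in> trunc m u w. d w y = i}"
proof (induction m arbitrary: u w i)
  case 0
  have "{y \<in> trunc 0 u w. d w y = i} = (if i = 0 then {w} else {})" using 0 by (auto simp: trunc_0)
  then show ?case by simp
next
  case (Suc m)
  show ?case
  proof (cases i)
    case 0
    have "{y \<in> trunc (Suc m) u w. d w y = 0} = {w}"
      using trunc_V[of "Suc m" u w] trunc_self[OF Suc.prems] d_eq_0[OF adj_V'[OF Suc.prems]] by auto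
    then show ?thesis using 0 by simp
  next
    case (Suc k)
    have *: "d w y = d v y + 1" if "E w v" "y \<in> trunc m w v" for v y
      using limb_dist'[OF that(1)] that(2) trunc_limb by blast
    have eq: "{y \<in> trunc (Suc m) u w. d w y = Suc k} = (\<Union>v\<in>{v. E w v} - {u}. {y \<in> trunc m w v. d v y = k})"
      unfolding trunc_Suc[OF Suc.prems] using * by auto
    have "card (\<Union>v\<in>{v. E w v} - {u}. {y \<in> trunc m w v. d v y = k})
        = (\<Sum>v\<in>{v. E w v} - {u}. card {y \<in> trunc m w v. d v y = k})"
      using trunc_disjoint by (intro card_UN_disjoint) (auto, blast)
    also have "\<dots> = (\<Sum>v\<in>{v. E w v} - {u}. levels (tcode E m w v) k)"
      using Suc.IH by (intro sum.cong) auto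
    finally show ?thesis using Suc eq
      by (simp add: sum_unfold_sum_mset image_mset.compositionality comp_def)
  qed
qed

lemma trunc_code: "E u w \<Longrightarrow> trunc (card V) u w = limb u w"
  by (rule trunc_big) auto

lemma levels_code:
  assumes "E z v" "i > 0"
  shows "levels (code z v) (i - 1) = card {y \<in> limb z v. d z y = i}"
proof -
  have "{y \<in> limb z v. d v y = i - 1} = {y \<in> limb z v. d z y = i}"
    using limb_dist'[OF assms(1)] assms(2) by auto
  then show ?thesis using levels_tcode[OF assms(1)] trunc_code[OF assms(1)] by simp
qed

definition branches :: "'a \<Rightarrow> rtree multiset" where
  "branches z = image_mset (code z) (mset_set {v. E z v})"

text \<open>The part of the tree that is already known when the branches of height \<open>h\<close>
  at \<open>z\<close> are to be determined.\<close>

definition tall_part :: "'a \<Rightarrow> nat \<Rightarrow> 'a set" where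
  "tall_part z h = insert z (\<Union>v\<in>{v. E z v \<and> h < depth z v}. limb z v)"

lemma tall_part_V: "z \<in> V \<Longrightarrow> tall_part z h \<subseteq> V"
  using limb_V by (auto simp: tall_part_def)

lemma tall_part_branch: "E z v \<Longrightarrow> x \<in> limb z v \<Longrightarrow> x \<in> tall_part z h \<longleftrightarrow> h < depth z v"
  using branch_unique limb_not by (auto simp: tall_part_def)

lemma away_branch:
  assumes "E u w" "z \<in> limb w u" "z \<in> V"
  obtains v where "E z v" "w \<in> limb z v" "limb u w \<subseteq> limb z v" "u = z \<and> w = v \<or> u \<in> limb z v"
proof -
  have uV: "u \<in> V" "w \<in> V" using assms(1) adj_V adj_V' by auto
  have dzw: "d z w = d z u + 1" using limb_dist[OF adj_sym[OF assms(1)] assms(2)] .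
  then have "w \<noteq> z" by auto
  then obtain v where v: "E z v" "w \<in> limb z v" using ex_branch uV assms(3) by metis
  have "limb u w \<subseteq> limb z v"
  proof
    fix y assume y: "y \<in> limb u w"
    show "y \<in> limb z v"
    proof (rule ccontr)
      assume "y \<notin> limb z v"
      then have "d w y = d w z + d z y" using branches_cross[OF v] y limb_V by blast
      moreover have "d z y = d z w + d w y" using cross[OF assms(1,2) y] .
      ultimately show False using dzw by (simp add: d_sym)
    qed
  qed
  moreover have "u = z \<and> w = v \<or> u \<in> limb z v"
  proof (cases "u = z")
    case True
    then show ?thesis using branch_unique[OF assms(1)[unfolded True] v(1)] limb_self v
      assms(1) by blast
  next
    case False
    then have "u \<in> interval z w" "z \<notin> interval u w"
      using dzw d_adj[OF assms(1)] uV assms(3) d_eq_0[of z u] by (auto simp: interval_def d_sym)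
    have "u \<in> limb z v"
    proof (rule ccontr)
      assume "u \<notin> limb z v"
      then have "d w u = d w z + d z u" using branches_cross[OF v] uV by blast
      then show False using d_adj[OF assms(1)] dzw d_eq_0[of z u] uV assms(3) False by (simp add: d_sym)
    qed
    then show ?thesis by blast
  qed
  ultimately show ?thesis using that v by blast
qed

lemma depth_away:
  assumes "E u w" "z \<in> limb w u" "E z v" "w \<in> limb z v"
  shows "d z u + depth u w \<le> depth z v"
proof -
  have zV: "z \<in> V" using assms(3) adj_V by blast
  obtain v' where v': "E z v'" "w \<in> limb z v'" "limb u w \<subseteq> limb z v'"
    using away_branch[OF assms(1,2) zV] by metis
  then have "v' = v" using branch_unique assms by blast
  obtain x where x: "x \<in> limb u w" "d u x = depth u w" using depth_ex assms(1) .
  have "d z x = d z u + d u x" using cross'[OF assms(1,2) x(1)] .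
  then show ?thesis using depth_ge[of x z v] x v' \<open>v' = v\<close> by auto
qed

text \<open>If \<open>z\<close> lay behind \<open>w\<close>, then \<open>x\<close> would be at
  distance at least \<open>Suc J\<close> from \<open>z\<close>, while every vertex is within
  distance \<open>J\<close>. This dictates the path length \<open>Suc J\<close>.\<close>

lemma anchored_away:
  assumes "z \<in> V" "\<And>v. E z v \<Longrightarrow> depth z v \<le> J" "(x, u, w) \<in> anchored (Suc J)"
  shows "z \<in> limb w u"
proof (rule ccontr)
  note pD = anchored_D[OF assms(3)]
  assume "z \<notin> limb w u"
  then have "z \<in> limb u w" using limb_compl[OF pD(1)] assms(1) by blast
  then have "d x z = Suc J + d w z" using cross[OF pD(1,2)] pD by simp
  then have "x \<noteq> z" by auto
  then obtain v where "E z v" "x \<in> limb z v" using ex_branch pD(5) assms(1) by metis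
  then have "d z x \<le> J" using depth_ge assms(2) le_trans by blast
  then show False using \<open>d x z = _\<close> by (simp add: d_sym)
qed

text \<open>The three terms sort by the positions of \<open>w\<close> and \<open>x\<close>. If
  \<open>w\<close> is outside the tall part, the height \<open>h\<close> of the limb leaves no room
  below \<open>z\<close>: then \<open>u = z\<close>, and \<open>x\<close> is any vertex at distance
  \<open>J\<close>. If both are inside, the term depends on the tall part alone. If only
  \<open>w\<close> is inside, then \<open>d z x \<le> h\<close> and
  \<open>d z w \<le> Suc J - h\<close> add up to \<open>Suc J\<close>, so both are equalities and
  \<open>x\<close> can be chosen independently of the edge.\<close>

lemma count_split:
  assumes z: "z \<in> V" and HJ: "\<And>v. E z v \<Longrightarrow> depth z v \<le> J" and h: "h < J" and Y: "height Y = h"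
  shows "code_count (Suc J) (card V) Y =
    card {v. E z v \<and> code z v = Y} * card {x \<in> V. d z x = J}
    + card {(x, u, w). (x, u, w) \<in> anchored (Suc J) \<and> code u w = Y \<and> x \<in> tall_part z h \<and> w \<in> tall_part z h}
    + card {(u, w). E u w \<and> z \<in> limb w u \<and> w \<in> tall_part z h \<and> d z w = Suc J - h \<and> code u w = Y}
      * card {x \<in> V - tall_part z h. d z x = h}"
proof -
  let ?W = "tall_part z h"
  let ?S = "{p \<in> anchored (Suc J). pcode (card V) p = Y}"
  let ?S1 = "{(x, u, w). (x, u, w) \<in> anchored (Suc J) \<and> code u w = Y \<and> w \<notin> ?W}"
  let ?S2 = "{(x, u, w). (x, u, w) \<in> anchored (Suc J) \<and> code u w = Y \<and> x \<in> ?W \<and> w \<in> ?W}"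
  let ?S3 = "{(x, u, w). (x, u, w) \<in> anchored (Suc J) \<and> code u w = Y \<and> x \<notin> ?W \<and> w \<in> ?W}"
  let ?N = "{v. E z v \<and> code z v = Y}" and ?top = "{x \<in> V. d z x = J}"
  let ?e = "{(u, w). E u w \<and> z \<in> limb w u \<and> w \<in> ?W \<and> d z w = Suc J - h \<and> code u w = Y}"
  let ?a = "{x \<in> V - ?W. d z x = h}"
  have away: "z \<in> limb w u" if "(x, u, w) \<in> anchored (Suc J)" for x u w
    using anchored_away[OF z HJ that] .
  have S: "?S = ?S1 \<union> ?S2 \<union> ?S3" by auto
  have fin: "finite ?S1" "finite ?S2" "finite ?S3" by (auto intro: finite_subset[OF _ finite_anchored[of "Suc J"]])
  have "card ?S = card (?S1 \<union> ?S2) + card ?S3"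
    unfolding S using fin by (intro card_Un_disjoint) auto
  also have "card (?S1 \<union> ?S2) = card ?S1 + card ?S2"
    using fin by (intro card_Un_disjoint) auto
  finally have card_S: "card ?S = card ?S1 + card ?S2 + card ?S3" .
  have "bij_betw (\<lambda>(v, x). (x, z, v)) (?N \<times> ?top) ?S1"
    unfolding bij_betw_def
  proof
    show "inj_on (\<lambda>(v, x). (x, z, v)) (?N \<times> ?top)" by (auto simp: inj_on_def)
    show "(\<lambda>(v, x). (x, z, v)) ` (?N \<times> ?top) = ?S1"
    proof (intro set_eqI iffI)
      fix p assume "p \<in> (\<lambda>(v, x). (x, z, v)) ` (?N \<times> ?top)"
      then obtain v x where p: "p = (x, z, v)" "E z v" "code z v = Y" "x \<in> V" "d z x = J" by auto
      have Hv: "depth z v = h" using height_code[OF p(2)] p(3) Y by simp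
      then have "x \<notin> limb z v" using depth_ge[of x z v] p(5) h by auto
      then have x: "x \<in> limb v z" using limb_compl[OF p(2)] p(4) by blast
      have "d x v = Suc J" using limb_dist[OF adj_sym[OF p(2)] x] p(5) by (simp add: d_sym)
      moreover have "v \<notin> ?W" using tall_part_branch[OF p(2) limb_self[OF p(2)]] Hv by simp
      ultimately show "p \<in> ?S1" using p x by (auto simp: anchored_def)
    next
      fix p assume "p \<in> ?S1"
      then obtain x u w where p: "p = (x, u, w)" "(x, u, w) \<in> anchored (Suc J)" "code u w = Y" "w \<notin> ?W" by auto
      note pD = anchored_D[OF p(2)]
      obtain v where v: "E z v" "w \<in> limb z v" "u = z \<and> w = v \<or> u \<in> limb z v"
        using away_branch[OF pD(1) away[OF p(2)] z] by metis
      have "\<not> h < depth z v" using tall_part_branch[OF v(1,2)] p(4) by blast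
      moreover have "depth u w = h" using height_code[OF pD(1)] p(3) Y by simp
      ultimately have "d z u = 0" using depth_away[OF pD(1) away[OF p(2)] v(1,2)] by simp
      then have "u = z" using d_eq_0 z pD by blast
      then have "w = v" using v limb_not by blast
      have "d z x = J" using pD \<open>u = z\<close> by (simp add: d_sym)
      then show "p \<in> (\<lambda>(v, x). (x, z, v)) ` (?N \<times> ?top)"
        using p pD \<open>u = z\<close> by (auto simp: image_iff)
    qed
  qed
  then have S1: "card ?S1 = card ?N * card ?top"
    by (simp only: bij_betw_same_card[symmetric] card_cartesian_product)
  have "bij_betw (\<lambda>((u, w), x). (x, u, w)) (?e \<times> ?a) ?S3"
    unfolding bij_betw_def
  proof
    show "inj_on (\<lambda>((u, w), x). (x, u, w)) (?e \<times> ?a)" by (auto simp: inj_on_def)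
    show "(\<lambda>((u, w), x). (x, u, w)) ` (?e \<times> ?a) = ?S3"
    proof (intro set_eqI iffI)
      fix p assume "p \<in> (\<lambda>((u, w), x). (x, u, w)) ` (?e \<times> ?a)"
      then obtain x u w where p: "p = (x, u, w)" "E u w" "z \<in> limb w u" "w \<in> ?W" "d z w = Suc J - h"
        "code u w = Y" "x \<in> V" "x \<notin> ?W" "d z x = h" by auto
      obtain v where v: "E z v" "w \<in> limb z v" "limb u w \<subseteq> limb z v"
        using away_branch[OF p(2,3) z] by metis
      have hv: "h < depth z v" using tall_part_branch[OF v(1,2)] p(4) by simp
      have xv: "x \<notin> limb z v" using tall_part_branch[OF v(1)] p(8) hv by blast
      then have "d w x = d w z + d z x" using branches_cross[OF v(1,2)] p(7) by blast
      then have "d x w = Suc J" using p h by (simp add: d_sym)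
      moreover have "x \<in> limb w u" using xv v(3) limb_compl[OF p(2)] p(7) by blast
      ultimately show "p \<in> ?S3" using p by (auto simp: anchored_def)
    next
      fix p assume "p \<in> ?S3"
      then obtain x u w where p: "p = (x, u, w)" "(x, u, w) \<in> anchored (Suc J)" "code u w = Y" "x \<notin> ?W" "w \<in> ?W" by auto
      note pD = anchored_D[OF p(2)]
      obtain v where v: "E z v" "w \<in> limb z v" using away_branch[OF pD(1) away[OF p(2)] z] by metis
      have "x \<noteq> z" using p(4) by (auto simp: tall_part_def)
      then obtain v2 where v2: "E z v2" "x \<in> limb z v2" using ex_branch pD(5) z by metis
      have "x \<notin> limb z v" using tall_part_branch[OF v] p tall_part_branch[OF v(1)] by blast
      then have dxw: "d w x = d w z + d z x" using branches_cross[OF v] pD(5) by blast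
      have "d z x \<le> h" using tall_part_branch[OF v2, of h] p(4) depth_ge[OF v2(2)] by linarith
      moreover have "depth u w = h" using height_code[OF pD(1)] p(3) Y by simp
      then have "d z u + h \<le> J" using depth_away[OF pD(1) away[OF p(2)] v] HJ[OF v(1)] by simp
      moreover have "d z w = d z u + 1" using limb_dist[OF adj_sym[OF pD(1)] away[OF p(2)]] .
      ultimately have "d z x = h" "d z w = Suc J - h" using dxw pD(3) by (auto simp: d_sym)
      then show "p \<in> (\<lambda>((u, w), x). (x, u, w)) ` (?e \<times> ?a)"
        using p pD away[OF p(2)] by (auto simp: image_iff)
    qed
  qed
  then have S3: "card ?S3 = card ?e * card ?a"
    by (simp only: bij_betw_same_card[symmetric] card_cartesian_product)
  show ?thesis using card_S S1 S3 by simp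
qed

lemma count_branches: "count (branches z) Y = card {v. E z v \<and> code z v = Y}"
proof -
  have "count (branches z) Y = (\<Sum>v | v \<in> {v. E z v} \<and> code z v = Y. 1)"
    unfolding branches_def by (simp add: count_image_mset' Int_def conj_commute eq_commute)
  then show ?thesis by simp
qed

lemma filter_branches:
  "filter_mset Q (branches z) = image_mset (code z) (mset_set {v. E z v \<and> Q (code z v)})"
  unfolding branches_def by (simp add: filter_mset_image_mset filter_mset_mset_set)

lemma filter_branches_depth:
  "filter_mset (\<lambda>C. Q (height C)) (branches z) = image_mset (code z) (mset_set {v. E z v \<and> Q (depth z v)})"
proof -
  have "{v. E z v \<and> Q (height (code z v))} = {v. E z v \<and> Q (depth z v)}" using height_code by auto
  then show ?thesis using filter_branches[of "\<lambda>C. Q (height C)" z] by simp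
qed

text \<open>A vertex outside the tall part at distance \<open>h\<close> lies in a branch of height
  exactly \<open>h\<close>. The count is thus a sum over the multiset to be determined, which gives
  the monotonicity exploited in \<open>core_step\<close>.\<close>

lemma low_level:
  assumes z: "z \<in> V"
  shows "card {x \<in> V - tall_part z h. d z x = h} = (\<Sum>C\<in>#filter_mset (\<lambda>C. height C = h) (branches z). levels C (h - 1))"
proof -
  let ?N = "{v. E z v \<and> depth z v = h}"
  have U: "{x \<in> V - tall_part z h. d z x = h} = (\<Union>v\<in>?N. {x \<in> limb z v. d z x = h})"
  proof (intro set_eqI iffI)
    fix x assume x: "x \<in> {x \<in> V - tall_part z h. d z x = h}"
    then have "x \<noteq> z" by (auto simp: tall_part_def)
    then obtain v where v: "E z v" "x \<in> limb z v" using ex_branch x z by (metis DiffD1 mem_Collect_eq)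
    then have "depth z v = h" using tall_part_branch[OF v, of h] x depth_ge[OF v(2)] by auto
    then show "x \<in> (\<Union>v\<in>?N. {x \<in> limb z v. d z x = h})" using v x by auto
  next
    fix x assume "x \<in> (\<Union>v\<in>?N. {x \<in> limb z v. d z x = h})"
    then obtain v where v: "E z v" "depth z v = h" "x \<in> limb z v" "d z x = h" by auto
    then show "x \<in> {x \<in> V - tall_part z h. d z x = h}" using tall_part_branch[OF v(1,3), of h] limb_V by auto
  qed
  have "card (\<Union>v\<in>?N. {x \<in> limb z v. d z x = h}) = (\<Sum>v\<in>?N. card {x \<in> limb z v. d z x = h})"
  proof (rule card_UN_disjoint)
    show "finite ?N" by (rule finite_subset[OF _ finite_nbr[of z]]) auto
    show "\<forall>v\<in>?N. \<forall>v'\<in>?N. v \<noteq> v' \<longrightarrow> {x \<in> limb z v. d z x = h} \<inter> {x \<in> limb z v'. d z x = h} = {}"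
    proof (intro ballI impI)
      fix v v' assume v: "v \<in> ?N" "v' \<in> ?N" "v \<noteq> v'"
      then have "limb z v \<inter> limb z v' = {}" using branch_unique[of z v v'] by blast
      then show "{x \<in> limb z v. d z x = h} \<inter> {x \<in> limb z v'. d z x = h} = {}" by blast
    qed
  qed auto
  also have "\<dots> = (\<Sum>v\<in>?N. levels (code z v) (h - 1))"
  proof (intro sum.cong refl)
    fix v assume "v \<in> ?N"
    then have "E z v" "h > 0" using depth_pos by force+
    then show "card {x \<in> limb z v. d z x = h} = levels (code z v) (h - 1)" using levels_code by simp
  qed
  also have "\<dots> = (\<Sum>C\<in>#filter_mset (\<lambda>C. height C = h) (branches z). levels C (h - 1))"
    using filter_branches_depth[of "\<lambda>i. i = h" z]
    by (simp add: sum_unfold_sum_mset image_mset.compositionality comp_def)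
  finally show ?thesis unfolding U .
qed

lemma closed_tall_part:
  assumes z: "z \<in> V" shows "closed z (tall_part z h)"
  unfolding closed_def
proof (intro conjI ballI allI impI)
  show "z \<in> tall_part z h" "tall_part z h \<subseteq> V" using tall_part_V[OF z] by (auto simp: tall_part_def)
  fix y y' assume y: "y \<in> tall_part z h" "E y y' \<and> d z y = d z y' + 1"
  then have "y \<noteq> z" by auto
  then obtain v where v: "E z v" "y \<in> limb z v" "h < depth z v" using y(1) by (auto simp: tall_part_def)
  have "y' = z \<or> y' \<in> limb z v"
    using closed_insert_limb[OF v(1)] y v unfolding closed_def by blast
  then show "y' \<in> tall_part z h" using v by (auto simp: tall_part_def)
qed

lemma limb_in_tall_part:
  assumes "E u w" "z \<in> limb w u" "w \<in> tall_part z h" "z \<in> V"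
  shows "limb u w \<subseteq> tall_part z h" "u \<in> tall_part z h"
proof -
  obtain v where v: "E z v" "w \<in> limb z v" "limb u w \<subseteq> limb z v" "u = z \<and> w = v \<or> u \<in> limb z v"
    using away_branch[OF assms(1,2,4)] .
  have "h < depth z v" using tall_part_branch[OF v(1,2)] assms(3) by blast
  then have "limb z v \<subseteq> tall_part z h" using v(1) by (auto simp: tall_part_def)
  then show "limb u w \<subseteq> tall_part z h" "u \<in> tall_part z h" using v by (auto simp: tall_part_def)
qed

end

lemma sum_mset_mono_sub:
  fixes f :: "'a \<Rightarrow> nat"
  assumes "A \<subseteq># B" shows "(\<Sum>x\<in>#A. f x) \<le> (\<Sum>x\<in>#B. f x)"
  using assms by (auto simp: mset_subset_eq_exists_conv)

context deck_trees
begin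

lemma branches_iso:
  assumes "z \<in> V" "z' \<in> V'" "N \<subseteq> {v. E z v}" "N' \<subseteq> {v. E' z' v}"
    and "image_mset (A.code z) (mset_set N) = image_mset (B.code z') (mset_set N')"
  obtains g where "bij_betw g (insert z (\<Union>v\<in>N. A.limb z v)) (insert z' (\<Union>v\<in>N'. B.limb z' v))" "g z = z'"
    "iemb E (insert z (\<Union>v\<in>N. A.limb z v)) E' g"
proof -
  have "\<exists>f. bij_betw f (A.trunc (card V) z v) (B.trunc (card V) z' v') \<and> f v = v' \<and> iemb E (A.trunc (card V) z v) E' f"
    if "v \<in> N" "v' \<in> N'" "tcode E (card V) z v = tcode E' (card V) z' v'" for v v'
    using code_iso that assms(3,4) by blast
  from gluing[OF assms(3,4) _ this]
  obtain g where g: "bij_betw g (insert z (\<Union>v\<in>N. A.trunc (card V) z v)) (insert z' (\<Union>v\<in>N'. B.trunc (card V) z' v))"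
    "g z = z'" "iemb E (insert z (\<Union>v\<in>N. A.trunc (card V) z v)) E' g"
    using assms(5) card_eq by auto
  moreover have "(\<Union>v\<in>N. A.trunc (card V) z v) = (\<Union>v\<in>N. A.limb z v)"
    using assms(3) A.trunc_code by (intro SUP_cong) auto
  moreover have "(\<Union>v\<in>N'. B.trunc (card V) z' v) = (\<Union>v\<in>N'. B.limb z' v)"
    using assms(4) B.trunc_code card_eq by (intro SUP_cong) auto
  ultimately show ?thesis using that by simp
qed

lemma branches_eq_iso:
  assumes "z \<in> V" "z' \<in> V'" "A.branches z = B.branches z'"
  shows "\<exists>g. bij_betw g V V' \<and> iemb E V E' g"
proof -
  obtain g where "bij_betw g (insert z (\<Union>v\<in>{v. E z v}. A.limb z v)) (insert z' (\<Union>v\<in>{v. E' z' v}. B.limb z' v))"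
    "iemb E (insert z (\<Union>v\<in>{v. E z v}. A.limb z v)) E' g"
    using branches_iso[OF assms(1,2) subset_refl subset_refl]
    using assms(3) unfolding A.branches_def B.branches_def by metis
  then show ?thesis using A.limb_branches[OF assms(1)] B.limb_branches[OF assms(2)] by auto
qed

text \<open>Both sides split as in \<open>count_split\<close>. The part of the tree made of the branches higher than
  \<open>h\<close> is common, so the counts differ by \<open>\<Delta>\<mu> * \<pi> + e * \<Delta>a\<close>, where \<open>a\<close> is a monotone function of
  the multiplicities \<open>\<mu>\<close> of the branches of height \<open>h\<close>. This forces \<open>\<Delta>a = 0\<close>.\<close>

lemma core_step:
  assumes z: "z \<in> V" "z' \<in> V'" and HJ: "\<And>v. E z v \<Longrightarrow> A.depth z v \<le> J" "\<And>v. E' z' v \<Longrightarrow> B.depth z' v \<le> J"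
    and cnt: "\<And>Y. A.code_count (Suc J) (card V) Y = B.code_count (Suc J) (card V') Y"
    and h: "h < J" and top: "E z v0" "A.depth z v0 = J"
    and higher: "filter_mset (\<lambda>C. h < height C) (A.branches z) = filter_mset (\<lambda>C. h < height C) (B.branches z')"
  shows "filter_mset (\<lambda>C. height C = h) (A.branches z) = filter_mset (\<lambda>C. height C = h) (B.branches z')"
proof -
  let ?W = "A.tall_part z h" and ?W' = "B.tall_part z' h"
  obtain g where g: "bij_betw g ?W ?W'" "g z = z'" "iemb E ?W E' g"
    using branches_iso[OF z, of "{v. E z v \<and> h < A.depth z v}" "{v. E' z' v \<and> h < B.depth z' v}"] higher
    unfolding A.tall_part_def B.tall_part_def A.filter_branches_depth[of "\<lambda>i. h < i"] B.filter_branches_depth[of "\<lambda>i. h < i"]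
    by auto
  have gW: "g ` ?W = ?W'" using g(1) by (simp add: bij_betw_def)
  have WV: "?W \<subseteq> V" "?W' \<subseteq> V'" using A.tall_part_V B.tall_part_V z by auto
  have dist: "B.d (g x) (g y) = A.d x y" if "x \<in> ?W" "y \<in> ?W" for x y
    using iemb_dist[OF A.closed_tall_part[OF z(1)] g(3) _ that] gW WV by simp
  have inj: "g x = g y \<longleftrightarrow> x = y" if "x \<in> ?W" "y \<in> ?W" for x y
    using g(1) that by (auto simp: bij_betw_def dest: inj_onD)
  have inj_W: "inj_on g ?W" using g(1) by (simp add: bij_betw_def)
  have edge: "E' (g x) (g y) \<longleftrightarrow> E x y" if "x \<in> ?W" "y \<in> ?W" for x y
    using g(3) that by (simp add: iemb_def)
  have zW: "z \<in> ?W" by (simp add: A.tall_part_def)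
  have lam: "z' \<in> B.limb (g w) (g u) \<longleftrightarrow> z \<in> A.limb w u" if "u \<in> ?W" "w \<in> ?W" for u w
    using dist[OF zW that(1)] dist[OF zW that(2)] z g(2) by (simp add: A.limb_def B.limb_def)
  \<comment> \<open>A limb that points away from \<open>z\<close> and is rooted in the tall part
    lies entirely in it, so the isomorphism \<open>g\<close> of the tall parts preserves its
    code.\<close>
  have pcode: "B.code (g u) (g w) = A.code u w" if "E u w" "z \<in> A.limb w u" "w \<in> ?W" for u w
  proof -
    note L = A.limb_in_tall_part[OF that z(1)]
    have e': "E' (g u) (g w)" "g w \<in> ?W'" "z' \<in> B.limb (g w) (g u)" using edge lam L that gW by auto
    note L' = B.limb_in_tall_part[OF e'(1,3,2) z(2)]
    have "A.limb u w = {y \<in> ?W. A.d y w < A.d y u}" using L WV unfolding A.limb_def by blast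
    moreover have "B.limb (g u) (g w) = {y \<in> ?W'. B.d y (g w) < B.d y (g u)}"
      using L' WV unfolding B.limb_def by blast
    moreover have "{y \<in> ?W'. B.d y (g w) < B.d y (g u)} = g ` {y \<in> ?W. A.d y w < A.d y u}"
      unfolding gW[symmetric] using dist L(2) that(3) by auto
    ultimately have "g ` A.limb u w = B.limb (g u) (g w)" by simp
    then have "bij_betw g (A.trunc (card V) u w) (B.trunc (card V) (g u) (g w))"
      using A.trunc_code[OF that(1)] B.trunc_code[OF e'(1)] card_eq L(1) g(1)
      by (auto simp: bij_betw_def intro: inj_on_subset)
    moreover have "iemb E (A.trunc (card V) u w) E' g"
      using iemb_subset[OF g(3)] L(1) A.trunc_code[OF that(1)] by simp
    ultimately show ?thesis using iso_code[of u w "g u" "g w" g "card V"] that(1) e'(1) card_eq by simp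
  qed
  have awayA: "z \<in> A.limb w u" if "(x, u, w) \<in> A.anchored (Suc J)" for x u w
    using A.anchored_away[OF z(1) HJ(1) that] .
  have awayB: "z' \<in> B.limb w u" if "(x, u, w) \<in> B.anchored (Suc J)" for x u w
    using B.anchored_away[OF z(2) HJ(2) that] .
  let ?pi = "card {x \<in> V. A.d z x = J}" and ?pi' = "card {x \<in> V'. B.d z' x = J}"
  have topW: "x \<in> ?W" if x: "x \<in> V" "A.d z x = J" for x
  proof -
    have "x \<noteq> z" using x h by auto
    then obtain v where v: "E z v" "x \<in> A.limb z v" using A.ex_branch x z by metis
    then show ?thesis using A.tall_part_branch[OF v] A.depth_ge[OF v(2)] x h by simp
  qed
  have topW': "x \<in> ?W'" if x: "x \<in> V'" "B.d z' x = J" for x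
  proof -
    have "x \<noteq> z'" using x h by auto
    then obtain v where v: "E' z' v" "x \<in> B.limb z' v" using B.ex_branch x z by metis
    then show ?thesis using B.tall_part_branch[OF v] B.depth_ge[OF v(2)] x h by simp
  qed
  have pi_eq: "?pi = ?pi'"
  proof -
    have "{x \<in> V. A.d z x = J} = {x \<in> ?W. A.d z x = J}" using topW WV by blast
    moreover have "{x \<in> V'. B.d z' x = J} = {x \<in> ?W'. B.d z' x = J}" using topW' WV by blast
    moreover have "{x \<in> ?W'. B.d z' x = J} = g ` {x \<in> ?W. A.d z x = J}"
    proof -
      have "{x \<in> g ` ?W. B.d (g z) x = J} = g ` {x \<in> ?W. A.d z x = J}" using dist[OF zW] by auto
      then show ?thesis by (simp only: gW g(2))
    qed
    moreover have "inj_on g {x \<in> ?W. A.d z x = J}" using inj by (auto intro: inj_onI)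
    ultimately show ?thesis by (simp only: card_image)
  qed
  have pi_pos: "?pi > 0"
  proof -
    obtain x where "x \<in> A.limb z v0" "A.d z x = J" using A.depth_ex[OF top(1)] top(2) by metis
    then have "x \<in> {x \<in> V. A.d z x = J}" using A.limb_V by auto
    then show ?thesis using A.finite_V by (auto simp: card_gt_0_iff)
  qed
  let ?R = "\<lambda>Y. {(x, u, w). (x, u, w) \<in> A.anchored (Suc J) \<and> A.code u w = Y \<and> x \<in> ?W \<and> w \<in> ?W}"
  let ?R' = "\<lambda>Y. {(x, u, w). (x, u, w) \<in> B.anchored (Suc J) \<and> B.code u w = Y \<and> x \<in> ?W' \<and> w \<in> ?W'}"
  let ?G = "map_prod g (map_prod g g)"
  have R_eq: "card (?R Y) = card (?R' Y)" for Y
  proof -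
    have sub: "x \<in> ?W \<and> u \<in> ?W \<and> w \<in> ?W" if "(x, u, w) \<in> ?R Y" for x u w
      using that A.limb_in_tall_part(2)[OF A.anchored_D(1) awayA _ z(1)] by blast
    have im: "?G ` ?R Y = ?R' Y"
    proof (intro set_eqI iffI)
      fix q assume "q \<in> ?G ` ?R Y"
      then obtain x u w where q: "q = (g x, g u, g w)" "(x, u, w) \<in> ?R Y" by auto
      then have p: "(x, u, w) \<in> A.anchored (Suc J)" and W: "x \<in> ?W" "u \<in> ?W" "w \<in> ?W"
        using sub[OF q(2)] by auto
      note pD = A.anchored_D[OF p]
      have "g x \<in> B.limb (g w) (g u)"
        using pD(2) dist W gW WV by (auto simp: A.limb_def B.limb_def)
      then have "(g x, g u, g w) \<in> B.anchored (Suc J)"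
        using pD edge W dist by (auto simp: B.anchored_def)
      then show "q \<in> ?R' Y" using q W gW pcode[OF pD(1) awayA[OF p] W(3)] by auto
    next
      fix q assume "q \<in> ?R' Y"
      then obtain x' u' w' where q: "q = (x', u', w')" "(x', u', w') \<in> B.anchored (Suc J)" "B.code u' w' = Y"
        "x' \<in> ?W'" "w' \<in> ?W'" by auto
      then have "u' \<in> ?W'" using B.limb_in_tall_part(2)[OF B.anchored_D(1)[OF q(2)] awayB[OF q(2)] q(5) z(2)] by blast
      then obtain x u w where W: "x \<in> ?W" "u \<in> ?W" "w \<in> ?W" "x' = g x" "u' = g u" "w' = g w"
        using q(4,5) gW by blast
      note pD = B.anchored_D[OF q(2)]
      have e: "E u w" using pD(1) edge W by simp
      have "x \<in> A.limb w u" using pD(2) dist W WV by (auto simp: A.limb_def B.limb_def)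
      then have p: "(x, u, w) \<in> A.anchored (Suc J)" using e pD dist W by (auto simp: A.anchored_def)
      have "A.code u w = Y" using pcode[OF e awayA[OF p] W(3)] W q(3) by simp
      then show "q \<in> ?G ` ?R Y" using q W p by (auto intro!: image_eqI[of _ _ "(x, u, w)"])
    qed
    have "inj_on ?G (?R Y)"
    proof (rule inj_on_subset[OF map_prod_inj_on[OF inj_W map_prod_inj_on[OF inj_W inj_W]]], rule subsetI)
      fix p assume p: "p \<in> ?R Y"
      obtain x u w where "p = (x, u, w)" by (cases p)
      then show "p \<in> ?W \<times> ?W \<times> ?W" using sub[of x u w] p by blast
    qed
    from card_image[OF this] show ?thesis unfolding im ..
  qed
  let ?e = "\<lambda>Y. {(u, w). E u w \<and> z \<in> A.limb w u \<and> w \<in> ?W \<and> A.d z w = Suc J - h \<and> A.code u w = Y}"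
  let ?e' = "\<lambda>Y. {(u, w). E' u w \<and> z' \<in> B.limb w u \<and> w \<in> ?W' \<and> B.d z' w = Suc J - h \<and> B.code u w = Y}"
  have e_eq: "card (?e Y) = card (?e' Y)" for Y
  proof -
    have sub: "u \<in> ?W \<and> w \<in> ?W" if "(u, w) \<in> ?e Y" for u w
      using that A.limb_in_tall_part(2)[OF _ _ _ z(1)] by blast
    have im: "map_prod g g ` ?e Y = ?e' Y"
    proof (intro set_eqI iffI)
      fix q assume "q \<in> map_prod g g ` ?e Y"
      then obtain u w where q: "q = (g u, g w)" "(u, w) \<in> ?e Y" by auto
      then have W: "u \<in> ?W" "w \<in> ?W" using sub[OF q(2)] by auto
      show "q \<in> ?e' Y" using q W gW pcode[of u w] edge lam dist[OF zW] g(2) by auto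
    next
      fix q assume "q \<in> ?e' Y"
      then obtain u' w' where q: "q = (u', w')" "E' u' w'" "z' \<in> B.limb w' u'" "w' \<in> ?W'"
        "B.d z' w' = Suc J - h" "B.code u' w' = Y" by auto
      then have "u' \<in> ?W'" using B.limb_in_tall_part(2)[OF q(2,3,4) z(2)] by blast
      then obtain u w where W: "u \<in> ?W" "w \<in> ?W" "u' = g u" "w' = g w"
        using q(4) gW by blast
      have "E u w" "z \<in> A.limb w u" using q W edge lam by auto
      then have "(u, w) \<in> ?e Y" using pcode[of u w] q W dist[OF zW W(2)] g(2) by auto
      then show "q \<in> map_prod g g ` ?e Y" using q W by (auto intro!: image_eqI[of _ _ "(u, w)"])
    qed
    have "inj_on (map_prod g g) (?e Y)"
    proof (rule inj_on_subset[OF map_prod_inj_on[OF inj_W inj_W]], rule subsetI)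
      fix p assume p: "p \<in> ?e Y"
      obtain u w where "p = (u, w)" by (cases p)
      then show "p \<in> ?W \<times> ?W" using sub[of u w] p by blast
    qed
    from card_image[OF this] show ?thesis unfolding im ..
  qed
  let ?FA = "filter_mset (\<lambda>C. height C = h) (A.branches z)" and ?FB = "filter_mset (\<lambda>C. height C = h) (B.branches z')"
  let ?a = "\<Sum>C\<in>#?FA. levels C (h - 1)" and ?a' = "\<Sum>C\<in>#?FB. levels C (h - 1)"
  have main: "count ?FA Y * ?pi + card (?e Y) * ?a = count ?FB Y * ?pi + card (?e Y) * ?a'"
    if "height Y = h" for Y
    using A.count_split[OF z(1) HJ(1) h that] B.count_split[OF z(2) HJ(2) h that] cnt[of Y]
      R_eq[of Y] e_eq[of Y] pi_eq A.low_level[OF z(1), of h] B.low_level[OF z(2), of h]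
      A.count_branches[of z Y] B.count_branches[of z' Y] that by simp
  \<comment> \<open>If \<open>?a\<close> were smaller than \<open>?a'\<close>, then
    \<open>main\<close> would give each code at most as many occurrences in \<open>?FB\<close> as in
    \<open>?FA\<close>, and summing levels would yield the opposite inequality.\<close>
  have "?a = ?a'"
  proof (rule ccontr)
    assume "?a \<noteq> ?a'"
    then consider "?a < ?a'" | "?a' < ?a" by linarith
    then show False
    proof cases
      case 1
      have "count ?FB Y \<le> count ?FA Y" for Y
      proof (cases "height Y = h")
        case True
        have "card (?e Y) * ?a \<le> card (?e Y) * ?a'" using 1 by simp
        then have "count ?FB Y * ?pi \<le> count ?FA Y * ?pi" using main[OF True] by linarith
        then show ?thesis using pi_pos by simp
      qed simp
      then have "?FB \<subseteq># ?FA" by (simp add: subseteq_mset_def)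
      then show False using sum_mset_mono_sub[of ?FB ?FA "\<lambda>C. levels C (h - 1)"] 1 by simp
    next
      case 2
      have "count ?FA Y \<le> count ?FB Y" for Y
      proof (cases "height Y = h")
        case True
        have "card (?e Y) * ?a' \<le> card (?e Y) * ?a" using 2 by simp
        then have "count ?FA Y * ?pi \<le> count ?FB Y * ?pi" using main[OF True] by linarith
        then show ?thesis using pi_pos by simp
      qed simp
      then have "?FA \<subseteq># ?FB" by (simp add: subseteq_mset_def)
      then show False using sum_mset_mono_sub[of ?FA ?FB "\<lambda>C. levels C (h - 1)"] 2 by simp
    qed
  qed
  then have "count ?FA Y = count ?FB Y" for Y
    using main[of Y] pi_pos by (cases "height Y = h") auto
  then show ?thesis by (rule multiset_eqI)
qed

text \<open>Descending induction on the height of the branches; \<open>k\<close> is how far below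
  \<open>J\<close> they are already known to agree.\<close>

lemma core:
  assumes z: "z \<in> V" "z' \<in> V'" and HJ: "\<And>v. E z v \<Longrightarrow> A.depth z v \<le> J" "\<And>v. E' z' v \<Longrightarrow> B.depth z' v \<le> J"
    and cnt: "\<And>Y. A.code_count (Suc J) (card V) Y = B.code_count (Suc J) (card V') Y"
    and top: "E z v0" "A.depth z v0 = J"
    and highest: "filter_mset (\<lambda>C. height C = J) (A.branches z) = filter_mset (\<lambda>C. height C = J) (B.branches z')"
  shows "\<exists>g. bij_betw g V V' \<and> iemb E V E' g"
proof -
  have hle: "height C \<le> J" if "C \<in># A.branches z" for C
    using that HJ(1) A.height_code by (auto simp: A.branches_def)
  have hle': "height C \<le> J" if "C \<in># B.branches z'" for C
    using that HJ(2) B.height_code by (auto simp: B.branches_def)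
  have "filter_mset (\<lambda>C. J - k \<le> height C) (A.branches z) = filter_mset (\<lambda>C. J - k \<le> height C) (B.branches z')"
    if "k \<le> J" for k
    using that
  proof (induction k)
    case 0
    have "filter_mset (\<lambda>C. J - 0 \<le> height C) (A.branches z) = filter_mset (\<lambda>C. height C = J) (A.branches z)"
      using hle by (intro filter_mset_cong) (auto intro: antisym)
    moreover have "filter_mset (\<lambda>C. J - 0 \<le> height C) (B.branches z') = filter_mset (\<lambda>C. height C = J) (B.branches z')"
      using hle' by (intro filter_mset_cong) (auto intro: antisym)
    ultimately show ?case using highest by simp
  next
    case (Suc k)
    let ?h = "J - Suc k"
    have *: "filter_mset (\<lambda>C. ?h \<le> height C) X = filter_mset (\<lambda>C. ?h < height C) X + filter_mset (\<lambda>C. height C = ?h) X"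
      for X by (rule multiset_eqI) auto
    have "(\<lambda>C. J - k \<le> height C) = (\<lambda>C. ?h < height C)" using Suc.prems by (auto simp: fun_eq_iff)
    then have higher: "filter_mset (\<lambda>C. ?h < height C) (A.branches z) = filter_mset (\<lambda>C. ?h < height C) (B.branches z')"
      using Suc by simp
    have "?h < J" using Suc.prems by simp
    from core_step[OF z HJ cnt this top higher] show ?case using higher by (simp add: *)
  qed
  from this[of J] have "A.branches z = B.branches z'" by simp
  then show ?thesis using branches_eq_iso[OF z] by blast
qed

end

section \<open>Trees concentrated on a diametral path\<close>

primrec children :: "rtree \<Rightarrow> rtree multiset" where "children (Node M) = M"

text \<open>The truncation of codes, matching the parameter of \<open>tcode\<close> by
  \<open>prune_tcode\<close>.\<close>

primrec prune :: "nat \<Rightarrow> rtree \<Rightarrow> rtree" where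
  "prune 0 C = Node {#}"
| "prune (Suc m) C = Node (image_mset (prune m) (children C))"

lemma prune_tcode: "prune m (tcode E (Suc m) u w) = tcode E m u w"
proof (induction m arbitrary: u w)
  case (Suc m)
  have "image_mset (prune m) (image_mset (tcode E (Suc m) w) S) = image_mset (tcode E m w) S" for S
    unfolding image_mset.compositionality comp_def using Suc by simp
  then show ?case by (simp del: tcode.simps add: tcode.simps(2)[of E "Suc m"] tcode.simps(2)[of E m u])
qed simp

lemma height_pos: "0 < height C"
  by (cases C) simp

context tree_graph
begin

lemma less_height_tcode_depth:
  assumes "E u w" shows "i < height (tcode E m u w) \<longleftrightarrow> i < depth u w \<and> i \<le> m"
proof
  assume "i < height (tcode E m u w)"
  then obtain y where y: "y \<in> trunc m u w" "d w y = i" using less_height_tcode[OF assms] by blast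
  then have "d u y = i + 1" "d u y \<le> depth u w" "i \<le> m"
    using limb_dist'[OF assms, of y] depth_ge[of y u w] by (auto simp: trunc_def)
  then show "i < depth u w \<and> i \<le> m" by simp
next
  assume i: "i < depth u w \<and> i \<le> m"
  then have "i < height (code u w)" using height_code[OF assms] by simp
  then obtain y where "y \<in> trunc (card V) u w" "d w y = i" using less_height_tcode[OF assms] by blast
  then have "y \<in> trunc m u w" using i by (simp add: trunc_def)
  then show "i < height (tcode E m u w)" using less_height_tcode[OF assms] \<open>d w y = i\<close> by blast
qed

lemma branches_split:
  assumes "E u w" shows "branches w = add_mset (code w u) (children (code u w))"
proof -
  have "mset_set {v. E w v} = add_mset u (mset_set ({v. E w v} - {u}))"
    using adj_sym[OF assms] by (simp add: mset_set.remove)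
  then show ?thesis by (simp add: branches_def code_rec[OF assms])
qed

text \<open>A set and not a multiset: the number of triples with a given code also depends on the
  number of possible starting points \<open>x\<close>, and only the occurrence of codes is
  wanted.\<close>

definition codes_at :: "nat \<Rightarrow> nat \<Rightarrow> rtree set" where
  "codes_at t K = {code u w |x u w. (x, u, w) \<in> anchored t \<and> depth u w = K}"

text \<open>Limbs whose truncation at \<open>K - 1\<close> is \<open>Y\<close> are either equal to their truncation or go deeper. The
  latter are counted by their truncations at \<open>K\<close>.\<close>

lemma codes_at_count:
  assumes K: "1 \<le> K" and hY: "height Y = K" and finS: "finite S"
    and S: "{Y' \<in> pcode K ` anchored t. K < height Y' \<and> prune (K - 1) Y' = Y} \<subseteq> S"
    "\<And>Y'. Y' \<in> S \<Longrightarrow> K < height Y' \<and> prune (K - 1) Y' = Y"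
  shows "code_count t (K - 1) Y =
    card {(x, u, w) \<in> anchored t. depth u w = K \<and> code u w = Y} + (\<Sum>Y'\<in>S. code_count t K Y')"
proof -
  let ?G = "{(x, u, w) \<in> anchored t. depth u w = K \<and> code u w = Y}"
  let ?U = "\<Union>Y'\<in>S. {p \<in> anchored t. pcode K p = Y'}"
  have tcode_prune: "prune (K - 1) (tcode E K u w) = tcode E (K - 1) u w" for u w
    using prune_tcode[of "K - 1" E u w] K by simp
  have "{p \<in> anchored t. pcode (K - 1) p = Y} = ?G \<union> ?U"
  proof (intro set_eqI iffI)
    fix p assume pA: "p \<in> {p \<in> anchored t. pcode (K - 1) p = Y}"
    obtain x u w where p: "p = (x, u, w)" by (cases p)
    have e: "E u w" "tcode E (K - 1) u w = Y" "(x, u, w) \<in> anchored t" using pA anchored_D(1) by (auto simp: p)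
    have HK: "K \<le> depth u w" using less_height_tcode_depth[OF e(1), of "K - 1" "K - 1"] e hY K by simp
    show "p \<in> ?G \<union> ?U"
    proof (cases "depth u w = K")
      case True
      then have "tcode E (K - 1) u w = code u w" using e K depth_le[OF e(1)] by (intro tcode_stable) auto
      then show ?thesis using True e p by auto
    next
      case False
      then have "K < height (tcode E K u w)" using HK less_height_tcode_depth[OF e(1)] by simp
      moreover have "tcode E K u w \<in> pcode K ` anchored t" using e(3) by (auto intro!: image_eqI[of _ _ "(x, u, w)"])
      ultimately have "tcode E K u w \<in> S" using tcode_prune e(2) S(1) by blast
      then show ?thesis using p e by auto
    qed
  next
    fix p assume pA: "p \<in> ?G \<union> ?U"
    obtain x u w where p: "p = (x, u, w)" by (cases p)
    have pP: "(x, u, w) \<in> anchored t" using pA by (auto simp: p)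
    note e = anchored_D(1)[OF pP]
    show "p \<in> {p \<in> anchored t. pcode (K - 1) p = Y}"
    proof (cases "p \<in> ?G")
      case True
      then have "tcode E (K - 1) u w = code u w" using e K depth_le[OF e(1)] p by (intro tcode_stable) auto
      then show ?thesis using True by (auto simp: p)
    next
      case False
      then have "tcode E K u w \<in> S" using pA by (auto simp: p)
      then have "tcode E (K - 1) u w = Y" using S(2)[of "tcode E K u w"] tcode_prune[of u w] by simp
      then show ?thesis using pP by (simp add: p)
    qed
  qed
  moreover have "?G \<inter> ?U = {}"
  proof -
    have "\<not> K < height (tcode E K u w)" if "(x, u, w) \<in> ?G" for x u w
      using that less_height_tcode_depth[OF anchored_D(1)] by auto
    then show ?thesis using S(2) by auto
  qed
  moreover have "card ?U = (\<Sum>Y'\<in>S. code_count t K Y')"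
    using finS by (intro card_UN_disjoint) auto
  moreover have "finite ?G" by (rule finite_subset[OF _ finite_anchored[of t]]) auto
  ultimately show ?thesis using finS by (simp add: card_Un_disjoint)
qed

lemma codes_at_iff: "Y \<in> codes_at t K \<longleftrightarrow> {(x, u, w) \<in> anchored t. depth u w = K \<and> code u w = Y} \<noteq> {}"
proof
  assume "Y \<in> codes_at t K"
  then obtain x u w where "(x, u, w) \<in> {(x, u, w) \<in> anchored t. depth u w = K \<and> code u w = Y}"
    by (auto simp: codes_at_def)
  then show "{(x, u, w) \<in> anchored t. depth u w = K \<and> code u w = Y} \<noteq> {}" by (rule ex_in_conv[THEN iffD1, OF exI])
next
  assume "{(x, u, w) \<in> anchored t. depth u w = K \<and> code u w = Y} \<noteq> {}"
  then obtain p where p: "p \<in> {(x, u, w) \<in> anchored t. depth u w = K \<and> code u w = Y}" by (rule ex_in_conv[THEN iffD2, THEN exE])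
  obtain x u w where "p = (x, u, w)" by (cases p)
  then have "(x, u, w) \<in> anchored t" "depth u w = K" "code u w = Y" using p by auto
  then show "Y \<in> codes_at t K" unfolding codes_at_def by blast
qed

text \<open>The edge \<open>u w\<close> lies on the path from \<open>a\<close> to \<open>b\<close>,
  with \<open>w\<close> on the side of \<open>a\<close> and at distance \<open>k\<close> from it. So
  \<open>limb u w\<close> is the end of the tree around \<open>a\<close>, of depth
  \<open>k + 1\<close> if the path is diametral.\<close>

definition cut :: "'a \<Rightarrow> 'a \<Rightarrow> nat \<Rightarrow> 'a \<Rightarrow> 'a \<Rightarrow> bool" where
  "cut a b k u w \<longleftrightarrow> E u w \<and> a \<in> limb u w \<and> b \<in> limb w u \<and> d a w = k"

definition off_path_low :: "'a \<Rightarrow> 'a \<Rightarrow> nat \<Rightarrow> bool" where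
  "off_path_low a b t \<longleftrightarrow> (\<forall>u y. E u y \<and> limb u y \<inter> interval a b = {} \<longrightarrow> depth u y < t)"

lemma off_path_low_sym: "off_path_low a b t \<Longrightarrow> off_path_low b a t"
  unfolding off_path_low_def using interval_sym by metis

lemma cut_d:
  assumes "cut a b k u w"
  shows "d a b = k + 1 + d u b" "u \<in> interval a b" "w \<in> interval a b" "d a u = k + 1" "d a w = k" "E u w"
proof -
  have c: "E u w" "a \<in> limb u w" "b \<in> limb w u" "d a w = k" using assms by (auto simp: cut_def)
  have "d b a = d b u + d u a" using cross'[OF c(1,3,2)] .
  moreover have au: "d a u = k + 1" using limb_dist[OF c(1,2)] c(4) by simp
  ultimately show 1: "d a b = k + 1 + d u b" by (simp add: d_sym)
  have "d b w = d b u + 1" using limb_dist[OF adj_sym[OF c(1)] c(3)] .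
  then show "u \<in> interval a b" "w \<in> interval a b" "d a u = k + 1" "d a w = k" "E u w"
    using 1 au c adj_V adj_V' by (auto simp: interval_def d_sym)
qed

lemma cut_unique:
  assumes "cut a b k u w" "cut a b k u' w'"
  shows "u' = u" "w' = w"
proof -
  have "a \<in> V" "b \<in> V" using assms(1) limb_V by (auto simp: cut_def)
  then show "u' = u" "w' = w"
    using interval_unique[of u' a b u] interval_unique[of w' a b w] cut_d[OF assms(1)] cut_d[OF assms(2)] by auto
qed

lemma cut_ex:
  assumes "a \<in> V" "b \<in> V" "k < d a b"
  obtains u w where "cut a b k u w"
proof -
  obtain u where u: "u \<in> interval a b" "d a u = k + 1" using interval_ex[of a b "k + 1"] assms by auto
  then have uV: "u \<in> V" "u \<noteq> a" using interval_V by auto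
  obtain w where w: "E u w" "d a u = d a w + 1" using ex_closer assms(1) uV by blast
  have "w \<in> interval a b" using interval_step[OF assms(1) adj_sym[OF w(1)] w(2) assms(2) u(1)] .
  then have "d w b = d u b + 1" using u w by (simp add: interval_def)
  then have "cut a b k u w"
    using w u assms by (simp add: cut_def limb_def d_sym)
  then show ?thesis using that by blast
qed

lemma cut_flip:
  assumes "cut a b k u w" shows "cut b a (d a b - k - 1) w u"
  using assms cut_d[OF assms] adj_sym by (auto simp: cut_def d_sym)

lemma cut_depth:
  assumes "cut a b k u w" "d a b = diam"
  shows "depth u w = k + 1"
proof -
  have c: "E u w" "a \<in> limb u w" "b \<in> limb w u" using assms by (auto simp: cut_def)
  have "d u y \<le> k + 1" if y: "y \<in> limb u w" for y
  proof -
    have "d b y = d b u + d u y" using cross'[OF c(1,3) y] .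
    moreover have "d b y \<le> diam" using d_le_diam c y limb_V by blast
    ultimately show ?thesis using cut_d(1)[OF assms(1)] assms(2) by (simp add: d_sym)
  qed
  moreover have "d u a = k + 1" using cut_d[OF assms(1)] by (simp add: d_sym)
  ultimately show ?thesis using depth_ex[OF c(1)] depth_ge[OF c(2)] by (metis antisym)
qed

lemma cut_anchored:
  assumes "cut a b k u w" "1 \<le> t" "t + k \<le> d a b"
  obtains x where "(x, u, w) \<in> anchored t"
proof -
  have c: "E u w" "a \<in> limb u w" "b \<in> limb w u" using assms by (auto simp: cut_def)
  have V: "u \<in> V" "b \<in> V" using c adj_V limb_V by blast+
  have "t - 1 \<le> d u b" using assms(2,3) cut_d(1)[OF assms(1)] by simp
  then obtain x where x: "x \<in> interval u b" "d u x = t - 1" using interval_ex[OF V] by blast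
  have xL: "x \<in> limb w u"
    using limb_convex[OF adj_sym[OF c(1)] limb_self[OF adj_sym[OF c(1)]] c(3)] x by blast
  have "d x w = t" using limb_dist[OF adj_sym[OF c(1)] xL] x assms(2) by (simp add: d_sym)
  then show ?thesis using that xL c by (simp add: anchored_def)
qed

lemma cut_codes_at:
  assumes "cut a b k u w" "d a b = diam" "1 \<le> t" "t + k \<le> diam"
  shows "code u w \<in> codes_at t (k + 1)"
proof -
  obtain x where "(x, u, w) \<in> anchored t" using cut_anchored[OF assms(1,3)] assms by auto
  then show ?thesis using cut_depth[OF assms(1,2)] by (auto simp: codes_at_def)
qed

text \<open>Neither side of the edge can miss the path, as both are at least \<open>t\<close> deep.
  By convexity the edge then separates \<open>a\<close> from \<open>b\<close>.\<close>

lemma off_path_low_cut: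
  assumes "off_path_low a b t" "a \<in> V" "b \<in> V" "E u w" "t \<le> depth u w" "t \<le> depth w u"
  shows "cut a b (d a w) u w \<or> cut b a (d b w) u w"
proof (rule ccontr)
  assume *: "\<not> ?thesis"
  have L: "limb u w \<inter> limb w u = {}" "limb u w \<union> limb w u = V"
    using limb_compl[OF assms(4)] limb_V by auto
  have "limb u w \<inter> interval a b \<noteq> {}" "limb w u \<inter> interval a b \<noteq> {}"
    using assms(1,4-6) adj_sym[OF assms(4)] unfolding off_path_low_def by (auto simp: not_less[symmetric])
  then have "\<not> interval a b \<subseteq> limb w u" "\<not> interval a b \<subseteq> limb u w" using L(1) by blast+
  then have "\<not> (a \<in> limb w u \<and> b \<in> limb w u)" "\<not> (a \<in> limb u w \<and> b \<in> limb u w)"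
    using limb_convex assms(4) adj_sym by blast+
  then show False using * assms(2-4) L by (auto simp: cut_def)
qed

lemma off_path_low_codes_at:
  assumes "off_path_low a b t" "a \<in> V" "b \<in> V" "d a b = diam" "t \<le> k + 1" "Y \<in> codes_at t (k + 1)"
  shows "\<exists>u w. Y = code u w \<and> (cut a b k u w \<or> cut b a k u w)"
proof -
  obtain x u w where p: "Y = code u w" "(x, u, w) \<in> anchored t" "depth u w = k + 1"
    using assms(6) by (auto simp: codes_at_def)
  note pD = anchored_D[OF p(2)]
  have "t \<le> depth w u" using depth_ge[OF pD(2)] pD(3) by (simp add: d_sym)
  then consider "cut a b (d a w) u w" | "cut b a (d b w) u w"
    using off_path_low_cut[OF assms(1-3) pD(1)] p(3) assms(5) by auto
  then show ?thesis
  proof cases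
    case 1
    then show ?thesis using cut_depth[OF 1 assms(4)] p by auto
  next
    case 2
    then show ?thesis using cut_depth[OF 2] assms(4) p by (auto simp: d_sym)
  qed
qed

text \<open>Truncation cuts off the far part of the diametral path, which is at least half of it.\<close>

lemma cut_trunc_card:
  assumes c: "cut a b i u w" and ab: "d a b = diam" and K: "K \<le> i + 1" "K \<le> diam"
  shows "card (trunc K u w) + diam \<le> card V + K"
proof -
  have e: "E u w" "a \<in> limb u w" "b \<in> limb w u" using c by (auto simp: cut_def)
  have V: "a \<in> V" "b \<in> V" "u \<in> V" "w \<in> V" using e limb_V adj_V adj_V' by auto
  note tcode = cut_d[OF c]
  have "interval u b \<subseteq> limb w u" using limb_convex[OF adj_sym[OF e(1)] limb_self[OF adj_sym[OF e(1)]] e(3)] .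
  then have "d u b + 1 \<le> card (limb w u)" using card_mono[of "limb w u" "interval u b"] interval_card V by simp
  then have beyond: "card (limb u w) + diam \<le> card V + i" using limb_card[OF e(1)] tcode ab by simp
  show ?thesis
  proof (cases "i < K + 1")
    case True
    then show ?thesis using beyond card_mono[of "limb u w" "trunc K u w"] trunc_limb K by simp
  next
    case False
    \<comment> \<open>The path from \<open>a\<close> to \<open>q\<close> has \<open>i - K\<close>
      vertices, all at distance more than \<open>K\<close> from \<open>w\<close>, so the truncation
      loses at least that many.\<close>
    then obtain q where q: "q \<in> interval a w" "d a q = i - K - 1"
      using interval_ex[of a w "i - K - 1"] V tcode by auto
    have qL: "q \<in> limb u w" using limb_convex[OF e(1,2) limb_self[OF e(1)]] q by blast
    have sub: "interval a q \<subseteq> limb u w" using limb_convex[OF e(1,2) qL] .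
    have "interval a q \<inter> trunc K u w = {}"
    proof (rule ccontr)
      assume "interval a q \<inter> trunc K u w \<noteq> {}"
      then obtain y where y: "y \<in> interval a q" "y \<in> trunc K u w" by blast
      have "d a w \<le> d a y + d y w" using d_triangle V y interval_V by blast
      moreover have "d a y \<le> d a q" using y(1) by (simp add: interval_def)
      moreover have "d w y \<le> K" using y(2) by (simp add: trunc_def)
      ultimately show False using q tcode False by (simp add: d_sym)
    qed
    then have "card (interval a q) + card (trunc K u w) = card (interval a q \<union> trunc K u w)"
      by (simp add: card_Un_disjoint)
    also have "\<dots> \<le> card (limb u w)" using sub trunc_limb by (intro card_mono) auto
    finally have "card (interval a q) + card (trunc K u w) \<le> card (limb u w)" .
    moreover have "card (interval a q) = i - K - 1 + 1" using interval_card[of a q] V qL limb_V q(2) by auto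
    ultimately show ?thesis using beyond False by linarith
  qed
qed

lemma cut_odd:
  assumes "cut a b k u w" "d a b = 2 * k + 1"
  shows "cut b a k w u"
  using cut_flip[OF assms(1)] assms(2) by (simp add: mult_2)

lemma cut_even_centre:
  assumes "cut a b k u w" "cut b a k u' w'" "d a b = 2 * k"
  shows "w' = w" "u' \<noteq> u"
proof -
  have V: "a \<in> V" "b \<in> V" using assms(1) limb_V by (auto simp: cut_def)
  note c = cut_d[OF assms(1)] and c' = cut_d[OF assms(2)]
  have wI: "w' \<in> interval a b" "u' \<in> interval a b" using c' interval_sym by auto
  have "d a w' = k" "d a u' + 1 = k"
    using wI c' assms(3) by (auto simp: interval_def d_sym)
  then show "w' = w" "u' \<noteq> u" using interval_unique[OF wI(1) c(3)] c V by auto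
qed

text \<open>At the centre \<open>c\<close> the only branches of height \<open>k\<close> are those
  towards \<open>a\<close> and \<open>b\<close>, since any other misses the path and is lower than
  \<open>t\<close>. One of the two is cut off by \<open>u\<close>, so the other is identified inside
  the code by its height.\<close>

lemma even_deep:
  assumes "off_path_low a b t" "t \<le> k" "cut a b k u c" "cut b a k u' c" "d a b = diam" "diam = 2 * k"
  shows "filter_mset (\<lambda>C. height C = k) (children (code u c)) = {#code c u'#}"
proof -
  have V: "a \<in> V" "b \<in> V" using assms(3) limb_V by (auto simp: cut_def)
  have e: "E u c" "E c u" "E c u'" "E u' c" using assms(3,4) adj_sym by (auto simp: cut_def)
  have ne: "u' \<noteq> u" using cut_even_centre[OF assms(3,4)] assms(5,6) by simp
  have cb: "cut a b (k - 1) c u'" using cut_flip[OF assms(4)] assms(5,6) by (simp add: d_sym)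
  have k: "k \<ge> 1" using cut_d[OF cb] cut_d[OF assms(3)] by simp
  have ca: "cut b a (k - 1) c u" using cut_flip[OF assms(3)] assms(5,6) by (simp add: d_sym)
  have Hu': "depth c u' = k" using cut_depth[OF cb assms(5)] k by simp
  have uniq: "v = u'" if v: "E c v" "v \<noteq> u" "depth c v = k" for v
  proof (rule ccontr)
    assume "v \<noteq> u'"
    have "limb c v \<inter> interval a b = {}"
    proof (rule ccontr)
      assume "limb c v \<inter> interval a b \<noteq> {}"
      then obtain q where q: "q \<in> limb c v" "q \<in> interval a b" by blast
      have "a \<notin> limb c v" "b \<notin> limb c v"
        using branch_unique[OF v(1) e(3)] branch_unique[OF v(1) e(2)] v(2) \<open>v \<noteq> u'\<close> cb ca
        unfolding cut_def by blast+
      then have "d q a = d q c + d c a" "d q b = d q c + d c b"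
        using branches_cross[OF v(1) q(1)] V by auto
      moreover have "d a b \<le> d a c + d c b" using d_triangle V e adj_V by blast
      moreover have "d q c > 0" using limb_dist[OF v(1) q(1)] by simp
      ultimately show False using q(2) by (simp add: interval_def d_sym)
    qed
    then show False using assms(1,2) v unfolding off_path_low_def by fastforce
  qed
  have "{v \<in> {v. E c v} - {u}. height (code c v) = k} = {u'}"
  proof (intro set_eqI iffI)
    fix v assume v: "v \<in> {v \<in> {v. E c v} - {u}. height (code c v) = k}"
    then have "E c v" "v \<noteq> u" by auto
    moreover have "depth c v = k" using v height_code[OF \<open>E c v\<close>] by simp
    ultimately show "v \<in> {u'}" using uniq[of v] by simp
  next
    fix v assume "v \<in> {u'}"
    then show "v \<in> {v \<in> {v. E c v} - {u}. height (code c v) = k}" using height_code[OF e(3)] e(3) ne Hu' by simp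
  qed
  then show ?thesis
    by (simp add: code_rec[OF e(1)] filter_mset_image_mset filter_mset_mset_set)
qed

lemma cut_sizes_odd: "E u w \<Longrightarrow> rsize (code u w) + rsize (code w u) = card V"
  using rsize_tcode[of u w "card V"] rsize_tcode[of w u "card V"] trunc_code[of u w] trunc_code[of w u] adj_sym[of u w]
    limb_card[of u w] by simp

lemma rsize_code: "E u w \<Longrightarrow> rsize (code u w) = card (limb u w)"
  using rsize_tcode trunc_code by simp

lemma cut_sizes_even:
  assumes "E u c" "E u' c" "u' \<noteq> u"
  shows "card V < rsize (code u c) + rsize (code u' c)"
proof -
  have "limb c u \<subseteq> limb u' c" using limb_subset[OF assms(2) adj_sym[OF assms(1)]] assms(3) by blast
  moreover have "c \<in> limb u' c" "c \<notin> limb c u" using assms limb_self limb_not by auto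
  ultimately have "limb c u \<subset> limb u' c" by blast
  then have "card (limb c u) < card (limb u' c)" by (simp add: psubset_card_mono)
  then show ?thesis using limb_card[OF assms(1)] rsize_code assms by simp
qed

text \<open>A common vertex would be reached from \<open>w'\<close> through \<open>w\<close> and
  from \<open>w\<close> through \<open>w'\<close>, although these two are distinct. If the path is
  even longer, \<open>u\<close> lies strictly between the two limbs.\<close>

lemma cut_disjoint:
  assumes "cut a b k u w" "cut b a k u' w'" "2 * k < d a b"
  shows "limb u w \<inter> limb u' w' = {}" "2 * k + 1 < d a b \<Longrightarrow> u \<notin> limb u w \<union> limb u' w'"
proof -
  have V: "a \<in> V" "b \<in> V" using assms(1) limb_V by (auto simp: cut_def)
  note c = cut_d[OF assms(1)] and c' = cut_d[OF assms(2)]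
  have e: "E u w" "E u' w'" using c c' by auto
  have cc: "cut b a (d a b - k - 1) w u" using cut_flip[OF assms(1)] .
  have wI: "w' \<in> interval a b" "u' \<in> interval a b" using c' interval_sym by auto
  have aw': "d a w' = d a b - k" "d a u' = d a b - k - 1"
    using wI c' assms(3) by (auto simp: interval_def d_sym)
  have on: "d p q = d a q - d a p" if pq: "p \<in> interval a b" "q \<in> interval a b" "d a p \<le> d a q" for p q
  proof -
    have qV: "q \<in> V" using pq interval_V by blast
    obtain s where s: "s \<in> interval a q" "d a s = d a p" using interval_ex[OF V(1) qV pq(3)] by blast
    have sV: "s \<in> V" using s interval_V by blast
    have "s \<in> interval a b"
      using d_triangle[OF sV qV V(2)] d_triangle[OF V(1) sV V(2)] s pq sV by (simp add: interval_def)
    then have "s = p" using interval_unique[of s a b p] pq s V by simp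
    then have "d a p + d p q = d a q" using s by (simp add: interval_def)
    then show ?thesis by simp
  qed
  have w1: "d w w' = d a b - 2 * k" "d w u' = d a b - 2 * k - 1"
    using on[of w w'] on[of w u'] c wI aw' assms(3) by auto
  have "w \<in> limb w' u'" using w1 assms(3) e adj_V' by (simp add: limb_def)
  have "d u w' = d a b - 2 * k - 1" using on[of u w'] c wI aw' assms(3) by auto
  then have "w' \<in> limb w u" using w1 assms(3) e adj_V' by (simp add: limb_def d_sym)
  show "limb u w \<inter> limb u' w' = {}"
  proof (rule ccontr)
    assume "limb u w \<inter> limb u' w' \<noteq> {}"
    then obtain q where q: "q \<in> limb u w" "q \<in> limb u' w'" by blast
    have "d w' q = d w' w + d w q" using cross[OF e(1) \<open>w' \<in> limb w u\<close> q(1)] .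
    moreover have "d w q = d w w' + d w' q" using cross[OF e(2) \<open>w \<in> limb w' u'\<close> q(2)] .
    ultimately show False using w1 assms(3) by (simp add: d_sym)
  qed
  assume big: "2 * k + 1 < d a b"
  have "d u u' = d a b - 2 * k - 2" using on[of u u'] c wI aw' big by auto
  then have "d u u' \<le> d u w'" using \<open>d u w' = _\<close> by linarith
  then have "u \<notin> limb u' w'" by (simp add: limb_def)
  then show "u \<notin> limb u w \<union> limb u' w'" using limb_not by blast
qed

end

section \<open>Visible codes of exact depth and reassembly from two halves\<close>

context deck_trees
begin

text \<open>Limbs deeper than \<open>K\<close> may be too large for a card, so full codes cannot be
  counted. Truncations at \<open>K - 1\<close> and at \<open>K\<close> can: the former count limbs
  of depth \<open>K\<close> and deeper ones together, the latter account for the deeper ones, and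
  the difference is what has depth exactly \<open>K\<close>.\<close>

lemma codes_at_subset:
  assumes small: "\<And>x u w. (x, u, w) \<in> A.anchored t \<Longrightarrow> K \<le> A.depth u w \<Longrightarrow> t + card (A.trunc K u w) < l"
    and K: "1 \<le> K" "t + K < l"
  shows "{(x, u, w) \<in> A.anchored t. A.depth u w = K \<and> A.code u w = Y} = {} \<longleftrightarrow>
    {(x, u, w) \<in> B.anchored t. B.depth u w = K \<and> B.code u w = Y} = {}" (is "?GA = {} \<longleftrightarrow> ?GB = {}")
proof (cases "height Y = K")
  case False
  have "?GA = {}" "?GB = {}" using A.height_code B.height_code A.anchored_D(1) B.anchored_D(1) False by blast+
  then show ?thesis by (simp only:)
next
  case hY: True
  have s1: "t + rsize (A.pcode (K - 1) p) < l" if "p \<in> A.anchored t" "K - 1 < height (A.pcode (K - 1) p)" for p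
  proof -
    obtain x u w where p: "p = (x, u, w)" by (cases p)
    note e = A.anchored_D(1)[OF that(1)[unfolded p]]
    have "K \<le> A.depth u w" using that(2) A.less_height_tcode_depth[OF e] K by (simp add: p)
    moreover have "card (A.trunc (K - 1) u w) \<le> card (A.trunc K u w)"
      by (intro card_mono) (auto simp: A.trunc_def)
    ultimately show ?thesis using small[OF that(1)[unfolded p]] A.rsize_tcode[OF e] by (simp add: p)
  qed
  have s2: "t + rsize (A.pcode K p) < l" if "p \<in> A.anchored t" "K < height (A.pcode K p)" for p
  proof -
    obtain x u w where p: "p = (x, u, w)" by (cases p)
    note e = A.anchored_D(1)[OF that(1)[unfolded p]]
    have "K \<le> A.depth u w" using that(2) A.less_height_tcode_depth[OF e] by (simp add: p)
    then show ?thesis using small[OF that(1)[unfolded p]] A.rsize_tcode[OF e] by (simp add: p)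
  qed
  have c1: "A.code_count t (K - 1) Y = B.code_count t (K - 1) Y"
    using limb_count[of t "K - 1" "K - 1" Y, OF s1] K hY by simp
  have c2: "A.code_count t K Y' = B.code_count t K Y'" if "K < height Y'" for Y'
    using limb_count[of t K K Y', OF s2] K that by simp
  define S where "S = {Y' \<in> A.pcode K ` A.anchored t \<union> B.pcode K ` B.anchored t. K < height Y' \<and> prune (K - 1) Y' = Y}"
  have finS: "finite S" by (simp add: S_def)
  have "(\<Sum>Y'\<in>S. A.code_count t K Y') = (\<Sum>Y'\<in>S. B.code_count t K Y')"
    using c2 by (intro sum.cong) (auto simp: S_def)
  moreover have "A.code_count t (K - 1) Y = card ?GA + (\<Sum>Y'\<in>S. A.code_count t K Y')"
    by (rule A.codes_at_count[OF K(1) hY finS]; unfold S_def; blast)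
  moreover have "B.code_count t (K - 1) Y = card ?GB + (\<Sum>Y'\<in>S. B.code_count t K Y')"
    by (rule B.codes_at_count[OF K(1) hY finS]; unfold S_def; blast)
  ultimately have "card ?GA = card ?GB" using c1 by simp
  moreover have "finite ?GA" by (rule finite_subset[OF _ A.finite_anchored[of t]]) auto
  moreover have "finite ?GB" by (rule finite_subset[OF _ B.finite_anchored[of t]]) auto
  ultimately show ?thesis by (simp only: card_0_eq[symmetric])
qed

lemma codes_at_eq:
  assumes small: "\<And>x u w. (x, u, w) \<in> A.anchored t \<Longrightarrow> K \<le> A.depth u w \<Longrightarrow> t + card (A.trunc K u w) < l"
    and K: "1 \<le> K" "t + K < l"
  shows "A.codes_at t K = B.codes_at t K"
proof -
  have "Y \<in> A.codes_at t K \<longleftrightarrow> Y \<in> B.codes_at t K" for Y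
  proof -
    have "{(x, u, w) \<in> A.anchored t. A.depth u w = K \<and> A.code u w = Y} = {} \<longleftrightarrow>
      {(x, u, w) \<in> B.anchored t. B.depth u w = K \<and> B.code u w = Y} = {}"
      by (rule codes_at_subset[OF _ K]) (rule small)
    then show ?thesis unfolding A.codes_at_iff B.codes_at_iff by (rule arg_cong[of _ _ Not])
  qed
  then show ?thesis by (rule set_eqI)
qed

text \<open>The two limbs at an edge determine all branches at either of its ends. If the codes are
  matched crosswise, the other end of the edge in the second tree is used.\<close>

lemma odd_assemble:
  assumes "E u w" "E' u' w'" "{A.code u w, A.code w u} = {B.code u' w', B.code w' u'}"
  shows "\<exists>g. bij_betw g V V' \<and> iemb E V E' g"
proof -
  note A.branches_split[OF assms(1)] B.branches_split[OF assms(2)] B.branches_split[OF B.adj_sym[OF assms(2)]]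
  moreover have "(A.code u w = B.code u' w' \<and> A.code w u = B.code w' u') \<or> (A.code u w = B.code w' u' \<and> A.code w u = B.code u' w')"
    using assms(3) by (auto simp: doubleton_eq_iff)
  ultimately have "A.branches w = B.branches w' \<or> A.branches w = B.branches u'" by auto
  then show ?thesis
    using branches_eq_iso A.adj_V' B.adj_V B.adj_V' assms by metis
qed

end

context tree_graph
begin

text \<open>Classification by the position of the ends of a diametral path. One end in the limb
  means that the edge is a middle cut. Both ends in the limb force \<open>diam = 2 * k\<close> with
  \<open>w\<close> as centre, hence two branches of height \<open>k\<close>. With no end in the
  limb, its deepest vertex would be too far from one of them.\<close>

lemma long_limb_cases:
  assumes V: "a \<in> V" "b \<in> V" and ab: "d a b = diam" and k: "diam = 2 * k \<or> diam = 2 * k + 1"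
    and e: "E u w" and HK: "depth u w = k + 1"
  shows "cut a b k u w \<or> cut b a k u w \<or>
    diam = 2 * k \<and> 2 \<le> size (filter_mset (\<lambda>C. height C = k) (children (code u w)))"
proof -
  have L: "limb w u = V - limb u w" using limb_compl[OF e] .
  have eV: "u \<in> V" "w \<in> V" using e adj_V adj_V' by auto
  consider "a \<in> limb u w" "b \<in> limb w u" | "b \<in> limb u w" "a \<in> limb w u"
    | "a \<in> limb u w" "b \<in> limb u w" | "a \<in> limb w u" "b \<in> limb w u" using V L by blast
  then show ?thesis
  proof cases
    case 1
    then have "cut a b (d a w) u w" using e by (simp add: cut_def)
    then show ?thesis using cut_depth[of a b "d a w" u w] ab HK by auto
  next
    case 2
    then have "cut b a (d b w) u w" using e by (simp add: cut_def)
    then show ?thesis using cut_depth[of b a "d b w" u w] ab HK by (auto simp: d_sym)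
  next
    case 3
    have "d w a \<le> k" "d w b \<le> k"
      using depth_ge[OF 3(1)] depth_ge[OF 3(2)] limb_dist'[OF e 3(1)] limb_dist'[OF e 3(2)] HK by auto
    moreover have "diam \<le> d w a + d w b" using d_triangle[OF V(1) eV(2) V(2)] ab by (simp add: d_sym)
    ultimately have wk: "d w a = k" "d w b = k" "diam = 2 * k" using k by auto
    have "k \<noteq> 0"
    proof
      assume "k = 0"
      then have "d u w \<le> 0" using d_le_diam[OF eV] wk by simp
      then show False using d_adj[OF e] by simp
    qed
    then have "a \<noteq> w" "b \<noteq> w" using wk by auto
    then obtain v v' where v: "E w v" "a \<in> limb w v" "E w v'" "b \<in> limb w v'"
      using ex_branch V eV by metis
    have "v \<noteq> v'"
    proof
      assume "v = v'"
      then have "d v a + 1 = k" "d v b + 1 = k" using limb_dist'[OF v(1,2)] limb_dist'[OF v(3,4)] wk by auto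
      moreover have "d a b \<le> d a v + d v b" using d_triangle V v adj_V' by blast
      ultimately show False using ab wk \<open>k \<noteq> 0\<close> by (simp add: d_sym)
    qed
    have vu: "v \<noteq> u" "v' \<noteq> u" using v 3 L by blast+
    have "depth w v = k" using depth_ge[OF v(2)] depth_child[OF e v(1) vu(1)] wk HK by simp
    moreover have "depth w v' = k" using depth_ge[OF v(4)] depth_child[OF e v(3) vu(2)] wk HK by simp
    ultimately have sub: "{v, v'} \<subseteq> {x. (E w x \<and> x \<noteq> u) \<and> height (code w x) = k}" using v vu height_code by auto
    have "finite {x. (E w x \<and> x \<noteq> u) \<and> height (code w x) = k}"
      by (rule finite_subset[OF _ finite_nbr[of w]]) auto
    from card_mono[OF this sub] have "2 \<le> card {x. (E w x \<and> x \<noteq> u) \<and> height (code w x) = k}"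
      using \<open>v \<noteq> v'\<close> by simp
    moreover have "size (filter_mset (\<lambda>C. height C = k) (children (code u w)))
        = card {x. (E w x \<and> x \<noteq> u) \<and> height (code w x) = k}"
      by (simp add: code_rec[OF e] filter_mset_image_mset filter_mset_mset_set)
    ultimately show ?thesis using wk(3) by simp
  next
    case 4
    obtain y where y: "y \<in> limb u w" "d u y = k + 1" using depth_ex[OF e] HK by metis
    have "d a y = d a u + d u y" "d b y = d b u + d u y"
      using cross'[OF e 4(1) y(1)] cross'[OF e 4(2) y(1)] by auto
    moreover have "d a y \<le> diam" "d b y \<le> diam" using d_le_diam V y limb_V by blast+
    moreover have "diam \<le> d a u + d u b" using d_triangle[OF V(1) eV(1) V(2)] ab by simp
    ultimately have False using k y(2) by (auto simp: d_sym)
    then show ?thesis ..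
  qed
qed

lemma cut_even_children:
  assumes "cut a b k u w" "cut b a k u' w" "d a b = diam" "diam = 2 * k"
  shows "code w u \<in># filter_mset (\<lambda>C. height C = k) (children (code u' w))"
proof -
  have e: "E u w" "E u' w" "E w u" using assms(1,2) adj_sym by (auto simp: cut_def)
  have ne: "u' \<noteq> u" using cut_even_centre[OF assms(1,2)] assms(3,4) by simp
  have c: "cut b a (k - 1) w u" using cut_flip[OF assms(1)] assms(3,4) by (simp add: d_sym)
  have "k \<ge> 1" using cut_d[OF c] cut_d[OF assms(2)] by simp
  then have "height (code w u) = k" using cut_depth[OF c] assms(3) height_code[OF e(3)] by (simp add: d_sym)
  then show ?thesis using e ne by (auto simp: code_rec[OF e(2)])
qed

lemma cut_sizes:
  assumes "cut a b k u w" "cut b a k u' w'" "d a b = diam" "diam = 2 * k \<or> diam = 2 * k + 1"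
  shows "card V \<le> rsize (code u w) + rsize (code u' w')" "diam = 2 * k \<Longrightarrow> card V < rsize (code u w) + rsize (code u' w')"
proof -
  have e: "E u w" "E u' w'" using assms cut_def by auto
  have 1: "card V < rsize (code u w) + rsize (code u' w')" if "diam = 2 * k"
    using cut_even_centre[OF assms(1,2)] cut_sizes_even[of u w u'] e assms(3) that by auto
  then show "diam = 2 * k \<Longrightarrow> card V < rsize (code u w) + rsize (code u' w')" by blast
  show "card V \<le> rsize (code u w) + rsize (code u' w')"
  proof (cases "diam = 2 * k")
    case False
    then have "cut b a k w u" using cut_odd[OF assms(1)] assms by simp
    then have "u' = w" "w' = u" using cut_unique[OF _ assms(2)] by auto
    then show ?thesis using cut_sizes_odd[OF e(1)] assms(4) False by simp
  qed (use 1 in simp)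
qed

lemma cut_sizes_long:
  assumes "cut a b k u w" "cut b a k u' w'" "2 * k < d a b"
  shows "rsize (code u w) + rsize (code u' w') \<le> card V" "2 * k + 1 < d a b \<Longrightarrow> rsize (code u w) + rsize (code u' w') < card V"
proof -
  have e: "E u w" "E u' w'" using assms cut_def by auto
  have "rsize (code u w) + rsize (code u' w') = card (limb u w \<union> limb u' w')"
    using rsize_code e cut_disjoint(1)[OF assms] by (simp add: card_Un_disjoint)
  moreover have "card (limb u w \<union> limb u' w') \<le> card V" using limb_V finite_V by (intro card_mono) auto
  moreover have "card (limb u w \<union> limb u' w') < card V" if "2 * k + 1 < d a b"
    using cut_disjoint(2)[OF assms that] limb_V finite_V e adj_V by (intro psubset_card_mono) auto
  ultimately show "rsize (code u w) + rsize (code u' w') \<le> card V"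
    "2 * k + 1 < d a b \<Longrightarrow> rsize (code u w) + rsize (code u' w') < card V" by auto
qed

end

context deck_trees
begin

text \<open>The two halves overlap in the centre, so the branches there are the children of one half
  together with the unique child of height \<open>k\<close> of the other. In the second tree this
  uniqueness is inherited from the equality of the code sets.\<close>

lemma even_assemble:
  assumes ab: "a \<in> V" "b \<in> V" "A.d a b = A.diam" "A.diam = 2 * k" "A.off_path_low a b t" "t \<le> k"
    and cA: "A.cut a b k u1 w1" "A.cut b a k u2 w2"
    and ab': "B.d a' b' = B.diam" "B.diam = 2 * k"
    and cB: "B.cut a' b' k u1' w1'" "B.cut b' a' k u2' w2'"
    and eq: "{A.code u1 w1, A.code u2 w2} = {B.code u1' w1', B.code u2' w2'}"
  shows "\<exists>g. bij_betw g V V' \<and> iemb E V E' g"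
proof -
  let ?F = "filter_mset (\<lambda>C. height C = k)"
  have w: "w2 = w1" using A.cut_even_centre[OF cA] ab by simp
  have w': "w2' = w1'" using B.cut_even_centre[OF cB] ab' by simp
  note cA2 = cA(2)[unfolded w] and cB2 = cB(2)[unfolded w']
  have e: "E u1 w1" "E u2 w1" "E' u1' w1'" "E' u2' w1'" using cA(1) cA2 cB(1) cB2 A.cut_def B.cut_def by auto
  have FA1: "?F (children (A.code u1 w1)) = {#A.code w1 u2#}"
    using A.even_deep[OF ab(5,6) cA(1) cA2 ab(3,4)] .
  have FA2: "?F (children (A.code u2 w1)) = {#A.code w1 u1#}"
    using A.even_deep[OF A.off_path_low_sym[OF ab(5)] ab(6) cA2 cA(1) _ ab(4)] ab(3) by (simp add: A.d_sym)
  have size1: "size (?F (children (B.code u w1'))) = 1" if "u = u1' \<or> u = u2'" for u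
  proof -
    have "B.code u w1' \<in> {A.code u1 w1, A.code u2 w1}" using eq that w w' by auto
    then show ?thesis using FA1 FA2 by auto
  qed
  have singleton: "M = {#x#}" if "size M = 1" "x \<in># M" for M :: "rtree multiset" and x
    using size_1_singleton_mset[OF that(1)] that(2) by auto
  have FB2: "?F (children (B.code u2' w1')) = {#B.code w1' u1'#}"
    using size1[of u2'] B.cut_even_children[OF cB(1) cB2 ab'] singleton[of "?F (children (B.code u2' w1'))"] by blast
  have FB1: "?F (children (B.code u1' w1')) = {#B.code w1' u2'#}"
    using size1[of u1'] B.cut_even_children[OF cB2 cB(1) _ ab'(2)] ab'(1)[unfolded B.d_sym[of a' b']]
      singleton[of "?F (children (B.code u1' w1'))"] by blast
  have bA: "A.branches w1 = ?F (children (A.code u2 w1)) + children (A.code u1 w1)"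
    "A.branches w1 = ?F (children (A.code u1 w1)) + children (A.code u2 w1)"
    by (simp only: A.branches_split[OF e(1)] FA2 add_mset_add_single[of _ "children _"] add.commute)
      (simp only: A.branches_split[OF e(2)] FA1 add_mset_add_single[of _ "children _"] add.commute)
  have bB: "B.branches w1' = ?F (children (B.code u2' w1')) + children (B.code u1' w1')"
    by (simp only: B.branches_split[OF e(3)] FB2 add_mset_add_single[of _ "children _"] add.commute)
  have "(A.code u1 w1 = B.code u1' w1' \<and> A.code u2 w1 = B.code u2' w1') \<or>
      (A.code u1 w1 = B.code u2' w1' \<and> A.code u2 w1 = B.code u1' w1')"
    using eq w w' by (auto simp: doubleton_eq_iff)
  then have "A.branches w1 = B.branches w1'" using bA bB by auto
  then show ?thesis using branches_eq_iso A.adj_V' B.adj_V' e by metis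
qed

text \<open>A tree whose mass is concentrated on a diametral path is rebuilt from its two limbs of depth
  \<open>k\<close> at the middle. They are visible because the limbs of depth exactly \<open>k\<close> behind a path of
  length \<open>t\<close> are known, and no limb off the diametral path is high enough to interfere.\<close>

lemma long_path:
  assumes n: "l + r = card V" and V: "a \<in> V" "b \<in> V" and ab: "A.d a b = A.diam"
    and off: "A.off_path_low a b t" and t: "1 \<le> t" "t + r + 2 \<le> A.diam div 2" and le: "A.diam \<le> B.diam"
    and alt: "A.diam = B.diam \<or> (\<exists>a' b'. a' \<in> V' \<and> b' \<in> V' \<and> B.d a' b' = B.diam \<and> B.off_path_low a' b' t)"
  shows "\<exists>g. bij_betw g V V' \<and> iemb E V E' g"
proof -
  define k where "k = A.diam div 2"
  have e: "A.diam = 2 * k \<or> A.diam = 2 * k + 1" unfolding k_def by linarith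
  have tk: "t + r + 2 \<le> k" using t k_def by simp
  have "card (A.interval a b) \<le> card V" using A.interval_V A.finite_V card_mono by blast
  then have nd: "A.diam + 1 \<le> card V" using A.interval_card[OF V] ab by simp
  \<comment> \<open>By \<open>cut_trunc_card\<close> the truncation has at most
    \<open>card V + k + 1 - A.diam\<close> vertices, and \<open>t + r + k + 1\<close> is less than
    \<open>2 * k\<close> by \<open>tk\<close>.\<close>
  have small: "t + card (A.trunc (k + 1) u w) < l" if p: "(x, u, w) \<in> A.anchored t" "k + 1 \<le> A.depth u w" for x u w
  proof -
    note pD = A.anchored_D[OF p(1)]
    have "t \<le> A.depth w u" using A.depth_ge[OF pD(2)] pD(3) by (simp add: A.d_sym)
    then have "A.cut a b (A.d a w) u w \<or> A.cut b a (A.d b w) u w"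
      using A.off_path_low_cut[OF off V pD(1)] p(2) tk by simp
    then have "card (A.trunc (k + 1) u w) + A.diam \<le> card V + (k + 1)"
    proof
      assume c: "A.cut a b (A.d a w) u w"
      show ?thesis using A.cut_trunc_card[OF c ab, of "k + 1"] A.cut_depth[OF c ab] p(2) e tk by auto
    next
      assume c: "A.cut b a (A.d b w) u w"
      have ba: "A.d b a = A.diam" using ab by (simp add: A.d_sym)
      show ?thesis using A.cut_trunc_card[OF c ba, of "k + 1"] A.cut_depth[OF c ba] p(2) e tk by auto
    qed
    then show ?thesis using n e tk by auto
  qed
  have ex: "A.codes_at t (k + 1) = B.codes_at t (k + 1)"
    by (rule codes_at_eq[OF small]) (use n nd tk e in auto)
  obtain a' b' where V': "a' \<in> V'" "b' \<in> V'" and ab': "B.d a' b' = B.diam"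
    and alt': "A.diam = B.diam \<or> B.off_path_low a' b' t"
  proof (cases "A.diam = B.diam")
    case True
    have "V' \<noteq> {}" using V(1) card_eq A.finite_V by auto
    then show ?thesis using B.diam_ex that True by metis
  qed (use alt that in blast)
  have ba: "A.d b a = A.diam" "B.d b' a' = B.diam" using ab ab' by (auto simp: A.d_sym B.d_sym)
  have "k < A.d a b" "k < A.d b a" "k < B.d a' b'" "k < B.d b' a'" using ab ba ab' e tk le by auto
  then obtain u1 w1 u2 w2 u1' w1' u2' w2' where c1: "A.cut a b k u1 w1" and c2: "A.cut b a k u2 w2"
    and c1': "B.cut a' b' k u1' w1'" and c2': "B.cut b' a' k u2' w2'"
    using A.cut_ex[OF V] A.cut_ex[OF V(2,1)] B.cut_ex[OF V'] B.cut_ex[OF V'(2,1)] by metis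
  have tA: "t + k \<le> A.diam" "t + k \<le> B.diam" using e tk le by auto
  have exA: "A.codes_at t (k + 1) = {A.code u1 w1, A.code u2 w2}"
  proof
    show "A.codes_at t (k + 1) \<subseteq> {A.code u1 w1, A.code u2 w2}"
    proof
      fix Y assume "Y \<in> A.codes_at t (k + 1)"
      then obtain u w where "Y = A.code u w" "A.cut a b k u w \<or> A.cut b a k u w"
        using A.off_path_low_codes_at[OF off V ab _ \<open>Y \<in> _\<close>] tk by auto
      then show "Y \<in> {A.code u1 w1, A.code u2 w2}" using A.cut_unique c1 c2 by blast
    qed
    show "{A.code u1 w1, A.code u2 w2} \<subseteq> A.codes_at t (k + 1)"
      using A.cut_codes_at[OF c1 ab t(1) tA(1)] A.cut_codes_at[OF c2 ba(1) t(1) tA(1)] by blast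
  qed
  have exB: "B.codes_at t (k + 1) = {B.code u1' w1', B.code u2' w2'}"
  proof
    show "{B.code u1' w1', B.code u2' w2'} \<subseteq> B.codes_at t (k + 1)"
      using B.cut_codes_at[OF c1' ab' t(1) tA(2)] B.cut_codes_at[OF c2' ba(2) t(1) tA(2)] by blast
    show "B.codes_at t (k + 1) \<subseteq> {B.code u1' w1', B.code u2' w2'}"
    proof
      fix Y assume Y: "Y \<in> B.codes_at t (k + 1)"
      have "\<exists>u w. Y = B.code u w \<and> (B.cut a' b' k u w \<or> B.cut b' a' k u w)"
        using alt'
      proof
        assume "B.off_path_low a' b' t"
        then show ?thesis using B.off_path_low_codes_at[OF _ V' ab' _ Y] tk by simp
      next
        assume eq: "A.diam = B.diam"
        obtain x u w where p: "(x, u, w) \<in> B.anchored t" "Y = B.code u w" "B.depth u w = k + 1"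
          using Y by (auto simp: B.codes_at_def)
        \<comment> \<open>The code \<open>Y\<close> also occurs in the first tree, where by
          \<open>even_deep\<close> it has a single child of height \<open>k\<close>. This excludes
          the third alternative of \<open>long_limb_cases\<close>.\<close>
        have "\<not> 2 \<le> size (filter_mset (\<lambda>C. height C = k) (children Y)) \<or> A.diam = 2 * k + 1"
        proof (cases "A.diam = 2 * k")
          case True
          have w: "w2 = w1" using A.cut_even_centre[OF c1 c2] ab True by simp
          have "Y = A.code u1 w1 \<or> Y = A.code u2 w1" using Y ex exA w by auto
          then show ?thesis
            using A.even_deep[OF off _ c1 c2[unfolded w] ab True]
              A.even_deep[OF A.off_path_low_sym[OF off] _ c2[unfolded w] c1 ba(1) True] tk by auto
        qed (use e in auto)
        then show ?thesis
          using B.long_limb_cases[OF V' ab' _ B.anchored_D(1)[OF p(1)] p(3)] e eq p(2) by auto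
      qed
      then show "Y \<in> {B.code u1' w1', B.code u2' w2'}" using B.cut_unique c1' c2' by blast
    qed
  qed
  have sets: "{A.code u1 w1, A.code u2 w2} = {B.code u1' w1', B.code u2' w2'}" using ex exA exB by simp
  then have sum: "rsize (A.code u1 w1) + rsize (A.code u2 w2) = rsize (B.code u1' w1') + rsize (B.code u2' w2')"
    by (auto simp: doubleton_eq_iff)
  \<comment> \<open>Sizes decide: in the first tree the two limbs have at least
    \<open>card V\<close> vertices together, and more if they overlap. A larger diameter of the
    second tree would make them disjoint there, and leave a vertex uncovered if the first diameter
    is odd.\<close>
  have diam: "A.diam = B.diam"
  proof (rule ccontr)
    assume "A.diam \<noteq> B.diam"
    then have lt: "A.diam < B.diam" using le by simp
    then have "2 * k < B.d a' b'" "A.diam = 2 * k + 1 \<Longrightarrow> 2 * k + 1 < B.d a' b'" using ab' e by auto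
    then show False
      using A.cut_sizes[OF c1 c2 ab e] B.cut_sizes_long[OF c1' c2'] sum card_eq e by auto
  qed
  show ?thesis
  proof (cases "A.diam = 2 * k")
    case True
    show ?thesis
      by (rule even_assemble[OF V ab True off _ c1 c2 ab' _ c1' c2' sets]) (use tk diam True in auto)
  next
    case False
    then have odd: "A.diam = 2 * k + 1" using e by simp
    have "u2 = w1" "w2 = u1" using A.cut_unique[OF A.cut_odd[OF c1] c2] ab odd by auto
    moreover have "u2' = w1'" "w2' = u1'" using B.cut_unique[OF B.cut_odd[OF c1'] c2'] ab' odd diam by auto
    ultimately show ?thesis
      using odd_assemble[of u1 w1 u1' w1'] sets c1 c1' by (simp add: A.cut_def B.cut_def)
  qed
qed

end

section \<open>Highest branches at a centre, and thin limbs\<close>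

context tree_graph
begin

text \<open>A limb of height \<open>J\<close> counted here is a branch at \<open>z\<close>, and the
  possible starting points are the vertices at distance \<open>J\<close> outside that branch. The
  equation is stated additively to avoid truncated subtraction.\<close>

lemma count_top:
  assumes z: "z \<in> V" and HJ: "\<And>v. E z v \<Longrightarrow> depth z v \<le> J" and J: "0 < J" and Y: "height Y = J"
  shows "code_count (Suc J) (card V) Y + count (branches z) Y * levels Y (J - 1)
    = count (branches z) Y * card {x \<in> V. d z x = J}"
proof -
  let ?N = "{v. E z v \<and> code z v = Y}" and ?X = "\<lambda>v. {x \<in> V - limb z v. d z x = J}"
  have "bij_betw (\<lambda>(v, x). (x, z, v)) (SIGMA v:?N. ?X v) {p \<in> anchored (Suc J). pcode (card V) p = Y}"
    unfolding bij_betw_def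
  proof
    show "inj_on (\<lambda>(v, x). (x, z, v)) (SIGMA v:?N. ?X v)" by (auto simp: inj_on_def)
    show "(\<lambda>(v, x). (x, z, v)) ` (SIGMA v:?N. ?X v) = {p \<in> anchored (Suc J). pcode (card V) p = Y}"
    proof (intro set_eqI iffI)
      fix p assume "p \<in> (\<lambda>(v, x). (x, z, v)) ` (SIGMA v:?N. ?X v)"
      then obtain v x where p: "p = (x, z, v)" "E z v" "code z v = Y" "x \<in> V - limb z v" "d z x = J" by auto
      then have x: "x \<in> limb v z" using limb_compl[OF p(2)] by blast
      have "d x v = Suc J" using limb_dist[OF adj_sym[OF p(2)] x] p(5) by (simp add: d_sym)
      then show "p \<in> {p \<in> anchored (Suc J). pcode (card V) p = Y}" using p x by (simp add: anchored_def)
    next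
      fix p assume pA: "p \<in> {p \<in> anchored (Suc J). pcode (card V) p = Y}"
      obtain x u w where p: "p = (x, u, w)" by (cases p)
      have pP: "(x, u, w) \<in> anchored (Suc J)" "code u w = Y" using pA p by auto
      note pD = anchored_D[OF pP(1)]
      have aw: "z \<in> limb w u" using anchored_away[OF z HJ pP(1)] .
      obtain v where v: "E z v" "w \<in> limb z v" "u = z \<and> w = v \<or> u \<in> limb z v"
        using away_branch[OF pD(1) aw z] by metis
      have "depth u w = J" using height_code[OF pD(1)] pP(2) Y by simp
      then have "d z u = 0" using depth_away[OF pD(1) aw v(1,2)] HJ[OF v(1)] by simp
      then have "u = z" using d_eq_0 z pD by blast
      then have "w = v" using v limb_not by blast
      moreover have "d z x = J" using pD \<open>u = z\<close> by (simp add: d_sym)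
      moreover have "x \<notin> limb z v" using pD(2) \<open>u = z\<close> \<open>w = v\<close> limb_compl[OF v(1)] by blast
      ultimately show "p \<in> (\<lambda>(v, x). (x, z, v)) ` (SIGMA v:?N. ?X v)"
        using p pP pD \<open>u = z\<close> by (auto simp: image_iff)
    qed
  qed
  then have "code_count (Suc J) (card V) Y = card (SIGMA v:?N. ?X v)"
    by (rule bij_betw_same_card[symmetric])
  also have "\<dots> = (\<Sum>v\<in>?N. card (?X v))"
    using finite_V by (intro card_SigmaI) (auto intro: finite_subset[OF _ finite_nbr[of z]])
  finally have *: "code_count (Suc J) (card V) Y = (\<Sum>v\<in>?N. card (?X v))" .
  have X: "card (?X v) + levels Y (J - 1) = card {x \<in> V. d z x = J}" if v: "v \<in> ?N" for v
  proof -
    have "levels Y (J - 1) = card {x \<in> limb z v. d z x = J}" using v levels_code[of z v J] J by auto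
    moreover have "{x \<in> V. d z x = J} = ?X v \<union> {x \<in> limb z v. d z x = J}" using limb_V by auto
    moreover have "card (?X v \<union> {x \<in> limb z v. d z x = J}) = card (?X v) + card {x \<in> limb z v. d z x = J}"
      using finite_V by (intro card_Un_disjoint) auto
    ultimately show ?thesis by simp
  qed
  have "(\<Sum>v\<in>?N. card (?X v)) + card ?N * levels Y (J - 1) = (\<Sum>v\<in>?N. card (?X v) + levels Y (J - 1))"
    by (simp add: sum.distrib)
  also have "\<dots> = (\<Sum>v\<in>?N. card {x \<in> V. d z x = J})" using X by (intro sum.cong) auto
  finally show ?thesis using * count_branches[of z Y] by simp
qed

lemma top_level:
  assumes "z \<in> V" "\<And>v. E z v \<Longrightarrow> depth z v \<le> J" "0 < J"
  shows "card {x \<in> V. d z x = J} = (\<Sum>C\<in>#filter_mset (\<lambda>C. height C = J) (branches z). levels C (J - 1))"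
proof -
  have "tall_part z J = {z}" using assms(2) by (auto simp: tall_part_def not_less[symmetric])
  then have "{x \<in> V - tall_part z J. d z x = J} = {x \<in> V. d z x = J}" using assms(3) by auto
  then show ?thesis using low_level[OF assms(1), of J] by simp
qed

text \<open>With two branches of height \<open>J\<close>, no branch contains all vertices at
  distance \<open>J\<close>. This keeps the weights in \<open>weighted_unique\<close>
  positive.\<close>

lemma top_strict:
  assumes "E z v1" "E z v2" "v1 \<noteq> v2" "depth z v1 = J" "depth z v2 = J" "E z v" "0 < J"
  shows "levels (code z v) (J - 1) < card {x \<in> V. d z x = J}"
proof -
  obtain v' where v': "E z v'" "v' \<noteq> v" "depth z v' = J" using assms by metis
  obtain x where x: "x \<in> limb z v'" "d z x = J" using depth_ex[OF v'(1)] v'(3) by metis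
  have "x \<notin> limb z v" using branch_unique[OF v'(1) assms(6) x(1)] v'(2) by blast
  then have "{x \<in> limb z v. d z x = J} \<subset> {x \<in> V. d z x = J}" using x limb_V by blast
  then have "card {x \<in> limb z v. d z x = J} < card {x \<in> V. d z x = J}"
    using finite_V by (intro psubset_card_mono) auto
  then show ?thesis using levels_code[OF assms(6,7)] by simp
qed

text \<open>A limb \<open>u w\<close> is thin if the opposite limb \<open>w u\<close>, preceded by a path through the limb, may be too large
  to fit into a card.\<close>

definition thin :: "nat \<Rightarrow> 'a \<Rightarrow> 'a \<Rightarrow> bool" where
  "thin r u w \<longleftrightarrow> E u w \<and> card (limb u w) \<le> depth u w + r \<and> diam + 1 \<le> 2 * depth u w"

lemma depth_le_diam: "E u w \<Longrightarrow> depth u w \<le> diam"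
  using depth_ex[of u w] d_le_diam adj_V limb_V by (metis subset_iff)

text \<open>The limb \<open>w u\<close> contains the path, so its depth is at least
  \<open>j\<close>; being too deep to be thin, it has more than \<open>j + r\<close> vertices. That
  leaves fewer than \<open>l - j\<close> for the limb \<open>u w\<close>.\<close>

lemma small_limbs:
  assumes "l + r = card V" "\<And>u w. thin r u w \<Longrightarrow> depth u w < j" "diam + 1 \<le> 2 * j" "(x, u, w) \<in> anchored j"
  shows "j + card (limb u w) < l"
proof -
  note pD = anchored_D[OF assms(4)]
  have "j \<le> depth w u" using depth_ge[OF pD(2)] pD(3) by (simp add: d_sym)
  then have "\<not> thin r w u" using assms(2) by fastforce
  then have "depth w u + r < card (limb w u)"
    using adj_sym[OF pD(1)] \<open>j \<le> depth w u\<close> assms(3) unfolding thin_def by linarith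
  then show ?thesis using limb_card[OF pD(1)] assms(1) \<open>j \<le> depth w u\<close> by simp
qed

lemma depth_other:
  assumes "E z y" "E z v" "v \<noteq> y" shows "depth z v + depth z y \<le> diam"
proof -
  obtain x where x: "x \<in> limb z y" "d z x = depth z y" using depth_ex[OF assms(1)] .
  obtain q where q: "q \<in> limb z v" "d z q = depth z v" using depth_ex[OF assms(2)] .
  have "q \<notin> limb z y" using branch_unique[OF assms(2,1) q(1)] assms(3) by blast
  then have "d x q = d x z + d z q" using branches_cross[OF assms(1) x(1)] q limb_V by blast
  moreover have "d x q \<le> diam" using d_le_diam x q limb_V by blast
  ultimately show ?thesis using x q by (simp add: d_sym)
qed

lemma other_side:
  assumes "E z y" "q \<in> limb y z" shows "d z q + depth z y \<le> diam"
proof (cases "q = z")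
  case True then show ?thesis using depth_le_diam[OF assms(1)] by simp
next
  case False
  have "q \<in> V" "z \<in> V" using assms limb_V adj_V by auto
  then obtain v where v: "E z v" "q \<in> limb z v" using ex_branch False by metis
  have "v \<noteq> y" using v assms limb_compl[OF assms(1)] by blast
  then show ?thesis using depth_other[OF assms(1) v(1)] depth_ge[OF v(2)] by simp
qed

lemma interval_sub: "y \<in> interval a b \<Longrightarrow> a \<in> V \<Longrightarrow> b \<in> V \<Longrightarrow> interval a y \<subseteq> interval a b"
proof
  fix q assume y: "y \<in> interval a b" "a \<in> V" "b \<in> V" and q: "q \<in> interval a y"
  have V: "q \<in> V" "y \<in> V" using q y interval_V by auto
  show "q \<in> interval a b"
    using d_triangle[OF V(1,2) y(3)] d_triangle[OF y(2) V(1) y(3)] q y V by (simp add: interval_def)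
qed

lemma off_path_low_card:
  assumes "a \<in> V" "b \<in> V" "card V \<le> d a b + t"
  shows "off_path_low a b t"
  unfolding off_path_low_def
proof (intro allI impI)
  fix u y assume *: "E u y \<and> limb u y \<inter> interval a b = {}"
  have "card (limb u y) + card (interval a b) = card (limb u y \<union> interval a b)"
    using * by (simp add: card_Un_disjoint)
  also have "\<dots> \<le> card V" using limb_V interval_V finite_V by (intro card_mono) auto
  finally show "depth u y < t" using depth_le_card[of u y] * interval_card[OF assms(1,2)] assms(3) by simp
qed

text \<open>If some \<open>q\<close> on the side of \<open>z\<close> is at distance
  \<open>diam - depth z y\<close>, a diametral path runs through the edge \<open>z y\<close>. A limb
  missing it stays on one side of the edge, where at most \<open>r\<close> vertices (in the thin
  limb) or \<open>2 * r\<close> (on the other side, by \<open>small\<close>) are off the path. If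
  there is no such \<open>q\<close>, every diametral path stays in the thin limb, and the other side
  is too shallow to allow deep limbs.\<close>

lemma thin_off_path_low:
  assumes thin: "thin r z y" and small: "card V + depth z y \<le> diam + card (limb z y) + 2 * r + 1"
  shows "\<exists>a b. a \<in> V \<and> b \<in> V \<and> d a b = diam \<and> off_path_low a b (2 * r + 1)"
proof -
  let ?J = "depth z y" and ?B = "limb z y" and ?N = "limb y z"
  have e: "E z y" "E y z" and b: "card ?B \<le> ?J + r" and J: "diam + 1 \<le> 2 * ?J"
    using thin adj_sym by (auto simp: thin_def)
  have V: "z \<in> V" "y \<in> V" using e adj_V by auto
  have BN: "?N = V - ?B" using limb_compl[OF e(1)] .
  have JD: "?J \<le> diam" using depth_le_diam[OF e(1)] .
  show ?thesis
  proof (cases "\<exists>q\<in>?N. d z q = diam - ?J")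
    case True
    then obtain q where q: "q \<in> ?N" "d z q = diam - ?J" by blast
    obtain x where x: "x \<in> ?B" "d z x = ?J" using depth_ex[OF e(1)] .
    have xq: "x \<in> V" "q \<in> V" using x q limb_V by auto
    have "d q x = d q z + d z x" using cross'[OF e(1) q(1) x(1)] .
    then have ab: "d x q = diam" using x q JD by (simp add: d_sym)
    have "d x z = d x y + 1" using limb_dist[OF e(1) x(1)] .
    moreover have "d q y = d q z + 1" using limb_dist[OF e(2) q(1)] .
    ultimately have I: "z \<in> interval q x" "y \<in> interval x q"
      using ab x q JD V by (auto simp: interval_def d_sym)
    have cy: "card (interval x y) = ?J" using interval_card[OF xq(1) V(2)] \<open>d x z = d x y + 1\<close> x(2) by (simp add: d_sym)
    have cz: "card (interval q z) = diam - ?J + 1" using interval_card[OF xq(2) V(1)] q(2) by (simp add: d_sym)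
    have subB: "interval x y \<subseteq> ?B" using limb_convex[OF e(1) x(1) limb_self[OF e(1)]] .
    have subN: "interval q z \<subseteq> ?N" using limb_convex[OF e(2) q(1) limb_self[OF e(2)]] .
    have "off_path_low x q (2 * r + 1)"
      unfolding off_path_low_def
    proof (intro allI impI)
      fix u v assume K: "E u v \<and> limb u v \<inter> interval x q = {}"
      then have Kxy: "limb u v \<inter> interval x y = {}" "limb u v \<inter> interval q z = {}" "z \<notin> limb u v"
        using interval_sub[OF I(2) xq] interval_sub[OF I(1) xq(2,1)] interval_sym[of x q] I by auto
      have "limb u v \<subseteq> ?B \<or> limb u v \<subseteq> ?N"
      proof (rule ccontr)
        assume "\<not> ?thesis"
        then obtain p1 p2 where p: "p1 \<in> limb u v" "p1 \<in> ?N" "p2 \<in> limb u v" "p2 \<in> ?B"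
          using BN limb_V by blast
        then have "z \<in> interval p1 p2" using cross'[OF e(1) p(2,4)] V by (simp add: interval_def)
        then show False using limb_convex[of u v p1 p2] K p Kxy by blast
      qed
      then have "card (limb u v) \<le> 2 * r"
      proof
        assume "limb u v \<subseteq> ?B"
        then have "card (limb u v \<union> interval x y) \<le> card ?B" using subB by (intro card_mono) auto
        then show ?thesis using Kxy(1) cy b by (simp add: card_Un_disjoint)
      next
        assume "limb u v \<subseteq> ?N"
        then have "card (limb u v \<union> interval q z) \<le> card ?N" using subN by (intro card_mono) auto
        then show ?thesis using Kxy(2) cz limb_card[OF e(1)] small JD by (simp add: card_Un_disjoint)
      qed
      then show "depth u v < 2 * r + 1" using depth_le_card[of u v] K by simp
    qed
    then show ?thesis using xq ab by blast
  next
    case False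
    have dN: "d z q + ?J < diam" if "q \<in> ?N" for q
      using other_side[OF e(1) that] False that JD by fastforce
    have dB: "d z q \<le> ?J" if "q \<in> ?B" for q using depth_ge[OF that] .
    obtain a b where ab: "a \<in> V" "b \<in> V" "d a b = diam" using diam_ex V by blast
    \<comment> \<open>By \<open>dN\<close> a vertex of \<open>?N\<close> is nearer to
      \<open>z\<close> than \<open>diam - ?J\<close>, while no vertex is farther than
      \<open>?J\<close> from \<open>z\<close>; so it is not an end of a diametral path.\<close>
    have inB: "p \<in> ?B" if p: "p \<in> V" "q \<in> V" "d p q = diam" for p q
    proof (rule ccontr)
      assume "p \<notin> ?B"
      then have pN: "p \<in> ?N" using BN p by blast
      have "diam \<le> d z p + d z q" using d_triangle[OF p(1) V(1) p(2)] p(3) by (simp add: d_sym)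
      moreover have "d z q \<le> ?J" using dB dN[of q] BN p J by fastforce
      ultimately show False using dN[OF pN] by simp
    qed
    have aB: "a \<in> ?B" "b \<in> ?B" using inB[OF ab] inB[OF ab(2,1)] ab(3) by (auto simp: d_sym)
    have IB: "interval a b \<subseteq> ?B" using limb_convex[OF e(1) aB] .
    have cB: "diam + 1 \<le> card ?B" using card_mono[of ?B "interval a b"] IB interval_card[OF ab(1,2)] ab(3) by simp
    have "off_path_low a b (2 * r + 1)"
      unfolding off_path_low_def
    proof (intro allI impI)
      fix u v assume K: "E u v \<and> limb u v \<inter> interval a b = {}"
      have ev: "E u v" "E v u" using K adj_sym by auto
      have uv: "u \<in> V" "v \<in> V" using ev adj_V by auto
      have aK: "a \<in> limb v u" using K interval_ends[OF ab(1,2)] limb_compl[OF ev(1)] ab(1) by blast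
      obtain q where q: "q \<in> limb u v" "d u q = depth u v" using depth_ex[OF ev(1)] .
      have qV: "q \<in> V" using q limb_V by blast
      have duq: "d u q = d v q + 1" using limb_dist'[OF ev(1) q(1)] .
      have vq: "interval v q \<subseteq> limb u v" using limb_convex[OF ev(1) limb_self[OF ev(1)] q(1)] .
      \<comment> \<open>Since \<open>card ?B \<le> ?J + r\<close>, fewer than \<open>r\<close>
        vertices of the thin limb are off the path.\<close>
      have room: "card S + diam + 1 \<le> card ?B" if "S \<subseteq> ?B" "S \<subseteq> limb u v" for S
      proof -
        have "finite S" using that(1) finite_subset finite_limb by blast
        then have "card S + card (interval a b) = card (S \<union> interval a b)" using that K by (subst card_Un_disjoint) auto
        also have "\<dots> \<le> card ?B" using that IB by (intro card_mono) auto
        finally show ?thesis using interval_card[OF ab(1,2)] ab(3) by simp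
      qed
      show "depth u v < 2 * r + 1"
      proof (cases "v \<in> ?B")
        case vB: True
        show ?thesis
        proof (cases "q \<in> ?B")
          case True
          have "interval v q \<subseteq> ?B" using limb_convex[OF e(1) vB True] .
          then have "d v q + 1 + diam + 1 \<le> card ?B" using room[of "interval v q"] vq interval_card[OF uv(2) qV] by simp
          then show ?thesis using q(2) duq b JD by simp
        next
          case False
          then have qN: "q \<in> ?N" using BN qV by blast
          have vzq: "d q v = d q z + d z v" using cross'[OF e(1) qN vB] .
          have zv: "d z v = d y v + 1" using limb_dist'[OF e(1) vB] .
          have "y \<in> interval v q" using vzq zv limb_dist[OF e(2) qN] V by (simp add: interval_def d_sym)
          then have "interval v y \<subseteq> limb u v" using interval_sub[OF _ uv(2) qV] vq by blast
          moreover have "interval v y \<subseteq> ?B" using limb_convex[OF e(1) vB limb_self[OF e(1)]] .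
          ultimately have "d v y + 1 + diam + 1 \<le> card ?B" using room[of "interval v y"] interval_card[OF uv(2) V(2)] by simp
          then show ?thesis using q(2) duq vzq zv dN[OF qN] b JD by (simp add: d_sym)
        qed
      next
        case False
        then have vN: "v \<in> ?N" using BN uv by blast
        have azv: "d a v = d a z + d z v" using cross'[OF e(1) vN aB(1)] by (simp add: d_sym)
        have dau: "d a q = d a u + d u q" "d a q = d a v + d v q"
          using cross'[OF ev(1) aK q(1)] cross[OF ev(1) aK q(1)] by auto
        have dav: "d a v = d a u + 1" using limb_dist[OF ev(2) aK] .
        have qN: "q \<in> ?N"
        proof (rule ccontr)
          assume "q \<notin> ?N"
          then have qB: "q \<in> ?B" using BN qV by blast
          have "d q v = d q z + d z v" using cross'[OF e(1) vN qB] by (simp add: d_sym)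
          moreover have "d a q \<le> d a y + d y q" using d_triangle ab V qV by blast
          moreover have "d a z = d a y + 1" "d q z = d q y + 1"
            using limb_dist[OF e(1) aB(1)] limb_dist[OF e(1) qB] by auto
          ultimately show False using dau azv by (simp add: d_sym)
        qed
        have "d a q = d a z + d z q" using cross'[OF e(1) qN aB(1)] by (simp add: d_sym)
        then have "d z q + 1 \<ge> d u q" using dau(1) azv dav by simp
        then show ?thesis using dN[OF qN] q(2) cB b by simp
      qed
    qed
    then show ?thesis using ab by blast
  qed
qed

end

text \<open>The totals \<open>p\<close> and \<open>q\<close> themselves depend on the unknown
  multisets. If \<open>p \<le> q\<close>, the weights on the side of \<open>M\<close> are the
  smaller ones, so \<open>N\<close> is contained in \<open>M\<close>; summing \<open>f\<close> gives
  \<open>q \<le> p\<close>. Once the totals agree, the positive weights cancel.\<close>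

lemma weighted_unique:
  fixes f :: "'c \<Rightarrow> nat"
  assumes M: "p = (\<Sum>x\<in>#M. f x)" "\<And>x. x \<in># M \<Longrightarrow> f x < p" and N: "q = (\<Sum>x\<in>#N. f x)" "\<And>x. x \<in># N \<Longrightarrow> f x < q"
    and eq: "\<And>x. count M x * (p - f x) = count N x * (q - f x)"
  shows "M = N"
proof -
  have le: "q \<le> p" if "p \<le> q" and M: "\<And>x. x \<in># M \<Longrightarrow> f x < p" and N: "q = (\<Sum>x\<in>#N. f x)" "\<And>x. x \<in># N \<Longrightarrow> f x < q"
    and p: "p = (\<Sum>x\<in>#M. f x)" and eq: "\<And>x. count M x * (p - f x) = count N x * (q - f x)" for p q M N
  proof -
    have "count N x \<le> count M x" for x
    proof (cases "x \<in># N")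
      case True
      then have "count N x * (q - f x) > 0" using N(2) by simp
      then have *: "count M x * (p - f x) > 0" using eq by simp
      have "count N x * (p - f x) \<le> count N x * (q - f x)" using that(1) by (intro mult_le_mono) auto
      then have "count N x * (p - f x) \<le> count M x * (p - f x)" using eq by simp
      then show ?thesis using * by simp
    qed (simp add: not_in_iff)
    then show ?thesis using sum_mset_mono_sub[of N M f] N(1) p by (simp add: subseteq_mset_def)
  qed
  have pq: "p = q"
    using le[of p q M N] le[of q p N M] M N eq by (metis nat_le_linear antisym)
  have "count M x = count N x" for x
  proof (cases "x \<in># M \<or> x \<in># N")
    case True
    then have "p - f x > 0" using M(2) N(2) pq by auto
    then show ?thesis using eq[of x] pq by simp
  qed (simp add: not_in_iff)
  then show ?thesis by (rule multiset_eqI)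
qed

context tree_graph
begin

lemma codes_at_count_iff:
  "Y \<in> codes_at t K \<longleftrightarrow> height Y = K \<and> code_count t (card V) Y \<noteq> 0"
proof
  assume "Y \<in> codes_at t K"
  then obtain x u w where p: "(x, u, w) \<in> anchored t" "depth u w = K" "Y = code u w"
    by (auto simp: codes_at_def)
  then have "(x, u, w) \<in> {p \<in> anchored t. pcode (card V) p = Y}" by simp
  then have "0 < code_count t (card V) Y" unfolding card_gt_0_iff by (intro conjI) (blast, simp)
  moreover have "height Y = K" using p height_code[OF anchored_D(1)[OF p(1)]] by simp
  ultimately show "height Y = K \<and> code_count t (card V) Y \<noteq> 0" by blast
next
  assume h: "height Y = K \<and> code_count t (card V) Y \<noteq> 0"
  then have "0 < code_count t (card V) Y" by (intro neq0_conv[THEN iffD1]) (rule conjunct2)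
  then obtain p where p: "p \<in> {p \<in> anchored t. pcode (card V) p = Y}" unfolding card_gt_0_iff by blast
  obtain x u w where "p = (x, u, w)" by (cases p)
  then have q: "(x, u, w) \<in> anchored t" "code u w = Y" using p by auto
  have "depth u w = K" using height_code[OF anchored_D(1)[OF q(1)]] q(2) conjunct1[OF h] by simp
  then show "Y \<in> codes_at t K" unfolding codes_at_def using q by blast
qed

lemma branches_top:
  assumes "E z y" "depth z y = J" "\<And>v. E z v \<Longrightarrow> v \<noteq> y \<Longrightarrow> depth z v < J"
  shows "filter_mset (\<lambda>C. height C = J) (branches z) = {#code z y#}"
proof -
  have "v = y" if "E z v" "depth z v = J" for v using assms(3)[OF that(1)] that(2) by fastforce
  then have "{v. E z v \<and> depth z v = J} = {y}" using assms(1,2) by blast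
  then show ?thesis using filter_branches_depth[of "\<lambda>i. i = J" z] by simp
qed

end

section \<open>Centres and thin limbs compared between the two trees\<close>

context deck_trees
begin

lemma diam_ge:
  assumes "k \<le> A.diam" "k < l" "V \<noteq> {}"
  shows "k \<le> B.diam"
proof -
  obtain a b where ab: "a \<in> V" "b \<in> V" "A.d a b = A.diam" using A.diam_ex assms(3) by blast
  obtain q where q: "q \<in> A.interval a b" "A.d a q = k" using A.interval_ex[OF ab(1,2)] ab(3) assms(1) by metis
  have qV: "q \<in> V" using q A.interval_V by blast
  obtain f where f: "iemb E (A.interval a q) E' f" "f ` A.interval a q \<subseteq> V'"
    using embeds[OF A.interval_V] A.interval_card[OF ab(1) qV] q(2) assms(2) by (metis Suc_eq_plus1 Suc_leI)
  have mem: "a \<in> A.interval a q" "q \<in> A.interval a q" using A.interval_ends ab qV by auto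
  have "B.d (f a) (f q) = k" using iemb_dist[OF A.closed_interval'[OF ab(1) qV] f mem] q(2) by simp
  then show ?thesis using B.d_le_diam f(2) mem by blast
qed

text \<open>Without such a thin limb, all limbs of the second tree behind paths of length
  \<open>?J\<close> would be smaller than a card together with the path. By
  \<open>limb_size_B\<close> with the trees exchanged, the first tree would share this property; but
  \<open>limb y z\<close> behind a longest path of the thin limb violates it.\<close>

lemma thin_transfer:
  assumes n: "l + r = card V" and diam: "A.diam = B.diam" "A.diam < l" and thin: "A.thin r z y"
  obtains z' y' where "B.thin r z' y'" "A.depth z y \<le> B.depth z' y'"
proof -
  interpret BA: deck_trees V' E' V E l by (rule deck_trees_swap)
  let ?J = "A.depth z y"
  have e: "E z y" and b: "card (A.limb z y) \<le> ?J + r" and J: "A.diam + 1 \<le> 2 * ?J"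
    using thin by (auto simp: A.thin_def)
  have "\<exists>z' y'. B.thin r z' y' \<and> ?J \<le> B.depth z' y'"
  proof (rule ccontr)
    assume "\<not> ?thesis"
    then have no: "B.depth u w < ?J" if "B.thin r u w" for u w using that not_le by blast
    have small: "?J + rsize (B.pcode (card V) p) < l" if p: "p \<in> B.anchored ?J" for p
    proof -
      obtain x u w where pp: "p = (x, u, w)" by (cases p)
      have "?J + card (B.limb u w) < l"
        using B.small_limbs[of l r ?J x u w] n card_eq no J diam(1) p pp by simp
      then show ?thesis using B.rsize_code[OF B.anchored_D(1)] p pp card_eq by fastforce
    qed
    obtain x where x: "x \<in> A.limb z y" "A.d z x = ?J" using A.depth_ex[OF e] .
    have p: "(x, y, z) \<in> A.anchored ?J" using e x A.adj_sym by (simp add: A.anchored_def A.d_sym)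
    have "?J + 0 < l" using A.depth_le_diam[OF e] diam(2) by simp
    then have "?J + rsize (A.pcode (card V) (x, y, z)) < l"
      using BA.limb_size_B[of ?J 0 "card V" "(x, y, z)", OF small] p height_pos by simp
    moreover have "rsize (A.code y z) = card (A.limb y z)" using A.rsize_code[OF A.adj_sym[OF e]] .
    ultimately show False using A.limb_card[OF e] b n by simp
  qed
  then show ?thesis using that by blast
qed

text \<open>A path of length \<open>Suc J\<close> is longer than any thin limb is deep, so
  \<open>small_limbs\<close> applies to all limbs behind it at once, and \<open>limb_count\<close>
  may be used with height bound 0.\<close>

lemma all_counts:
  assumes n: "l + r = card V" and no: "\<And>u w. A.thin r u w \<Longrightarrow> A.depth u w \<le> J"
    and J: "A.diam + 1 \<le> 2 * Suc J" "Suc J < l"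
  shows "A.code_count (Suc J) (card V) Y = B.code_count (Suc J) (card V') Y"
proof -
  have small: "Suc J + rsize (A.pcode (card V) p) < l" if p: "p \<in> A.anchored (Suc J)" for p
  proof -
    obtain x u w where pp: "p = (x, u, w)" by (cases p)
    have "Suc J + card (A.limb u w) < l"
      using A.small_limbs[of l r "Suc J" x u w] n no J(1) p pp by (simp add: less_Suc_eq_le)
    then show ?thesis using A.rsize_code[OF A.anchored_D(1)] p pp by fastforce
  qed
  show ?thesis using limb_count[of "Suc J" 0 "card V" Y, OF small] J(2) height_pos card_eq by simp
qed

text \<open>All distances from the centre are at most \<open>k\<close>, so \<open>core\<close>
  applies with \<open>J = k\<close>. Its top level is unknown beforehand: it is recovered from
  \<open>count_top\<close> by \<open>weighted_unique\<close>, using that a diametral path provides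
  two branches of height \<open>k\<close>.\<close>

lemma even_centre:
  assumes V: "card V > 1" and diam: "A.diam = 2 * k" "B.diam = 2 * k"
    and cnt: "\<And>Y. A.code_count (Suc k) (card V) Y = B.code_count (Suc k) (card V') Y"
  shows "\<exists>g. bij_betw g V V' \<and> iemb E V E' g"
proof -
  have ne: "V \<noteq> {}" "V' \<noteq> {}" using V card_eq by auto
  have k: "0 < k"
  proof (rule ccontr)
    assume "\<not> 0 < k"
    then have "x = y" if "x \<in> V" "y \<in> V" for x y
      using A.d_le_diam[OF that] A.d_eq_0[OF that] diam by simp
    then have "card V \<le> 1" using card_le_Suc0_iff_eq[OF A.finite_V] by auto
    then show False using V by simp
  qed
  obtain a b where ab: "a \<in> V" "b \<in> V" "A.d a b = 2 * k" using A.diam_ex ne diam by metis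
  obtain a' b' where ab': "a' \<in> V'" "b' \<in> V'" "B.d a' b' = 2 * k" using B.diam_ex ne diam by metis
  obtain z where z: "z \<in> A.interval a b" "A.d a z = k" using A.interval_ex[OF ab(1,2), of k] ab(3) by auto
  obtain z' where z': "z' \<in> B.interval a' b'" "B.d a' z' = k" using B.interval_ex[OF ab'(1,2), of k] ab'(3) by auto
  have zV: "z \<in> V" "z' \<in> V'" using z z' A.interval_V B.interval_V by blast+
  have zb: "A.d z a = k" "A.d z b = k" "B.d z' a' = k" "B.d z' b' = k"
    using z z' ab(3) ab'(3) by (auto simp: A.interval_def B.interval_def A.d_sym B.d_sym)
  have eccA: "A.d z x \<le> k" if "x \<in> V" for x
    using A.ecc_diam[OF ab(1,2) _ zV(1) that] ab(3) diam zb by simp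
  have eccB: "B.d z' x \<le> k" if "x \<in> V'" for x
    using B.ecc_diam[OF ab'(1,2) _ zV(2) that] ab'(3) diam zb by simp
  have HA: "A.depth z v \<le> k" if "E z v" for v
    using A.depth_ex[OF that] eccA A.limb_V by (metis subset_iff)
  have HB: "B.depth z' v \<le> k" if "E' z' v" for v
    using B.depth_ex[OF that] eccB B.limb_V by (metis subset_iff)
  have "a \<noteq> z" "b \<noteq> z" "a' \<noteq> z'" "b' \<noteq> z'" using zb k by auto
  then obtain v1 v2 v1' v2' where v: "E z v1" "a \<in> A.limb z v1" "E z v2" "b \<in> A.limb z v2"
    "E' z' v1'" "a' \<in> B.limb z' v1'" "E' z' v2'" "b' \<in> B.limb z' v2'"
    using A.ex_branch B.ex_branch ab ab' zV by metis
  have depth: "A.depth z v1 = k" "A.depth z v2 = k" "B.depth z' v1' = k" "B.depth z' v2' = k"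
    using A.depth_ge[OF v(2)] A.depth_ge[OF v(4)] B.depth_ge[OF v(6)] B.depth_ge[OF v(8)] HA HB v zb
    by (auto intro: antisym)
  have "v1 \<noteq> v2"
  proof
    assume "v1 = v2"
    then have "A.d v1 a + 1 = k" "A.d v1 b + 1 = k" using A.limb_dist'[OF v(1,2)] A.limb_dist'[OF v(3,4)] zb by auto
    moreover have "A.d a b \<le> A.d a v1 + A.d v1 b" using A.d_triangle ab v A.adj_V' by blast
    ultimately show False using ab(3) k by (simp add: A.d_sym)
  qed
  have "v1' \<noteq> v2'"
  proof
    assume "v1' = v2'"
    then have "B.d v1' a' + 1 = k" "B.d v1' b' + 1 = k"
      using B.limb_dist'[OF v(5,6)] B.limb_dist'[OF v(7,8)] zb by auto
    moreover have "B.d a' b' \<le> B.d a' v1' + B.d v1' b'" using B.d_triangle ab' v B.adj_V' by blast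
    ultimately show False using ab'(3) k by (simp add: B.d_sym)
  qed
  let ?F = "filter_mset (\<lambda>C. height C = k)" and ?f = "\<lambda>C. levels C (k - 1)"
  let ?p = "card {x \<in> V. A.d z x = k}" and ?q = "card {x \<in> V'. B.d z' x = k}"
  have "?F (A.branches z) = ?F (B.branches z')"
  proof (rule weighted_unique)
    show "?p = (\<Sum>C\<in>#?F (A.branches z). ?f C)" using A.top_level[OF zV(1) HA k] .
    show "?q = (\<Sum>C\<in>#?F (B.branches z'). ?f C)" using B.top_level[OF zV(2) HB k] .
    show "?f C < ?p" if "C \<in># ?F (A.branches z)" for C
      using that A.top_strict[OF v(1,3) \<open>v1 \<noteq> v2\<close> depth(1,2) _ k] by (auto simp: A.branches_def)
    show "?f C < ?q" if "C \<in># ?F (B.branches z')" for C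
      using that B.top_strict[OF v(5,7) \<open>v1' \<noteq> v2'\<close> depth(3,4) _ k] by (auto simp: B.branches_def)
    show "count (?F (A.branches z)) Y * (?p - ?f Y) = count (?F (B.branches z')) Y * (?q - ?f Y)" for Y
    proof (cases "height Y = k")
      case True
      show ?thesis
        using A.count_top[OF zV(1) HA k True] B.count_top[OF zV(2) HB k True] cnt[of Y] True
        by (simp add: diff_mult_distrib2)
    qed simp
  qed
  then show ?thesis using core[OF zV HA HB cnt v(1) depth(1)] by simp
qed

text \<open>For odd diameter the only limbs of depth \<open>k + 1\<close> are the two halves at the
  middle edge. It is enough to know which codes occur.\<close>

lemma odd_centre:
  assumes diam: "A.diam = 2 * k + 1" "B.diam = 2 * k + 1" and ne: "V \<noteq> {}"
    and cnt: "\<And>Y. A.code_count (Suc k) (card V) Y = B.code_count (Suc k) (card V') Y"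
  shows "\<exists>g. bij_betw g V V' \<and> iemb E V E' g"
proof -
  have ne': "V' \<noteq> {}" using ne card_eq A.finite_V by auto
  obtain a b where ab: "a \<in> V" "b \<in> V" "A.d a b = A.diam" using A.diam_ex ne by metis
  obtain a' b' where ab': "a' \<in> V'" "b' \<in> V'" "B.d a' b' = B.diam" using B.diam_ex ne' by metis
  obtain u w where c: "A.cut a b k u w" using A.cut_ex[OF ab(1,2), of k] ab(3) diam by auto
  obtain u' w' where c': "B.cut a' b' k u' w'" using B.cut_ex[OF ab'(1,2), of k] ab'(3) diam by auto
  have f: "A.cut b a k w u" "B.cut b' a' k w' u'" using A.cut_odd[OF c] B.cut_odd[OF c'] ab ab' diam by auto
  have ba: "A.d b a = A.diam" "B.d b' a' = B.diam" using ab ab' by (auto simp: A.d_sym B.d_sym)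
  have cntK: "Y \<in> A.codes_at (Suc k) (k + 1) \<longleftrightarrow> Y \<in> B.codes_at (Suc k) (k + 1)" for Y
    using A.codes_at_count_iff[of Y "Suc k" "k + 1"] B.codes_at_count_iff[of Y "Suc k" "k + 1"] cnt[of Y] by simp
  have exA: "A.codes_at (Suc k) (k + 1) = {A.code u w, A.code w u}"
  proof
    show "{A.code u w, A.code w u} \<subseteq> A.codes_at (Suc k) (k + 1)"
      using A.cut_codes_at[OF c ab(3), of "Suc k"] A.cut_codes_at[OF f(1) ba(1), of "Suc k"] diam by simp
    show "A.codes_at (Suc k) (k + 1) \<subseteq> {A.code u w, A.code w u}"
    proof
      fix Y assume "Y \<in> A.codes_at (Suc k) (k + 1)"
      then obtain x p q where p: "(x, p, q) \<in> A.anchored (Suc k)" "A.depth p q = k + 1" "Y = A.code p q"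
        by (auto simp: A.codes_at_def)
      then have "A.cut a b k p q \<or> A.cut b a k p q"
        using A.long_limb_cases[OF ab _ A.anchored_D(1)[OF p(1)] p(2)] diam by auto
      then show "Y \<in> {A.code u w, A.code w u}" using A.cut_unique c f(1) p(3) by blast
    qed
  qed
  have exB: "B.codes_at (Suc k) (k + 1) = {B.code u' w', B.code w' u'}"
  proof
    show "{B.code u' w', B.code w' u'} \<subseteq> B.codes_at (Suc k) (k + 1)"
      using B.cut_codes_at[OF c' ab'(3), of "Suc k"] B.cut_codes_at[OF f(2) ba(2), of "Suc k"] diam by simp
    show "B.codes_at (Suc k) (k + 1) \<subseteq> {B.code u' w', B.code w' u'}"
    proof
      fix Y assume "Y \<in> B.codes_at (Suc k) (k + 1)"
      then obtain x p q where p: "(x, p, q) \<in> B.anchored (Suc k)" "B.depth p q = k + 1" "Y = B.code p q"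
        by (auto simp: B.codes_at_def)
      then have "B.cut a' b' k p q \<or> B.cut b' a' k p q"
        using B.long_limb_cases[OF ab' _ B.anchored_D(1)[OF p(1)] p(2)] diam by auto
      then show "Y \<in> {B.code u' w', B.code w' u'}" using B.cut_unique c' f(2) p(3) by blast
    qed
  qed
  have "{A.code u w, A.code w u} = {B.code u' w', B.code w' u'}" using exA exB cntK by blast
  then show ?thesis using odd_assemble c c' by (auto simp: A.cut_def B.cut_def)
qed

text \<open>A piece of \<open>limb y z\<close> too large for the thin limb pins the position of \<open>z\<close> in any copy.\<close>

lemma thin_limb_eq:
  assumes n: "l + r = card V" and diam: "A.diam = B.diam" and tA: "A.thin r z y" and tB: "B.thin r z' y'"
    and J: "A.depth z y = J" "B.depth z' y' = J" and ge: "card (B.limb z' y') \<le> card (A.limb z y)"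
    and big: "A.diam + card (A.limb z y) + 2 * r + 2 \<le> card V + J"
  shows "A.code z y = B.code z' y'"
proof -
  let ?e = "A.diam"
  have eA: "E z y" "E y z" and eB: "E' z' y'" "E' y' z'" and bA: "card (A.limb z y) \<le> J + r"
    and bB: "card (B.limb z' y') \<le> J + r" and J2: "?e + 1 \<le> 2 * J"
    using tA tB J A.adj_sym B.adj_sym by (auto simp: A.thin_def B.thin_def)
  have V: "z \<in> V" "y \<in> V" "z' \<in> V'" "y' \<in> V'" using eA eB A.adj_V B.adj_V by auto
  have JD: "J \<le> ?e" using A.depth_le_diam[OF eA(1)] J by simp
  have N: "A.limb y z = V - A.limb z y" "B.limb y' z' = V' - B.limb z' y'"
    by (rule A.limb_compl[OF eA(1)], rule B.limb_compl[OF eB(1)])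
  have dN: "A.d z q + J \<le> ?e" if "q \<in> A.limb y z" for q using A.other_side[OF eA(1) that] J by simp
  have dN': "B.d z' q + J \<le> ?e" if "q \<in> B.limb y' z'" for q using B.other_side[OF eB(1) that] J diam by simp
  have ecc: "A.d z q \<le> J" if "q \<in> V" for q
    using A.depth_ge[of q z y] dN[of q] J N J2 that by fastforce
  have ecc': "B.d z' q \<le> J" if "q \<in> V'" for q
    using B.depth_ge[of q z' y'] dN'[of q] J N J2 that by fastforce
  obtain a0 b0 where ab0: "a0 \<in> V" "b0 \<in> V" "A.d a0 b0 = ?e" using A.diam_ex V by blast
  have "a0 \<in> A.limb z y \<or> b0 \<in> A.limb z y"
  proof (rule ccontr)
    assume "\<not> ?thesis"
    then have "A.d z a0 + J \<le> ?e" "A.d z b0 + J \<le> ?e" using dN N ab0 by auto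
    moreover have "?e \<le> A.d z a0 + A.d z b0" using A.d_triangle[OF ab0(1) V(1) ab0(2)] ab0(3) by (simp add: A.d_sym)
    ultimately show False using J2 by simp
  qed
  then obtain a b where ab: "a \<in> A.limb z y" "b \<in> V" "A.d a b = ?e"
    using ab0 by (metis A.d_sym)
  have aV: "a \<in> V" using ab A.limb_V by blast
  \<comment> \<open>The pattern is to contain a diametral pair. One end \<open>a\<close> lies in the
    thin limb because \<open>2 * J\<close> exceeds the diameter; the path to the other end is added
    if that end lies on the side of \<open>z\<close>.\<close>
  define C0 where "C0 = (if b \<in> A.limb y z then A.interval z b else {z})"
  have clN: "A.closed z (A.limb y z)" using A.closed_limb[OF eA(2)] .
  have C0: "A.closed z C0" "C0 \<subseteq> A.limb y z" "card C0 \<le> ?e - J + 1"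
  proof -
    show "A.closed z C0" using A.closed_interval'[OF V(1) ab(2)] A.closed_interval'[OF V(1) V(1)] V
      unfolding C0_def by (auto simp: A.closed_def)
    show "C0 \<subseteq> A.limb y z"
      using A.limb_convex[OF eA(2) A.limb_self[OF eA(2)]] A.limb_self[OF eA(2)] by (auto simp: C0_def)
    show "card C0 \<le> ?e - J + 1"
    proof (cases "b \<in> A.limb y z")
      case True then show ?thesis using A.interval_card[OF V(1) ab(2)] dN[OF True] by (simp add: C0_def)
    qed (simp add: C0_def)
  qed
  have cN: "?e - J + 2 + r \<le> card (A.limb y z)" using A.limb_card[OF eA(1)] big JD by simp
  obtain C where C: "A.closed z C" "C0 \<subseteq> C" "C \<subseteq> A.limb y z" "card C = ?e - J + 2 + r"
    using A.closed_extend[OF C0(1) clN C0(2) _ cN] C0(3) by auto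
  let ?X = "A.limb z y \<union> C"
  have "z \<in> C" using C(1) by (simp add: A.closed_def)
  then have clX: "A.closed z ?X"
    using A.closed_Un[OF A.closed_insert_limb[OF eA(1)] C(1)] by (simp add: insert_absorb)
  have disj: "A.limb z y \<inter> C = {}" using C(3) N by blast
  have finC: "finite C" using C(3) finite_subset by (metis A.finite_limb)
  have "card ?X = card (A.limb z y) + card C" using disj finC by (simp add: card_Un_disjoint)
  then have cX: "card ?X \<le> l" using C(4) big n JD by simp
  have XV: "?X \<subseteq> V" using clX by (simp add: A.closed_def)
  obtain f where f: "iemb E ?X E' f" "f ` ?X \<subseteq> V'" using embeds[OF XV cX] .
  have dist: "B.d (f p) (f q) = A.d p q" if "p \<in> ?X" "q \<in> ?X" for p q
    using iemb_dist[OF clX f that] .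
  have inj: "inj_on f ?X" using f(1) by (simp add: iemb_def)
  have bX: "b \<in> ?X"
  proof (cases "b \<in> A.limb y z")
    case True then show ?thesis using C(2) A.interval_ends[OF V(1) ab(2)] by (auto simp: C0_def)
  qed (use N ab in auto)
  have mem: "z \<in> ?X" "y \<in> ?X" "a \<in> ?X" "b \<in> ?X"
    using \<open>z \<in> C\<close> A.limb_self[OF eA(1)] ab bX by auto
  let ?z = "f z" and ?y = "f y"
  have fV: "f q \<in> V'" if "q \<in> ?X" for q using f(2) that by blast
  have e2: "E' ?z ?y" using f(1) mem eA unfolding iemb_def by blast
  \<comment> \<open>The image of the diametral pair is diametral, so by \<open>ecc_diam\<close> it
    governs all distances from the image of \<open>z\<close>.\<close>
  have ecc2: "B.d ?z q \<le> J" if "q \<in> V'" for q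
  proof -
    have "B.d (f a) (f b) = B.diam" using dist mem ab diam by simp
    from B.ecc_diam[OF fV[OF mem(3)] fV[OF mem(4)] this fV[OF mem(1)] that]
    have "B.d ?z q \<le> max (A.d z a) (A.d z b)" using dist mem by simp
    then show ?thesis using ecc[OF aV] ecc[OF ab(2)] by simp
  qed
  obtain x where x: "x \<in> A.limb z y" "A.d z x = J" using A.depth_ex[OF eA(1)] J by metis
  obtain x' where x': "x' \<in> B.limb z' y'" "B.d z' x' = J" using B.depth_ex[OF eB(1)] J by metis
  have x'V: "x' \<in> V'" using x' B.limb_V by blast
  have fLam: "f ` A.limb z y \<subseteq> B.limb ?z ?y"
    using dist mem fV by (auto simp: B.limb_def A.limb_def)
  have fC: "f ` C \<subseteq> B.limb ?y ?z"
  proof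
    fix q assume "q \<in> f ` C"
    then obtain p where p: "q = f p" "p \<in> C" by blast
    then have "A.d p z < A.d p y" using C(3) by (auto simp: A.limb_def)
    then show "q \<in> B.limb ?y ?z" using dist[of p z] dist[of p y] mem fV p by (simp add: B.limb_def)
  qed
  have fx: "f x \<in> B.limb ?z ?y" "B.d ?z (f x) = J" using fLam x dist mem by auto
  have "card (f ` C) = card C" using inj by (intro card_image) (auto intro: inj_on_subset)
  then have cL: "?e - J + 2 + r \<le> card (B.limb ?y ?z)"
    using card_mono[OF B.finite_limb fC] C(4) by simp
  \<comment> \<open>If the image of \<open>z\<close> is outside the second thin limb,
    \<open>x'\<close> is too far from it; if \<open>z'\<close> is behind that image,
    \<open>f x\<close> is too far from \<open>z'\<close>. Otherwise the image of \<open>C\<close>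
    lies in the second thin limb. It shares at most \<open>?e - J + 1\<close> vertices with the path
    \<open>?S\<close> of \<open>J\<close> vertices, and thinness leaves at most \<open>r\<close>
    more, too few for \<open>card C\<close>.\<close>
  have z2: "?z = z'"
  proof (rule ccontr)
    assume ne: "?z \<noteq> z'"
    have pos: "B.d ?z z' > 0" using B.d_eq_0 ne fV mem V by blast
    show False
    proof (cases "?z \<in> B.limb z' y'")
      case False
      then have "?z \<in> B.limb y' z'" using N fV mem by blast
      then have "B.d ?z x' = B.d ?z z' + J" using B.cross'[OF eB(1) _ x'(1)] x'(2) by simp
      then show False using ecc2[OF x'V] pos by simp
    next
      case zB: True
      show False
      proof (cases "z' \<in> B.limb ?z ?y")
        case False
        then have "z' \<in> B.limb ?y ?z" using B.limb_compl[OF e2] V by blast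
        then have "B.d z' (f x) = B.d z' ?z + J" using B.cross'[OF e2 _ fx(1)] fx(2) by simp
        then show False using ecc'[of "f x"] fx B.limb_V pos by (auto simp: B.d_sym)
      next
        case zL: True
        let ?L = "B.limb ?y ?z" and ?S = "B.interval y' x'"
        note e2' = B.adj_sym[OF e2]
        have LB: "?L \<subseteq> B.limb z' y'"
        proof (rule ccontr)
          assume "\<not> ?L \<subseteq> B.limb z' y'"
          then obtain q where q: "q \<in> ?L" "q \<in> B.limb y' z'" using N B.limb_V by blast
          have "B.d ?z q = B.d ?z z' + B.d z' q" using B.cross[OF eB(2) zB q(2)] .
          moreover have "B.d z' q = B.d z' ?z + B.d ?z q" using B.cross[OF e2' zL q(1)] .
          ultimately show False using pos by (simp add: B.d_sym)
        qed
        have S: "?S \<subseteq> B.limb z' y'" using B.limb_convex[OF eB(1) B.limb_self[OF eB(1)] x'(1)] .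
        have "B.d x' z' = B.d x' y' + 1" using B.limb_dist[OF eB(1) x'(1)] .
        then have cS: "card ?S = J" using B.interval_card[OF V(4) x'V] x'(2) by (simp add: B.d_sym)
        have SI: "B.d z' q + B.d q x' = J" if "q \<in> ?S" for q
        proof -
          have "q \<in> B.limb z' y'" using S that by blast
          then have "B.d z' q = B.d y' q + 1" using B.limb_dist'[OF eB(1)] by blast
          moreover have "B.d y' q + B.d q x' = B.d y' x'" using that by (simp add: B.interval_def)
          ultimately show ?thesis using \<open>B.d x' z' = _\<close> x'(2) by (simp add: B.d_sym)
        qed
        have LS: "card (?L \<inter> ?S) \<le> ?e - J + 1"
        proof (cases "x' \<in> ?L")
          case True
          have "B.d (f x) x' = B.d (f x) ?z + B.d ?z x'" using B.cross[OF e2' fx(1) True] .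
          moreover have "f x \<in> V'" using fx(1) B.limb_V by blast
          then have "B.d (f x) x' \<le> ?e" using B.d_le_diam[OF _ x'V] diam by simp
          ultimately have zx: "B.d ?z x' + J \<le> ?e" using fx(2) by (simp add: B.d_sym)
          have "B.d z' x' = B.d z' ?z + B.d ?z x'" using B.cross[OF e2' zL True] .
          then have sum: "B.d z' ?z + B.d ?z x' = J" using x'(2) by simp
          have "B.d x' q \<le> ?e - J" if "q \<in> ?L \<inter> ?S" for q
          proof -
            have "B.d z' q = B.d z' ?z + B.d ?z q" using B.cross[OF e2' zL] that by blast
            then show ?thesis using SI[of q] that sum zx by (simp add: B.d_sym)
          qed
          then have "B.d x' ` (?L \<inter> ?S) \<subseteq> {..?e - J}" by auto
          moreover have "inj_on (B.d x') (?L \<inter> ?S)"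
            using B.interval_unique[of _ x' y'] x'V V B.interval_sym[of y' x'] by (auto intro!: inj_onI)
          ultimately show ?thesis using card_inj_on_le[of "B.d x'" "?L \<inter> ?S" "{..?e - J}"] by simp
        next
          case False
          then have "x' \<in> B.limb ?z ?y" using B.limb_compl[OF e2'] x'V by blast
          then have I: "B.interval z' x' \<subseteq> B.limb ?z ?y" using B.limb_convex[OF e2 zL] by blast
          have "?S \<subseteq> B.interval z' x'" using SI B.interval_V[of y' x'] x'(2) by (auto simp: B.interval_def)
          then have "?L \<inter> ?S = {}" using I B.limb_compl[OF e2'] by blast
          then show ?thesis by simp
        qed
        have "?L \<subseteq> (B.limb z' y' - ?S) \<union> (?L \<inter> ?S)" using LB by blast
        then have "card ?L \<le> card ((B.limb z' y' - ?S) \<union> (?L \<inter> ?S))" by (intro card_mono) auto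
        also have "\<dots> \<le> card (B.limb z' y' - ?S) + card (?L \<inter> ?S)" by (rule card_Un_le)
        also have "card (B.limb z' y' - ?S) = card (B.limb z' y') - J" using S cS by (simp add: card_Diff_subset)
        finally show False using LS cL bB by simp
      qed
    qed
  qed
  have y2: "?y = y'"
  proof (rule ccontr)
    assume ne: "?y \<noteq> y'"
    have "J \<le> B.depth z' ?y" using B.depth_ge[OF fx(1)] fx(2) z2 by simp
    then show False using B.depth_other[OF eB(1) _ ne] e2 z2 J J2 diam by simp
  qed
  have sub: "f ` A.limb z y \<subseteq> B.limb z' y'" using fLam z2 y2 by simp
  have injL: "inj_on f (A.limb z y)" using inj by (auto intro: inj_on_subset)
  have "f ` A.limb z y = B.limb z' y'"
    using card_seteq[OF B.finite_limb sub] card_image[OF injL] ge by simp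
  then have "bij_betw f (A.trunc (card V) z y) (B.trunc (card V) z' y')"
    using A.trunc_code[OF eA(1)] B.trunc_code[OF eB(1)] card_eq injL by (simp add: bij_betw_def)
  moreover have "iemb E (A.trunc (card V) z y) E' f"
    using iemb_subset[OF f(1)] A.trunc_code[OF eA(1)] by simp
  ultimately show ?thesis using iso_code[of z y z' y' f "card V"] eA(1) eB(1) y2 card_eq by simp
qed

text \<open>Since \<open>2 * J\<close> exceeds the diameter, the thin limb is the only branch of
  height \<open>J\<close> at \<open>z\<close>, so \<open>thin_limb_eq\<close> supplies the whole top
  level for \<open>core\<close>. If the recognising pattern does not fit into a card, the tree is
  concentrated on a diametral path.\<close>

lemma thin_case:
  assumes n: "l + r = card V" "9 * r + 10 \<le> card V" and diam: "A.diam = B.diam" "A.diam + 1 < l"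
    and tA: "A.thin r z y" and tB: "B.thin r z' y'" and J: "A.depth z y = J" "B.depth z' y' = J"
    and max: "\<And>u w. A.thin r u w \<Longrightarrow> A.depth u w \<le> J" and ge: "card (B.limb z' y') \<le> card (A.limb z y)"
  shows "\<exists>g. bij_betw g V V' \<and> iemb E V E' g"
proof (cases "A.diam + card (A.limb z y) + 2 * r + 2 \<le> card V + J")
  case True
  have eA: "E z y" "A.diam + 1 \<le> 2 * J" and eB: "E' z' y'" using tA tB J by (auto simp: A.thin_def B.thin_def)
  have V: "z \<in> V" "z' \<in> V'" using eA eB A.adj_V B.adj_V by auto
  have oA: "A.depth z v < J" if "E z v" "v \<noteq> y" for v using A.depth_other[OF eA(1) that] J eA(2) by simp
  have oB: "B.depth z' v < J" if "E' z' v" "v \<noteq> y'" for v using B.depth_other[OF eB that] J eA(2) diam by simp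
  have HA: "A.depth z v \<le> J" if "E z v" for v using oA[OF that] J by (cases "v = y") auto
  have HB: "B.depth z' v \<le> J" if "E' z' v" for v using oB[OF that] J by (cases "v = y'") auto
  have top: "filter_mset (\<lambda>C. height C = J) (A.branches z) = filter_mset (\<lambda>C. height C = J) (B.branches z')"
    using A.branches_top[OF eA(1) J(1) oA] B.branches_top[OF eB J(2) oB]
      thin_limb_eq[OF n(1) diam(1) tA tB J ge True] by simp
  have "Suc J < l" using A.depth_le_diam[OF eA(1)] J diam(2) by simp
  then have "A.code_count (Suc J) (card V) Y = B.code_count (Suc J) (card V') Y" for Y
    using all_counts[OF n(1) max] eA(2) by simp
  from core[OF V HA HB this eA(1) J(1) top] show ?thesis .
next
  case False
  have "card V + A.depth z y \<le> A.diam + card (A.limb z y) + 2 * r + 1" using False J by simp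
  then obtain a b where ab: "a \<in> V" "b \<in> V" "A.d a b = A.diam" "A.off_path_low a b (2 * r + 1)"
    using A.thin_off_path_low[OF tA] by blast
  have "card (A.limb z y) \<le> J + r" using tA J by (simp add: A.thin_def)
  then have "(2 * r + 1) + r + 2 \<le> A.diam div 2" using False n(2) by simp
  then show ?thesis using long_path[OF n(1) ab, of] diam(1) by simp
qed

theorem trees_isomorphic:
  assumes n: "l + r = card V" "9 * r + 10 \<le> card V"
  shows "\<exists>g. bij_betw g V V' \<and> iemb E V E' g"
proof -
  interpret BA: deck_trees V' E' V E l by (rule deck_trees_swap)
  have swap: "\<exists>g. bij_betw g V V' \<and> iemb E V E' g" if "\<exists>g. bij_betw g V' V \<and> iemb E' V' E g"
    using that bij_betw_inv_into iemb_inv by blast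
  have ne: "V \<noteq> {}" "V' \<noteq> {}" using n card_eq by auto
  have n': "l + r = card V'" "9 * r + 10 \<le> card V'" using n card_eq by auto
  consider "A.diam + 1 < l" "B.diam + 1 < l" | "l \<le> A.diam + 1 \<or> l \<le> B.diam + 1" by linarith
  then show ?thesis
  proof cases
    case 1
    have diam: "A.diam = B.diam" using diam_ge[of "A.diam"] BA.diam_ge[of "B.diam"] ne 1 by simp
    show ?thesis
    proof (cases "\<exists>z y. A.thin r z y")
      case True
      define HS where "HS = {h. \<exists>z y. A.thin r z y \<and> A.depth z y = h}"
      have "HS \<subseteq> {..A.diam}" using A.depth_le_diam by (auto simp: HS_def A.thin_def)
      then have fin: "finite HS" using finite_subset by blast
      have "HS \<noteq> {}" using True by (auto simp: HS_def)
      then have "Max HS \<in> HS" "\<And>h. h \<in> HS \<Longrightarrow> h \<le> Max HS" using fin by auto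
      then obtain z y where z: "A.thin r z y" and mx: "\<And>u w. A.thin r u w \<Longrightarrow> A.depth u w \<le> A.depth z y"
        unfolding HS_def by (smt (verit) mem_Collect_eq)
      have mx': "B.depth u w \<le> A.depth z y" if "B.thin r u w" for u w
        using BA.thin_transfer[OF n'(1) _ _ that] diam 1 mx by (metis add_lessD1 le_trans)
      obtain z' y' where z': "B.thin r z' y'" "A.depth z y \<le> B.depth z' y'"
        using thin_transfer[OF n(1) diam _ z] 1 by auto
      have depth: "B.depth z' y' = A.depth z y" using mx'[OF z'(1)] z'(2) by simp
      \<comment> \<open>The comparison embeds the thin limb of the first tree into that of the
        second and concludes by size, so the first tree has to be the one with the larger limb;
        otherwise the roles are exchanged.\<close>
      show ?thesis
      proof (cases "card (B.limb z' y') \<le> card (A.limb z y)")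
        case True
        then show ?thesis using thin_case[OF n diam 1(1) z z'(1) refl depth mx] by simp
      next
        case False
        then have "\<exists>g. bij_betw g V' V \<and> iemb E' V' E g"
          using BA.thin_case[OF n' diam[symmetric] 1(2) z'(1) z depth refl mx'] by simp
        then show ?thesis by (rule swap)
      qed
    next
      case False
      define k where "k = A.diam div 2"
      have e: "A.diam = 2 * k \<or> A.diam = 2 * k + 1" unfolding k_def by linarith
      have "Suc k < l" using e 1 n by linarith
      then have cnt: "A.code_count (Suc k) (card V) Y = B.code_count (Suc k) (card V') Y" for Y
        using all_counts[OF n(1), of k] False e by auto
      show ?thesis using e
      proof
        assume "A.diam = 2 * k"
        then show ?thesis using even_centre[of k] cnt diam n by simp
      next
        assume "A.diam = 2 * k + 1"
        then show ?thesis using odd_centre[of k] cnt diam ne by simp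
      qed
    qed
  next
    case 2
    \<comment> \<open>Diameters of this size are not visible in a card and might differ, hence the
      alternative premise of \<open>long_path\<close>. At most \<open>r\<close> vertices are off a
      diametral path in either tree.\<close>
    have big: "l \<le> A.diam + 1" "l \<le> B.diam + 1"
    proof -
      have "l > 0" using n by simp
      then have "l \<le> A.diam + 1 \<Longrightarrow> l \<le> B.diam + 1" "l \<le> B.diam + 1 \<Longrightarrow> l \<le> A.diam + 1"
        using diam_ge[of "l - 1"] BA.diam_ge[of "l - 1"] ne by auto
      then show "l \<le> A.diam + 1" "l \<le> B.diam + 1" using 2 by auto
    qed
    obtain a b where ab: "a \<in> V" "b \<in> V" "A.d a b = A.diam" using A.diam_ex ne by metis
    obtain a' b' where ab': "a' \<in> V'" "b' \<in> V'" "B.d a' b' = B.diam" using B.diam_ex ne by metis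
    have off: "A.off_path_low a b (2 * r + 1)" "B.off_path_low a' b' (2 * r + 1)"
      using A.off_path_low_card[OF ab(1,2)] B.off_path_low_card[OF ab'(1,2)] ab ab' big n n' by auto
    have t: "2 * r + 1 + r + 2 \<le> A.diam div 2" "2 * r + 1 + r + 2 \<le> B.diam div 2"
      using big n by auto
    show ?thesis
    proof (cases "A.diam \<le> B.diam")
      case True
      show ?thesis using long_path[OF n(1) ab off(1) _ t(1) True] ab' off(2) by auto
    next
      case False
      have "\<exists>g. bij_betw g V' V \<and> iemb E' V' E g"
        using BA.long_path[OF n'(1) ab' off(2) _ t(2)] False ab off(1) by auto
      then show ?thesis by (rule swap)
    qed
  qed
qed

end

section \<open>Recognising trees\<close>

definition cyc :: "('a \<Rightarrow> 'a \<Rightarrow> bool) \<Rightarrow> 'a list \<Rightarrow> bool" where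
  "cyc E vs \<longleftrightarrow> 3 \<le> length vs \<and> distinct vs \<and> (\<forall>i<length vs. E (vs ! i) (vs ! (Suc i mod length vs)))"

locale sgraph =
  fixes V :: "'a set" and E :: "'a \<Rightarrow> 'a \<Rightarrow> bool"
  assumes finite_V: "finite V" and adj_sym: "E u v \<Longrightarrow> E v u" and adj_irrefl: "\<not> E u u"
    and adj_V: "E u v \<Longrightarrow> u \<in> V"
begin

lemma adj_V': "E u v \<Longrightarrow> v \<in> V"
  using adj_V adj_sym by blast

definition reach :: "'a \<Rightarrow> 'a \<Rightarrow> bool" where "reach x y \<longleftrightarrow> (\<exists>n. (E ^^ n) x y)"

lemma reach_refl: "reach x x"
  unfolding reach_def by (intro exI[of _ 0]) simp

lemma reach_step: "reach x u \<Longrightarrow> E u w \<Longrightarrow> reach x w"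
  unfolding reach_def using relpowp_Suc_I by metis

lemma reach_trans: "reach x y \<Longrightarrow> reach y z \<Longrightarrow> reach x z"
  unfolding reach_def by (metis relpowp_trans)

lemma reach_sym: "reach x y \<Longrightarrow> reach y x"
proof -
  have "(E ^^ n) x y \<Longrightarrow> (E ^^ n) y x" for n
  proof (induction n arbitrary: y)
    case (Suc n)
    then obtain z where "(E ^^ n) x z" "E z y" by (auto elim: relpowp_Suc_E)
    with Suc.IH adj_sym show ?case by (meson relpowp_Suc_I2)
  qed auto
  then show "reach x y \<Longrightarrow> reach y x" unfolding reach_def by blast
qed

lemma gdist_le: "(E ^^ n) x y \<Longrightarrow> gdist E x y \<le> n"
  unfolding gdist_def by (rule Least_le)

lemma gdist_relpow: "reach x y \<Longrightarrow> (E ^^ gdist E x y) x y"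
  unfolding gdist_def reach_def using LeastI_ex by metis

lemma gdist_0: "reach x y \<Longrightarrow> gdist E x y = 0 \<longleftrightarrow> x = y"
proof
  assume "reach x y" "gdist E x y = 0"
  then show "x = y" using gdist_relpow[of x y] by simp
next
  assume "x = y"
  then have "gdist E x y \<le> 0" using gdist_le[of 0 x y] by simp
  then show "gdist E x y = 0" by simp
qed

lemma closer:
  assumes "reach x u" "u \<noteq> x"
  obtains w where "E u w" "reach x w" "gdist E x w < gdist E x u"
proof -
  have "gdist E x u \<noteq> 0" using assms gdist_0 by blast
  then obtain n where n: "gdist E x u = Suc n" using not0_implies_Suc by blast
  then obtain w where w: "(E ^^ n) x w" "E w u" using gdist_relpow[OF assms(1)] by (metis relpowp_Suc_E)
  then have "gdist E x w < gdist E x u" using gdist_le n by fastforce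
  then show ?thesis using that w adj_sym unfolding reach_def by blast
qed

text \<open>A shortest walk from \<open>v\<close> to \<open>w\<close> avoiding \<open>u\<close>
  repeats no vertex, and \<open>u\<close> closes it to a cycle; \<open>v \<noteq> w\<close> ensures
  length at least 3.\<close>

lemma avoiding_cycle:
  assumes "E u v" "E u w" "v \<noteq> w" "(\<lambda>a b. E a b \<and> a \<noteq> u \<and> b \<noteq> u)\<^sup>*\<^sup>* v w"
  shows "\<exists>vs. cyc E vs"
proof -
  let ?R = "\<lambda>a b. E a b \<and> a \<noteq> u \<and> b \<noteq> u"
  obtain n0 where "(?R ^^ n0) v w" using assms(4) unfolding rtranclp_power by blast
  define m where "m = (LEAST n. (?R ^^ n) v w)"
  have m: "(?R ^^ m) v w" unfolding m_def by (rule LeastI) fact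
  have least: "m \<le> n" if "(?R ^^ n) v w" for n unfolding m_def using that by (rule Least_le)
  obtain f where f: "f 0 = v" "f m = w" "\<And>i. i < m \<Longrightarrow> ?R (f i) (f (Suc i))"
    using m unfolding relpowp_fun_conv by blast
  have part: "(?R ^^ (j - i)) (f i) (f j)" if "i \<le> j" "j \<le> m" for i j
    unfolding relpowp_fun_conv using f(3) that by (intro exI[of _ "\<lambda>k. f (i + k)"]) auto
  have inj: "inj_on f {..m}"
  proof (rule linorder_inj_onI)
    fix i j assume ij: "i < j" "i \<in> {..m}" "j \<in> {..m}"
    show "f i \<noteq> f j"
    proof
      assume "f i = f j"
      then have "(?R ^^ (i + (m - j))) v w"
        using part[of 0 i] part[of j m] ij f(1,2) unfolding relpowp_add by auto
      then show False using least[of "i + (m - j)"] ij by simp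
    qed
  qed auto
  have "m \<noteq> 0"
  proof
    assume "m = 0"
    then show False using f(1,2) assms(3) by simp
  qed
  have fu: "f i \<noteq> u" if "i \<le> m" for i
    using f(3)[of i] f(3)[of "i - 1"] that \<open>m \<noteq> 0\<close> by (cases "i < m") auto
  let ?vs = "u # map f [0..<Suc m]"
  have len: "length ?vs = m + 2" by simp
  have "cyc E ?vs"
    unfolding cyc_def
  proof (intro conjI allI impI)
    show "3 \<le> length ?vs" using \<open>m \<noteq> 0\<close> by simp
    have "inj_on f {0..<Suc m}" using inj by (simp add: atLeast0LessThan lessThan_Suc_atMost)
    moreover have "u \<notin> f ` {0..<Suc m}"
    proof
      assume "u \<in> f ` {0..<Suc m}"
      then obtain i where "i \<in> {0..<Suc m}" "u = f i" by blast
      then have "i \<le> m" "u = f i" by auto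
      then show False using fu by blast
    qed
    ultimately show "distinct ?vs" by (simp add: distinct_map del: upt_Suc)
    fix i assume "i < length ?vs"
    then have i: "i < m + 2" by simp
    consider "i = 0" | j where "i = Suc j" "j < m" | "i = Suc m"
      using i by (metis Suc_less_eq add_2_eq_Suc' less_SucE not0_implies_Suc)
    then show "E (?vs ! i) (?vs ! (Suc i mod length ?vs))"
    proof cases
      case 1
      then show ?thesis using assms(1) f(1) by (simp add: nth_append del: upt_Suc)
    next
      case 2
      then show ?thesis using f(3)[OF 2(2)] by (simp del: upt_Suc)
    next
      case 3
      then show ?thesis using adj_sym[OF assms(2)] f(2) len by (simp del: upt_Suc)
    qed
  qed
  then show ?thesis by blast
qed

lemma avoiding:
  assumes "reach x v" "gdist E x v \<le> gdist E x u" "v \<noteq> u"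
  shows "(\<lambda>a b. E a b \<and> a \<noteq> u \<and> b \<noteq> u)\<^sup>*\<^sup>* v x"
  using assms
proof (induction "gdist E x v" arbitrary: v rule: less_induct)
  case less
  show ?case
  proof (cases "v = x")
    case False
    then obtain w where w: "E v w" "reach x w" "gdist E x w < gdist E x v" using closer less.prems by metis
    then have "w \<noteq> u" using less.prems by auto
    then show ?thesis using less.hyps[OF w(3,2)] w less.prems by (auto intro: converse_rtranclp_into_rtranclp)
  qed simp
qed

lemma acyclic_unique:
  assumes "\<nexists>vs. cyc E vs" "reach x u" "E u v" "E u w"
    "gdist E x v \<le> gdist E x u" "gdist E x w \<le> gdist E x u"
  shows "v = w"
proof (rule ccontr)
  assume ne: "v \<noteq> w"
  let ?R = "\<lambda>a b. E a b \<and> a \<noteq> u \<and> b \<noteq> u"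
  have "v \<noteq> u" "w \<noteq> u" using assms adj_irrefl by auto
  then have "?R\<^sup>*\<^sup>* v x" "?R\<^sup>*\<^sup>* w x" using avoiding assms reach_step by blast+
  moreover have "symp ?R" using adj_sym by (auto intro: sympI)
  ultimately have "?R\<^sup>*\<^sup>* v w" by (meson rtranclp_trans symp_rtranclp sympD)
  then show False using avoiding_cycle assms ne by blast
qed

lemma acyclic_tree:
  assumes "\<nexists>vs. cyc E vs" "\<And>x y. x \<in> V \<Longrightarrow> y \<in> V \<Longrightarrow> reach x y"
  shows "tree_graph V E"
proof
  show "x \<in> V \<Longrightarrow> y \<in> V \<Longrightarrow> \<exists>n. (E ^^ n) x y" for x y using assms(2) by (auto simp: reach_def)
  show "v = w" if "x \<in> V" "E u v" "E u w" "gdist E x v \<le> gdist E x u" "gdist E x w \<le> gdist E x u" for x u v w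
    using acyclic_unique[OF assms(1) _ that(2-5)] assms(2) that adj_V by blast
qed (use finite_V adj_sym adj_irrefl adj_V in auto)

definition arcs :: "('a \<times> 'a) set" where "arcs = {(u, w). E u w}"

lemma finite_arcs: "finite arcs"
proof -
  have "arcs \<subseteq> V \<times> V" using adj_V adj_V' by (auto simp: arcs_def)
  then show ?thesis using finite_V finite_subset by blast
qed

text \<open>Each vertex other than \<open>x\<close> contributes the two arcs between itself and a
  chosen neighbour nearer to \<open>x\<close>.\<close>

lemma connected_arcs:
  assumes "x \<in> V" "\<And>y. y \<in> V \<Longrightarrow> reach x y"
  shows "2 * (card V - 1) \<le> card arcs"
proof -
  have "\<forall>v\<in>V - {x}. \<exists>w. E v w \<and> gdist E x w < gdist E x v" using closer assms by (metis DiffD1 DiffD2 insertI1)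
  then obtain p where p: "\<And>v. v \<in> V - {x} \<Longrightarrow> E v (p v) \<and> gdist E x (p v) < gdist E x v" by metis
  let ?f = "\<lambda>(v, b). if b then (v, p v) else (p v, v)"
  have "inj_on ?f ((V - {x}) \<times> UNIV)"
  proof (rule inj_onI)
    fix s s' assume s: "s \<in> (V - {x}) \<times> UNIV" "s' \<in> (V - {x}) \<times> UNIV" "?f s = ?f s'"
    obtain v b v' b' where e: "s = (v, b)" "s' = (v', b')" by (cases s; cases s')
    then show "s = s'" using s p[of v] p[of v'] by (cases b; cases b') auto
  qed
  moreover have "?f ` ((V - {x}) \<times> UNIV) \<subseteq> arcs"
  proof
    fix s assume "s \<in> ?f ` ((V - {x}) \<times> UNIV)"
    then obtain v b where "s = ?f (v, b)" "v \<in> V - {x}" by blast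
    then show "s \<in> arcs" using p[of v] adj_sym[of v "p v"] by (cases b) (auto simp: arcs_def)
  qed
  ultimately have "card ((V - {x}) \<times> (UNIV :: bool set)) \<le> card arcs"
    using finite_arcs by (rule card_inj_on_le)
  then show ?thesis using assms(1) finite_V by (simp add: card_cartesian_product)
qed

text \<open>In an acyclic graph each vertex has at most one neighbour not farther from the
  representative of its component, so every edge can be charged to its farther end, and
  representatives are never charged. Two components would leave at most
  \<open>2 * (card V - 2)\<close> arcs.\<close>

lemma acyclic_connected:
  assumes acyc: "\<nexists>vs. cyc E vs" and arcs: "2 * (card V - 1) \<le> card arcs" and xy: "x \<in> V" "y \<in> V"
  shows "reach x y"
proof (rule ccontr)
  assume not: "\<not> reach x y"
  define c where "c v = (SOME y. reach v y)" for v
  have c: "reach v (c v)" for v unfolding c_def using reach_refl by (rule someI)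
  have c_eq: "c v = c w" if "reach v w" for v w
  proof -
    have "reach v = reach w" using that reach_trans reach_sym by (intro ext) blast
    then show ?thesis by (simp add: c_def)
  qed
  have c_reach: "reach (c v) v" for v using c reach_sym by blast
  \<comment> \<open>An arc is charged to its end farther from the representative; the flag records
    whether this end is the tail.\<close>
  let ?f = "\<lambda>(u, w). if gdist E (c u) w < gdist E (c u) u then (u, True) else (w, False)"
  have ce: "c u = c w" if "E u w" for u w using c_eq reach_step[OF reach_refl that] by blast
  have root: "v \<noteq> c v" if "E v w" "gdist E (c v) w \<le> gdist E (c v) v" for v w
  proof
    assume "v = c v"
    then have "gdist E (c v) v = 0" using gdist_0[OF c_reach[of v]] by simp
    then have "gdist E (c v) w = 0" using that by simp
    moreover have "reach (c v) w" using reach_step[OF c_reach that(1)] .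
    ultimately have "c v = w" using gdist_0 by blast
    then show False using \<open>v = c v\<close> that(1) adj_irrefl by simp
  qed
  let ?W = "(V - {c x, c y}) \<times> (UNIV :: bool set)"
  have "inj_on ?f arcs"
  proof (rule inj_onI)
    fix s s' assume s: "s \<in> arcs" "s' \<in> arcs" "?f s = ?f s'"
    obtain u w u' w' where e: "s = (u, w)" "s' = (u', w')" by (cases s; cases s')
    have E: "E u w" "E u' w'" using s e by (auto simp: arcs_def)
    consider "u = u'" "gdist E (c u) w < gdist E (c u) u" "gdist E (c u) w' < gdist E (c u) u"
      | "w = w'" "gdist E (c w) u \<le> gdist E (c w) w" "gdist E (c w) u' \<le> gdist E (c w) w"
      using s(3) e ce[OF E(1)] ce[OF E(2)] by (auto split: if_splits)
    then show "s = s'"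
    proof cases
      case 1
      then have "w = w'" using acyclic_unique[OF acyc c_reach[of u] E(1)] E by simp
      then show ?thesis using 1 e by simp
    next
      case 2
      then have "u = u'" using acyclic_unique[OF acyc c_reach[of w] adj_sym[OF E(1)]] adj_sym[OF E(2)] by simp
      then show ?thesis using 2 e by simp
    qed
  qed
  moreover have "?f ` arcs \<subseteq> ?W"
  proof
    fix q assume "q \<in> ?f ` arcs"
    then obtain u w where q: "q = ?f (u, w)" "E u w" by (auto simp: arcs_def)
    have cc: "c (c v) = c v" for v using c_eq[OF c_reach[of v]] .
    show "q \<in> ?W"
    proof (cases "gdist E (c u) w < gdist E (c u) u")
      case True
      then have "u \<noteq> c u" using root[OF q(2)] by simp
      then have "u \<noteq> c x" "u \<noteq> c y" using cc by metis+
      then show ?thesis using q True adj_V by auto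
    next
      case False
      then have "w \<noteq> c w" using root[OF adj_sym[OF q(2)]] ce[OF q(2)] by simp
      then have "w \<noteq> c x" "w \<noteq> c y" using cc by metis+
      then show ?thesis using q False adj_V' by auto
    qed
  qed
  moreover have "finite ?W" using finite_V by simp
  ultimately have "card arcs \<le> card ?W" by (rule card_inj_on_le)
  moreover have "c x \<in> V" "c y \<in> V"
  proof -
    have "v \<in> V" if "reach u v" "u \<in> V" for u v
      using that gdist_relpow[OF that(1)] adj_V' by (cases "gdist E u v") (auto elim: relpowp_Suc_E)
    then show "c x \<in> V" "c y \<in> V" using c xy by blast+
  qed
  moreover have "c x \<noteq> c y" using not c c_reach reach_trans by metis
  moreover have "card (V - {c x, c y}) = card V - 2"
    using calculation finite_V by (simp add: card_Diff_subset)
  moreover have "card {c x, c y} \<le> card V" using calculation finite_V by (intro card_mono) auto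
  ultimately show False using arcs by (simp add: card_cartesian_product)
qed

end

lemma (in tree_graph) sgraph: "sgraph V E"
  by unfold_locales (use finite_V adj_sym adj_irrefl adj_V in auto)

section \<open>Induced paths in trees and in chordless cycles\<close>

definition path_adj :: "nat \<Rightarrow> nat \<Rightarrow> bool" where "path_adj i j \<longleftrightarrow> j = Suc i \<or> i = Suc j"

lemma (in tree_graph) path_geodesic:
  assumes f: "f \<in> Embs {..<m} path_adj V E" and ij: "i \<le> j" "j < m"
  shows "d (f i) (f j) = j - i"
  using ij
proof (induction j rule: less_induct)
  case (less j)
  have V: "f k \<in> V" if "k < m" for k using f that by (auto simp: Embs_def)
  have E: "E (f k) (f (Suc k))" if "Suc k < m" for k
    using f that by (auto simp: Embs_def iemb_def path_adj_def)
  show ?case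
  proof (cases "i = j")
    case False
    then obtain k where k: "j = Suc k" "i \<le> k" using less.prems by (cases j) auto
    have dk: "d (f i) (f k) = k - i" using less.IH[of k] k less.prems by simp
    have e: "E (f k) (f j)" using E[of k] k less.prems by simp
    show ?thesis
    proof (cases "i = k")
      case True
      then show ?thesis using d_adj[OF e] k by simp
    next
      case ik: False
      then obtain q where q: "k = Suc q" "i \<le> q" using k by (cases k) auto
      have dq: "d (f i) (f q) = q - i" using less.IH[of q] k q less.prems by simp
      have "f q \<noteq> f j" using f k q less.prems by (auto simp: Embs_def iemb_def dest: inj_onD)
      moreover have eq: "E (f k) (f q)" using adj_sym[OF E[of q]] k q less.prems by simp
      moreover have "d (f i) (f q) \<le> d (f i) (f k)" using dq dk q(1) by (simp add: diff_le_mono)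
      ultimately have "\<not> d (f i) (f j) \<le> d (f i) (f k)"
        using unique_closer[OF V[of i] eq e] less.prems by auto
      then show ?thesis using d_step[OF V[of i] e] dk k less.prems by auto
    qed
  qed simp
qed

text \<open>An induced path in a tree is geodesic, so its ordered pair of ends fixes both the number
  \<open>m\<close> of vertices and every vertex in between.\<close>

lemma (in tree_graph) card_paths:
  "(\<Sum>m\<in>{3..l}. card (Embs {..<m} path_adj V E)) \<le> card V * card V"
proof -
  let ?S = "SIGMA m:{3..l}. Embs {..<m} path_adj V E"
  let ?f = "\<lambda>(m, f). (f 0, f (m - 1))"
  have "inj_on ?f ?S"
  proof (rule inj_onI)
    fix s s' assume s: "s \<in> ?S" "s' \<in> ?S" "?f s = ?f s'"
    obtain m f m' f' where e: "s = (m, f)" "s' = (m', f')" by (cases s; cases s')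
    have m: "3 \<le> m" "3 \<le> m'" and f: "f \<in> Embs {..<m} path_adj V E" "f' \<in> Embs {..<m'} path_adj V E"
      and ends: "f 0 = f' 0" "f (m - 1) = f' (m' - 1)" using s e by auto
    have "m - 1 = m' - 1"
      using path_geodesic[OF f(1), of 0 "m - 1"] path_geodesic[OF f(2), of 0 "m' - 1"] m ends by simp
    then have mm: "m = m'" using m by simp
    have PiE: "f \<in> {..<m} \<rightarrow>\<^sub>E V" "f' \<in> {..<m} \<rightarrow>\<^sub>E V" using f mm by (auto simp: Embs_def)
    have "f i = f' i" if "i < m" for i
    proof (rule interval_unique)
      have V: "g i \<in> V" "g 0 \<in> V" "g (m - 1) \<in> V" if "g \<in> {..<m} \<rightarrow>\<^sub>E V" for g
        using \<open>i < m\<close> m by (auto intro!: PiE_mem[OF that])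
      show "f i \<in> interval (f 0) (f (m - 1))" "f 0 \<in> V" "f (m - 1) \<in> V"
        using path_geodesic[OF f(1), of 0 i] path_geodesic[OF f(1), of i "m - 1"]
          path_geodesic[OF f(1), of 0 "m - 1"] that m V[OF PiE(1)] by (auto simp: interval_def)
      show "f' i \<in> interval (f 0) (f (m - 1))"
        using path_geodesic[OF f(2), of 0 i] path_geodesic[OF f(2), of i "m - 1"]
          path_geodesic[OF f(2), of 0 "m - 1"] that m V[OF PiE(2)] ends mm by (auto simp: interval_def)
      show "d (f 0) (f i) = d (f 0) (f' i)"
        using path_geodesic[OF f(1), of 0 i] path_geodesic[OF f(2), of 0 i] that ends mm by simp
    qed
    then have "f = f'" using PiE by (intro PiE_ext) auto
    then show "s = s'" using e mm by simp
  qed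
  moreover have "?f ` ?S \<subseteq> V \<times> V"
  proof
    fix s assume "s \<in> ?f ` ?S"
    then obtain m :: nat and g where s: "s = (g 0, g (m - 1))" "3 \<le> m" "g \<in> {..<m} \<rightarrow>\<^sub>E V" by (auto simp: Embs_def)
    then show "s \<in> V \<times> V" using PiE_mem[OF s(3)] by auto
  qed
  moreover have "finite (V \<times> V)" using finite_V by simp
  ultimately have "card ?S \<le> card (V \<times> V)" by (rule card_inj_on_le)
  moreover have "card ?S = (\<Sum>m\<in>{3..l}. card (Embs {..<m} path_adj V E))"
    using finite_Embs[OF _ finite_V] by (intro card_SigmaI) auto
  ultimately show ?thesis by (simp add: card_cartesian_product)
qed

lemma mod_add_left_cancel:
  fixes s a b c :: nat
  assumes "(s + a) mod c = (s + b) mod c" "a < c" "b < c"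
  shows "a = b"
proof -
  have *: "a \<le> b" if "(s + a) mod c = (s + b) mod c" "a < c" "b < c" for a b
  proof (rule ccontr)
    assume "\<not> a \<le> b"
    then have "c dvd (s + a) - (s + b)" using that(1) by (subst mod_eq_dvd_iff_nat[symmetric]) auto
    then show False using that \<open>\<not> a \<le> b\<close> by (auto dest: dvd_imp_le)
  qed
  show ?thesis using *[of a b] *[of b a] assms by simp
qed

definition cadj :: "nat \<Rightarrow> nat \<Rightarrow> nat \<Rightarrow> bool" where
  "cadj c i j \<longleftrightarrow> j = Suc i mod c \<or> i = Suc j mod c"

context sgraph
begin

text \<open>A chord of a shortest cycle would close an arc of it to a shorter cycle.\<close>

lemma chordless_cycle:
  assumes "\<exists>vs. cyc E vs"
  obtains vs where "cyc E vs" "\<And>i j. i < length vs \<Longrightarrow> j < length vs \<Longrightarrow> E (vs ! i) (vs ! j) \<Longrightarrow> cadj (length vs) i j"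
proof -
  obtain vs where vs: "cyc E vs" and least: "\<And>ws. cyc E ws \<Longrightarrow> length vs \<le> length ws"
    using ex_has_least_nat[of "cyc E" _ length] assms by blast
  let ?c = "length vs"
  have v: "3 \<le> ?c" "distinct vs" "\<And>i. i < ?c \<Longrightarrow> E (vs ! i) (vs ! (Suc i mod ?c))"
    using vs by (auto simp: cyc_def)
  have chord: "cadj ?c i j" if ij: "i < j" "j < ?c" "E (vs ! i) (vs ! j)" for i j
  proof (rule ccontr)
    assume no: "\<not> cadj ?c i j"
    let ?ws = "drop i (take (Suc j) vs)"
    have len: "length ?ws = Suc j - i" using ij by simp
    have nth: "?ws ! k = vs ! (i + k)" if "k \<le> j - i" for k using that ij by (simp add: min_def)
    have "cyc E ?ws"
      unfolding cyc_def
    proof (intro conjI allI impI)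
      have "j \<noteq> Suc i" using no ij by (auto simp: cadj_def)
      then show "3 \<le> length ?ws" using len ij by simp
      show "distinct ?ws" using v(2) by simp
      fix k assume "k < length ?ws"
      then have k: "k \<le> j - i" using len ij by simp
      show "E (?ws ! k) (?ws ! (Suc k mod length ?ws))"
      proof (cases "k = j - i")
        case True
        then have "Suc k mod length ?ws = 0" using len ij by (simp add: Suc_diff_le)
        then show ?thesis using nth[of k] nth[of 0] True ij adj_sym by simp
      next
        case False
        then have "Suc k mod length ?ws = Suc k" "Suc k \<le> j - i" using len k by auto
        then show ?thesis using nth[of k] nth[of "Suc k"] v(3)[of "i + k"] k ij by simp
      qed
    qed
    then have "?c \<le> Suc j - i" using least len by metis
    then have "i = 0" "Suc j = ?c" using ij by auto
    then show False using no by (simp add: cadj_def)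
  qed
  have "cadj ?c i j" if "i < ?c" "j < ?c" "E (vs ! i) (vs ! j)" for i j
  proof -
    have "i \<noteq> j" using that(3) adj_irrefl by auto
    then consider "i < j" | "j < i" by linarith
    then show ?thesis
    proof cases
      case 1 then show ?thesis using chord that by blast
    next
      case 2 then show ?thesis using chord[of j i] that adj_sym by (auto simp: cadj_def)
    qed
  qed
  then show ?thesis using that vs by blast
qed

text \<open>There are \<open>length vs\<close> starting points and two directions. Because
  \<open>m < length vs\<close>, the two ends of a window of \<open>m\<close> vertices are not
  adjacent around the cycle.\<close>

lemma cycle_paths:
  assumes vs: "cyc E vs" and chord: "\<And>i j. i < length vs \<Longrightarrow> j < length vs \<Longrightarrow> E (vs ! i) (vs ! j) \<Longrightarrow> cadj (length vs) i j"
    and m: "3 \<le> m" "m < length vs"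
  shows "2 * length vs \<le> card (Embs {..<m} path_adj V E)"
proof -
  let ?c = "length vs"
  have v: "3 \<le> ?c" "distinct vs" "\<And>i. i < ?c \<Longrightarrow> E (vs ! i) (vs ! (Suc i mod ?c))"
    using vs by (auto simp: cyc_def)
  have c0: "0 < ?c" using v(1) by linarith
  have nth_eq: "vs ! i = vs ! j \<longleftrightarrow> i = j" if "i < ?c" "j < ?c" for i j
    using nth_eq_iff_index_eq[OF v(2) that] .
  let ?t = "\<lambda>b i. if b then i else m - 1 - i"
  let ?g = "\<lambda>(s, b). restrict (\<lambda>i. vs ! ((s + ?t b i) mod ?c)) {..<m}"
  have adj: "E (vs ! ((s + i) mod ?c)) (vs ! ((s + j) mod ?c)) \<longleftrightarrow> path_adj i j" if ij: "i < m" "j < m" for s i j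
  proof
    assume "path_adj i j"
    then show "E (vs ! ((s + i) mod ?c)) (vs ! ((s + j) mod ?c))"
      using v(3)[of "(s + i) mod ?c"] v(3)[of "(s + j) mod ?c"] c0 adj_sym
      by (auto simp: path_adj_def mod_Suc_eq)
  next
    have one: "j = Suc i" if "i < m" "j < m" "(s + j) mod ?c = Suc ((s + i) mod ?c) mod ?c" for i j
    proof -
      have "(s + j) mod ?c = (s + Suc i) mod ?c" unfolding that(3) by (simp add: mod_Suc_eq)
      then show ?thesis using mod_add_left_cancel[of s j ?c "Suc i"] that(1,2) m by simp
    qed
    assume "E (vs ! ((s + i) mod ?c)) (vs ! ((s + j) mod ?c))"
    then have "cadj ?c ((s + i) mod ?c) ((s + j) mod ?c)" using chord c0 by simp
    then show "path_adj i j" using one[of i j] one[of j i] ij by (auto simp: cadj_def path_adj_def)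
  qed
  have vsV: "vs ! i \<in> V" if "i < ?c" for i using v(3)[OF that] adj_V by blast
  have tm: "?t b i < m" if "i < m" for b i using that by auto
  have inj_t: "?t b i = ?t b j \<longleftrightarrow> i = j" if "i < m" "j < m" for b i j using that by auto
  have "?g ` ({..<?c} \<times> UNIV) \<subseteq> Embs {..<m} path_adj V E"
  proof
    fix f assume "f \<in> ?g ` ({..<?c} \<times> UNIV)"
    then obtain s b where f: "f = ?g (s, b)" by blast
    have "inj_on f {..<m}"
    proof (rule inj_onI)
      fix i j assume ij: "i \<in> {..<m}" "j \<in> {..<m}" "f i = f j"
      then have "(s + ?t b i) mod ?c = (s + ?t b j) mod ?c" using f nth_eq c0 by simp
      then have "?t b i = ?t b j" using mod_add_left_cancel[of s "?t b i" ?c "?t b j"] tm[of i b] tm[of j b] ij m by simp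
      then show "i = j" using inj_t ij by simp
    qed
    moreover have "E (f i) (f j) \<longleftrightarrow> path_adj i j" if "i < m" "j < m" for i j
    proof -
      have "E (f i) (f j) \<longleftrightarrow> path_adj (?t b i) (?t b j)" using adj[OF tm tm] that f by simp
      then show ?thesis using that by (auto simp: path_adj_def)
    qed
    moreover have "f \<in> {..<m} \<rightarrow>\<^sub>E V" using f vsV c0 by auto
    ultimately show "f \<in> Embs {..<m} path_adj V E" by (simp add: Embs_def iemb_def)
  qed
  moreover have "inj_on ?g ({..<?c} \<times> UNIV)"
  proof (rule inj_onI)
    fix p p' assume p: "p \<in> {..<?c} \<times> UNIV" "p' \<in> {..<?c} \<times> UNIV" "?g p = ?g p'"
    obtain s b s' b' where e: "p = (s, b)" "p' = (s', b')" by (cases p; cases p')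
    have eq: "(s + ?t b i) mod ?c = (s' + ?t b' i) mod ?c" if "i < m" for i
      using fun_cong[OF p(3), of i] that e nth_eq c0 by simp
    \<comment> \<open>Comparing the first two vertices of a forward and a backward path gives
      \<open>2\<close> congruent to \<open>0\<close> modulo a cycle length of at least 3.\<close>
    have mixed: False if eq: "\<And>i. i < m \<Longrightarrow> (x + i) mod ?c = (y + (m - 1 - i)) mod ?c" for x y
    proof -
      have "(x + 0) mod ?c = (y + (m - 1 - 0)) mod ?c" "(x + 1) mod ?c = (y + (m - 1 - 1)) mod ?c"
        using eq[of 0] eq[of 1] m by linarith+
      then have "(x + 0) mod ?c = (y + (m - 1)) mod ?c" "(x + 1) mod ?c = (y + (m - 2)) mod ?c"
        by (simp_all only: diff_diff_left one_add_one diff_zero)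
      then have "Suc (y + (m - 1)) mod ?c = (y + (m - 2)) mod ?c" by (metis add.right_neutral add_Suc_right mod_Suc_eq One_nat_def)
      moreover have "Suc (y + (m - 1)) = (y + (m - 2)) + 2" using m by linarith
      ultimately have "((y + (m - 2)) + 2) mod ?c = ((y + (m - 2)) + 0) mod ?c" by (simp only: add_0_right)
      from mod_add_left_cancel[OF this] v(1) show False by force
    qed
    have "b = b'"
    proof (rule ccontr)
      assume "b \<noteq> b'"
      then show False using mixed[of s s'] mixed[of s' s] eq by (cases b; cases b') auto
    qed
    then have "(?t b 0 + s) mod ?c = (?t b 0 + s') mod ?c" using eq[of 0] m by (simp add: add.commute)
    then have "s = s'" using mod_add_left_cancel[of "?t b 0" s ?c s'] p(1,2) e by auto
    then show "p = p'" using e \<open>b = b'\<close> by simp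
  qed
  moreover have "finite (Embs {..<m} path_adj V E)" using finite_Embs finite_V by blast
  ultimately have "card ({..<?c} \<times> (UNIV :: bool set)) \<le> card (Embs {..<m} path_adj V E)"
    using card_inj_on_le by blast
  then show ?thesis by (simp add: card_cartesian_product)
qed

lemma card_arcs_Embs: "card arcs = card (Embs {..<2} path_adj V E)"
proof (rule bij_betw_same_card)
  let ?g = "\<lambda>(u, w). restrict (\<lambda>i. if i = 0 then u else w) {..<2::nat}"
  show "bij_betw ?g arcs (Embs {..<2} path_adj V E)"
    unfolding bij_betw_def
  proof
    have two: "i < 2 \<longleftrightarrow> i = 0 \<or> i = 1" for i :: nat by auto
    show "inj_on ?g arcs"
    proof (rule inj_onI)
      fix p q assume "?g p = ?g q"
      then have "?g p 0 = ?g q 0" "?g p 1 = ?g q 1" by auto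
      then show "p = q" by (cases p; cases q) simp
    qed
    show "?g ` arcs = Embs {..<2} path_adj V E"
    proof (intro set_eqI iffI)
      fix f assume "f \<in> ?g ` arcs"
      then obtain u w where f: "f = ?g (u, w)" "E u w" by (auto simp: arcs_def)
      have "u \<noteq> w" "E w u" "u \<in> V" "w \<in> V" using f(2) adj_irrefl adj_sym adj_V by blast+
      then show "f \<in> Embs {..<2} path_adj V E"
        using f adj_irrefl by (auto simp: Embs_def iemb_def path_adj_def inj_on_def two)
    next
      fix f assume f: "f \<in> Embs {..<2} path_adj V E"
      then have e: "E (f 0) (f 1)" and ext: "f \<in> extensional {..<2}"
        by (auto simp: Embs_def iemb_def path_adj_def PiE_def)
      have "f = ?g (f 0, f 1)"
        using ext by (intro extensionalityI[of f "{..<2}"]) (auto simp: two)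
      moreover have "(f 0, f 1) \<in> arcs" using e by (simp add: arcs_def)
      ultimately show "f \<in> ?g ` arcs" by (rule image_eqI)
    qed
  qed
qed

end

text \<open>A chordless cycle of length \<open>c > l\<close> contains \<open>2 * c\<close> induced paths on \<open>m\<close> vertices for each \<open>m \<le> l\<close>,
  whereas paths in a tree are determined by their ends.\<close>

lemma recognise_tree:
  assumes T: "tree_graph V E" "\<nexists>vs. cyc E vs" and G: "sgraph V' E'" and n: "card V = card V'" "2 \<le> card V"
    and l: "l \<le> card V" "8 * card V + 10 \<le> 9 * l"
    and emb: "\<And>(X :: nat set) F. finite X \<Longrightarrow> card X \<le> l \<Longrightarrow> card (Embs X F V E) = card (Embs X F V' E')"
  shows "tree_graph V' E'"
proof -
  interpret T: tree_graph V E by (rule T(1))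
  interpret T: sgraph V E by (rule T.sgraph)
  interpret G: sgraph V' E' by (rule G)
  have acyc: "\<nexists>vs. cyc E' vs"
  proof
    assume "\<exists>vs. cyc E' vs"
    then obtain vs where vs: "cyc E' vs"
      and chord: "\<And>i j. i < length vs \<Longrightarrow> j < length vs \<Longrightarrow> E' (vs ! i) (vs ! j) \<Longrightarrow> cadj (length vs) i j"
      using G.chordless_cycle by blast
    let ?c = "length vs"
    have v: "3 \<le> ?c" "distinct vs" "\<And>i. i < ?c \<Longrightarrow> E' (vs ! i) (vs ! (Suc i mod ?c))"
      using vs by (auto simp: cyc_def)
    show False
    proof (cases "?c \<le> l")
      case True
      have "E' (vs ! i) (vs ! j) \<longleftrightarrow> cadj ?c i j" if "i < ?c" "j < ?c" for i j
        using chord[OF that] v(3)[of i] v(3)[of j] that G.adj_sym by (auto simp: cadj_def)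
      moreover have "inj_on ((!) vs) {..<?c}" using v(2) by (auto simp: inj_on_def nth_eq_iff_index_eq)
      moreover have "vs ! i \<in> V'" if "i < ?c" for i using v(3)[OF that] G.adj_V by blast
      ultimately have "restrict ((!) vs) {..<?c} \<in> Embs {..<?c} (cadj ?c) V' E'"
        by (auto simp: Embs_def iemb_def inj_on_def)
      then have "0 < card (Embs {..<?c} (cadj ?c) V' E')"
        using finite_Embs[OF _ G.finite_V, of "{..<?c}"] by (auto simp: card_gt_0_iff)
      then have "0 < card (Embs {..<?c} (cadj ?c) V E)" using emb[of "{..<?c}" "cadj ?c"] True by simp
      then obtain f where f: "f \<in> Embs {..<?c} (cadj ?c) V E" unfolding card_gt_0_iff by blast
      have "cyc E (map f [0..<?c])"
        unfolding cyc_def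
      proof (intro conjI allI impI)
        show "3 \<le> length (map f [0..<?c])" using v(1) by simp
        show "distinct (map f [0..<?c])" using f by (simp add: distinct_map Embs_def iemb_def atLeast0LessThan)
        fix i assume "i < length (map f [0..<?c])"
        then have i: "i < ?c" by simp
        then have i': "Suc i mod ?c < ?c" by (intro mod_less_divisor) linarith
        then have "E (f i) (f (Suc i mod ?c))" using f i by (auto simp: Embs_def iemb_def cadj_def)
        then show "E (map f [0..<?c] ! i) (map f [0..<?c] ! (Suc i mod length (map f [0..<?c])))" using i i' by simp
      qed
      then show False using T(2) by blast
    next
      case False
      have "(\<Sum>m\<in>{3..l}. 2 * (l + 1)) \<le> (\<Sum>m\<in>{3..l}. card (Embs {..<m} path_adj V E))"
      proof (rule sum_mono)
        fix m assume m: "m \<in> {3..l}"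
        then have "2 * ?c \<le> card (Embs {..<m} path_adj V' E')" using G.cycle_paths[OF vs chord] False by simp
        then show "2 * (l + 1) \<le> card (Embs {..<m} path_adj V E)" using emb[of "{..<m}" path_adj] m False by simp
      qed
      also have "\<dots> \<le> card V * card V" by (rule T.card_paths)
      finally have *: "(l - 2) * (2 * (l + 1)) \<le> card V * card V" by simp
      \<comment> \<open>The premise \<open>8 * card V + 10 \<le> 9 * l\<close> enters here.
        Multiplied by 81, the bound on paths becomes
        \<open>128 * (card V - 1) \<le> 81 * card V\<close>, which fails for more than two
        vertices.\<close>
      have "8 * card V - 8 \<le> 9 * (l - 2)" "8 * card V \<le> 9 * (l + 1)" using l by auto
      then have "(8 * card V - 8) * (2 * (8 * card V)) \<le> (9 * (l - 2)) * (2 * (9 * (l + 1)))"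
        by (intro mult_le_mono[OF _ mult_le_mono[OF order_refl]]) simp_all
      also have "\<dots> = 81 * ((l - 2) * (2 * (l + 1)))" by (simp add: algebra_simps)
      also have "\<dots> \<le> 81 * (card V * card V)" using * by simp
      finally have "(8 * card V - 8) * (2 * (8 * card V)) \<le> 81 * (card V * card V)" .
      then have "(8 * card V - 8) * 16 \<le> 81 * card V" using n(2) by (simp add: mult.assoc)
      then show False using l by simp
    qed
  qed
  obtain x where x: "x \<in> V" using n(2) by fastforce
  have "2 * (card V - 1) \<le> card T.arcs"
    using T.connected_arcs[OF x] T.connected x unfolding T.reach_def by blast
  moreover have "card T.arcs = card G.arcs"
    using T.card_arcs_Embs G.card_arcs_Embs emb[of "{..<2}" path_adj] l n by simp
  ultimately have "G.reach x y" if "x \<in> V'" "y \<in> V'" for x y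
    using G.acyclic_connected[OF acyc _ that] n by simp
  then show ?thesis by (rule G.acyclic_tree[OF acyc])
qed

section \<open>Decks\<close>

abbreviation adj :: "'a pair_pre_digraph \<Rightarrow> 'a \<Rightarrow> 'a \<Rightarrow> bool" where
  "adj G x y \<equiv> (x, y) \<in> parcs G"

lemma pair_graph_sgraph: "pair_graph G \<Longrightarrow> sgraph (pverts G) (adj G)"
proof
  assume G: "pair_graph G"
  then interpret pair_graph G .
  show "finite (pverts G)" by (rule pair_finite_verts)
  show "adj G u v \<Longrightarrow> adj G v u" for u v using pair_sym_arcs by (auto simp: symmetric_def dest: symD)
  show "\<not> adj G u u" for u using pair_no_loops by force
  show "adj G u v \<Longrightarrow> u \<in> pverts G" for u v by (rule in_arcsD1)
qed

text \<open>The library's cycles are lists of arcs. The periodic enumeration \<open>g\<close> makes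
  the closing arc an ordinary one, and distinctness is required only of the vertices after the
  first.\<close>

lemma cyc_cycle:
  assumes G: "pair_graph G" and vs: "cyc (adj G) vs"
  shows "\<exists>p. pre_digraph.cycle (with_proj G) p \<and> 3 \<le> length p"
proof -
  interpret pair_graph G by (rule G)
  let ?c = "length vs"
  define g where "g i = vs ! (i mod ?c)" for i
  have v: "3 \<le> ?c" "distinct vs" "\<And>i. i < ?c \<Longrightarrow> adj G (vs ! i) (vs ! (Suc i mod ?c))"
    using vs by (auto simp: cyc_def)
  have g: "adj G (g i) (g (Suc i))" for i
  proof -
    have "i mod ?c < ?c" using v(1) by (intro mod_less_divisor) linarith
    then show ?thesis using v(3)[of "i mod ?c"] by (simp add: g_def mod_Suc_eq)
  qed
  let ?p = "\<lambda>a b. map (\<lambda>i. (g i, g (Suc i))) [a..<b]"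
  have cas: "pcas (g a) (?p a (a + k)) (g (a + k))" for a k
  proof (induction k arbitrary: a)
    case (Suc k)
    have "[a..<a + Suc k] = a # [Suc a..<Suc a + k]" by (simp add: upt_conv_Cons)
    then show ?case using Suc[of "Suc a"] by simp
  qed simp
  have verts: "pawalk_verts (g a) (?p a (a + k)) = map g [a..<Suc (a + k)]" for a k
  proof (induction k arbitrary: a)
    case (Suc k)
    have "[a..<a + Suc k] = a # [Suc a..<Suc a + k]" "[a..<Suc (a + Suc k)] = a # [Suc a..<Suc (Suc a + k)]"
      by (simp_all add: upt_conv_Cons)
    then show ?case using Suc[of "Suc a"] by simp
  qed simp
  have "g (0 + ?c) = g 0" by (simp add: g_def)
  then have "awalk (g 0) (?p 0 ?c) (g 0)"
    using cas[of 0 ?c] g in_arcsD1 by (auto simp: awalk_def)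
  moreover have "distinct (tl (pawalk_verts (g 0) (?p 0 ?c)))"
  proof -
    have "tl (map g [0..<Suc ?c]) = map g [1..<Suc ?c]" by (simp only: map_tl[symmetric] tl_upt One_nat_def)
    moreover have "inj_on g {1..<Suc ?c}"
    proof (rule inj_onI)
      fix i j assume ij: "i \<in> {1..<Suc ?c}" "j \<in> {1..<Suc ?c}" "g i = g j"
      have "i mod ?c < ?c" "j mod ?c < ?c" using v(1) by (auto intro!: mod_less_divisor)
      then have "i mod ?c = j mod ?c" using ij(3) nth_eq_iff_index_eq[OF v(2)] by (simp add: g_def)
      moreover have "1 + (i - 1) = i" "1 + (j - 1) = j" using ij by auto
      ultimately have "(1 + (i - 1)) mod ?c = (1 + (j - 1)) mod ?c" by (simp only:)
      moreover have "i - 1 < ?c" "j - 1 < ?c" using ij by auto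
      ultimately have "i - 1 = j - 1" using mod_add_left_cancel by blast
      then show "i = j" using ij by auto
    qed
    ultimately show ?thesis using verts[of 0 ?c] by (simp add: distinct_map del: upt_Suc)
  qed
  moreover have "?p 0 ?c \<noteq> []" "3 \<le> length (?p 0 ?c)" using v(1) by auto
  ultimately show ?thesis unfolding cycle_def by blast
qed

lemma undirected_tree_tree_graph:
  assumes "undirected_tree T"
  shows "tree_graph (pverts T) (adj T)" "\<nexists>vs. cyc (adj T) vs"
proof -
  have T: "pair_graph T" "Digraph_Component.connected (with_proj T)"
    "\<not> (\<exists>p. pre_digraph.cycle (with_proj T) p \<and> 3 \<le> length p)"
    using assms by (auto simp: undirected_tree_def)
  interpret sgraph "pverts T" "adj T" by (rule pair_graph_sgraph[OF T(1)])
  show acyc: "\<nexists>vs. cyc (adj T) vs" using cyc_cycle[OF T(1)] T(3) by blast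
  have "reach x y" if "x \<in> pverts T" "y \<in> pverts T" for x y
  proof -
    have par: "parcs (mk_symmetric (with_proj T)) \<subseteq> parcs T"
      using adj_sym by (auto simp: parcs_mk_symmetric)
    have "(x, y) \<in> rtrancl_on (pverts T) (parcs (mk_symmetric (with_proj T)))"
      using T(2) that by (auto simp: Digraph_Component.connected_def strongly_connected_def reachable_def)
    then show ?thesis
    proof (induction rule: rtrancl_on_induct)
      case base show ?case by (rule reach_refl)
    next
      case (step y z) then show ?case using reach_step par by blast
    qed
  qed
  then show "tree_graph (pverts T) (adj T)" using acyclic_tree[OF acyc] by blast
qed

lemma card_Embs_le:
  assumes "finite X" "finite M'" "bij_betw g M M'" "iemb E M E' g"
  shows "card (Embs X F M E) \<le> card (Embs X F M' E')"
proof (rule card_inj_on_le)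
  let ?c = "\<lambda>f. restrict (g \<circ> f) X"
  show "inj_on ?c (Embs X F M E)"
  proof (rule inj_onI)
    fix f1 f2 assume f: "f1 \<in> Embs X F M E" "f2 \<in> Embs X F M E" "?c f1 = ?c f2"
    have f12: "f1 \<in> X \<rightarrow>\<^sub>E M" "f2 \<in> X \<rightarrow>\<^sub>E M" using f by (auto simp: Embs_def)
    have "f1 y = f2 y" if "y \<in> X" for y
    proof -
      have "g (f1 y) = g (f2 y)" using fun_cong[OF f(3), of y] that by simp
      then show ?thesis using assms(3) f12 that by (auto simp: bij_betw_def dest: inj_onD)
    qed
    then show "f1 = f2" using f12 by (intro PiE_ext) auto
  qed
  show "?c ` Embs X F M E \<subseteq> Embs X F M' E'"
  proof
    fix h assume "h \<in> ?c ` Embs X F M E"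
    then obtain f where f: "f \<in> Embs X F M E" "h = ?c f" by blast
    then have fM: "f ` X \<subseteq> M" by (auto simp: Embs_def)
    have "g ` M = M'" using assms(3) by (simp add: bij_betw_def)
    then have "h \<in> X \<rightarrow>\<^sub>E M'" unfolding f(2) using fM by (intro restrict_PiE_iff[THEN iffD2]) auto
    moreover have "iemb F X E' h" using iemb_comp[OF _ fM assms(4)] f by (auto simp: Embs_def)
    ultimately show "h \<in> Embs X F M' E'" by (simp add: Embs_def)
  qed
  show "finite (Embs X F M' E')" using assms(1,2) by (rule finite_Embs)
qed

lemma card_Embs_iso:
  assumes "finite X" "finite M" "bij_betw g M M'" "iemb E M E' g"
  shows "card (Embs X F M E) = card (Embs X F M' E')"
proof (rule antisym)
  have "finite M'" using assms(2,3) bij_betw_finite by blast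
  then show "card (Embs X F M E) \<le> card (Embs X F M' E')" using card_Embs_le assms by blast
  show "card (Embs X F M' E') \<le> card (Embs X F M E)"
    using card_Embs_le[OF assms(1,2) bij_betw_inv_into[OF assms(3)] iemb_inv[OF assms(3,4)]] .
qed

lemma supersets_card:
  assumes "finite V" "A \<subseteq> V" "card A \<le> l"
  shows "card {S. S \<subseteq> V \<and> card S = l \<and> A \<subseteq> S} = (card V - card A) choose (l - card A)"
proof -
  have finA: "finite A" using assms finite_subset by blast
  have "bij_betw (\<lambda>B. A \<union> B) {B. B \<subseteq> V - A \<and> card B = l - card A} {S. S \<subseteq> V \<and> card S = l \<and> A \<subseteq> S}"
  proof (rule bij_betw_byWitness[where f' = "\<lambda>S. S - A"])
    show "\<forall>B\<in>{B. B \<subseteq> V - A \<and> card B = l - card A}. A \<union> B - A = B" by blast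
    show "\<forall>S\<in>{S. S \<subseteq> V \<and> card S = l \<and> A \<subseteq> S}. A \<union> (S - A) = S" by blast
    show "(\<lambda>B. A \<union> B) ` {B. B \<subseteq> V - A \<and> card B = l - card A} \<subseteq> {S. S \<subseteq> V \<and> card S = l \<and> A \<subseteq> S}"
    proof
      fix S assume "S \<in> (\<lambda>B. A \<union> B) ` {B. B \<subseteq> V - A \<and> card B = l - card A}"
      then obtain B where B: "S = A \<union> B" "B \<subseteq> V - A" "card B = l - card A" by blast
      have "finite B" "A \<inter> B = {}" using B(2) assms(1) finite_subset by blast+
      then have "card S = l" using B finA assms(3) by (simp add: card_Un_disjoint)
      then show "S \<in> {S. S \<subseteq> V \<and> card S = l \<and> A \<subseteq> S}" using B assms(2) by blast
    qed
    show "(\<lambda>S. S - A) ` {S. S \<subseteq> V \<and> card S = l \<and> A \<subseteq> S} \<subseteq> {B. B \<subseteq> V - A \<and> card B = l - card A}"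
      using finA by (auto simp: card_Diff_subset)
  qed
  then have "card {S. S \<subseteq> V \<and> card S = l \<and> A \<subseteq> S} = card {B. B \<subseteq> V - A \<and> card B = l - card A}"
    by (rule bij_betw_same_card[symmetric])
  also have "\<dots> = card (V - A) choose (l - card A)" using assms(1) by (simp add: n_subsets)
  also have "card (V - A) = card V - card A" using finA assms(2) by (rule card_Diff_subset)
  finally show ?thesis .
qed

text \<open>Kelly's lemma: every copy of a pattern lies in the same number of cards.\<close>

lemma Embs_cards:
  assumes "finite V" "finite X" "card X \<le> l"
  shows "(\<Sum>S\<in>{S. S \<subseteq> V \<and> card S = l}. card (Embs X F S E))
    = card (Embs X F V E) * ((card V - card X) choose (l - card X))"
proof -
  let ?C = "{S. S \<subseteq> V \<and> card S = l}"
  have fin: "finite ?C" using assms(1) by simp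
  have "Embs X F S E = {f \<in> Embs X F V E. f ` X \<subseteq> S}" if "S \<in> ?C" for S
    using that by (auto simp: Embs_def PiE_def Pi_def)
  then have "(\<Sum>S\<in>?C. card (Embs X F S E)) = (\<Sum>S\<in>?C. card {f \<in> Embs X F V E. f ` X \<subseteq> S})" by simp
  also have "\<dots> = (\<Sum>f\<in>Embs X F V E. card {S \<in> ?C. f ` X \<subseteq> S})"
  proof -
    have "(\<Sum>S\<in>?C. card {f \<in> Embs X F V E. f ` X \<subseteq> S}) = (\<Sum>S\<in>?C. \<Sum>f\<in>Embs X F V E. of_bool (f ` X \<subseteq> S))"
      using finite_Embs[OF assms(2,1)] by (simp add: Int_def)
    also have "\<dots> = (\<Sum>f\<in>Embs X F V E. \<Sum>S\<in>?C. of_bool (f ` X \<subseteq> S))" by (rule sum.swap)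
    finally show ?thesis using fin by (simp add: Int_def)
  qed
  also have "\<dots> = (\<Sum>f\<in>Embs X F V E. (card V - card X) choose (l - card X))"
  proof (rule sum.cong[OF refl])
    fix f assume "f \<in> Embs X F V E"
    then have f: "f ` X \<subseteq> V" "card (f ` X) = card X" by (auto simp: Embs_def iemb_def card_image)
    have "{S \<in> ?C. f ` X \<subseteq> S} = {S. S \<subseteq> V \<and> card S = l \<and> f ` X \<subseteq> S}" by blast
    then show "card {S \<in> ?C. f ` X \<subseteq> S} = (card V - card X) choose (l - card X)"
      using supersets_card[OF assms(1) f(1)] f(2) assms(3) by simp
  qed
  finally show ?thesis by simp
qed

text \<open>A number of copies attached to an isomorphism class through an arbitrary member;
  \<open>class_Embs_card\<close> shows that for cards the choice does not matter.\<close>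

definition class_Embs :: "nat set \<Rightarrow> (nat \<Rightarrow> nat \<Rightarrow> bool) \<Rightarrow> nat pair_pre_digraph set \<Rightarrow> nat" where
  "class_Embs X F C = card (Embs X F (pverts (SOME H. H \<in> C)) (adj (SOME H. H \<in> C)))"

lemma iso_iemb:
  assumes "pair_graph G" "inj_on f (pverts G)" "parcs H = map_prod f f ` parcs G"
  shows "iemb (adj G) (pverts G) (adj H) f"
  unfolding iemb_def
proof (intro conjI ballI)
  interpret pair_graph G by (rule assms(1))
  show "inj_on f (pverts G)" by (rule assms(2))
  fix x y assume xy: "x \<in> pverts G" "y \<in> pverts G"
  show "adj H (f x) (f y) \<longleftrightarrow> adj G x y"
  proof
    assume "adj H (f x) (f y)"
    then obtain x' y' where p: "(x', y') \<in> parcs G" "f x = f x'" "f y = f y'" using assms(3) by auto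
    then have "x = x'" "y = y'" using inj_onD[OF assms(2)] xy in_arcsD1 in_arcsD2 by metis+
    then show "adj G x y" using p by simp
  next
    assume "adj G x y"
    then show "adj H (f x) (f y)" using assms(3) by force
  qed
qed

definition card_graph :: "'a pair_pre_digraph \<Rightarrow> 'a set \<Rightarrow> 'a pair_pre_digraph" where
  "card_graph G S = \<lparr>pverts = S, parcs = {e \<in> parcs G. fst e \<in> S \<and> snd e \<in> S}\<rparr>"

lemma with_proj_card_graph: "with_proj G \<restriction> S = with_proj (card_graph G S)"
  by (simp add: induce_subgraph_def card_graph_def with_proj_def)

lemma card_graph_pair_graph:
  assumes "pair_graph G" "S \<subseteq> pverts G"
  shows "pair_graph (card_graph G S)"
proof -
  interpret pair_graph G by (rule assms(1))
  have fin: "finite S" using assms(2) pair_finite_verts finite_subset by blast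
  have sym: "symmetric (with_proj (card_graph G S))"
    using pair_sym_arcs by (auto simp: card_graph_def symmetric_def sym_def)
  show ?thesis
    by unfold_locales (use fin sym pair_finite_arcs pair_no_loops in \<open>auto simp: card_graph_def\<close>)
qed

lemma class_Embs_card:
  assumes G: "pair_graph G" and S: "S \<subseteq> pverts G" and X: "finite X"
  shows "class_Embs X F (iso_class (with_proj G \<restriction> S)) = card (Embs X F S (adj G))"
proof -
  let ?K = "card_graph G S"
  have K: "pair_graph ?K" using card_graph_pair_graph[OF G S] .
  then interpret K: pair_graph ?K .
  have fin: "finite S" using S G finite_subset by (metis pair_fin_digraph.pair_finite_verts pair_digraph.axioms(1) pair_graph.axioms(1))
  obtain h :: "'a \<Rightarrow> nat" where h: "inj_on h (pverts ?K)"
    using finite_imp_inj_to_nat_seg[OF K.pair_finite_verts] by auto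
  have "digraph_iso (with_proj ?K) (with_proj \<lparr>pverts = h ` pverts ?K, parcs = map_prod h h ` parcs ?K\<rparr>)"
    unfolding digraph_iso_with_proj_iff[OF K.pair_wf_digraph_axioms] using h by (intro exI[of _ h]) simp
  then have "\<exists>H. H \<in> iso_class (with_proj ?K)" by (auto simp: iso_class_def)
  then have "(SOME H. H \<in> iso_class (with_proj ?K)) \<in> iso_class (with_proj ?K)" by (rule someI_ex)
  then obtain f where f: "inj_on f (pverts ?K)" "pverts (SOME H. H \<in> iso_class (with_proj ?K)) = f ` pverts ?K"
    "parcs (SOME H. H \<in> iso_class (with_proj ?K)) = map_prod f f ` parcs ?K"
    unfolding iso_class_def mem_Collect_eq digraph_iso_with_proj_iff[OF K.pair_wf_digraph_axioms] by blast
  have "card (Embs X F (pverts ?K) (adj ?K)) = class_Embs X F (iso_class (with_proj ?K))"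
    unfolding class_Embs_def
    by (rule card_Embs_iso[OF X K.pair_finite_verts _ iso_iemb[OF K f(1,3)]]) (use f in \<open>simp add: bij_betw_def\<close>)
  moreover have "Embs X F (pverts ?K) (adj ?K) = Embs X F S (adj G)"
    by (auto simp: Embs_def iemb_def card_graph_def)
  ultimately show ?thesis by (simp add: with_proj_card_graph)
qed

lemma deck_sum:
  assumes K: "pair_graph K" and X: "finite X" "card X \<le> l"
  shows "(\<Sum>C\<in>#deck l K. class_Embs X F C)
    = card (Embs X F (pverts K) (adj K)) * ((card (pverts K) - card X) choose (l - card X))"
proof -
  interpret K: pair_graph K by (rule K)
  have "(\<Sum>C\<in>#deck l K. class_Embs X F C) = (\<Sum>S\<in>{S. S \<subseteq> pverts K \<and> card S = l}. class_Embs X F (iso_class (with_proj K \<restriction> S)))"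
    by (simp add: deck_def sum_unfold_sum_mset image_mset.compositionality comp_def)
  also have "\<dots> = (\<Sum>S\<in>{S. S \<subseteq> pverts K \<and> card S = l}. card (Embs X F S (adj K)))"
    using class_Embs_card[OF K _ X(1)] by (intro sum.cong) auto
  finally show ?thesis using Embs_cards[OF K.pair_finite_verts X, of F "adj K"] by simp
qed

text \<open>Summed over the deck, each copy is counted the same number of times, and this binomial
  coefficient is positive because \<open>card X \<le> l\<close> and \<open>l\<close> is at most the
  number of vertices; so it cancels.\<close>

lemma deck_Embs:
  assumes G: "pair_graph G" and H: "pair_graph H" and n: "card (pverts G) = card (pverts H)"
    and deck: "deck l G = deck l H" and l: "l \<le> card (pverts G)" and X: "finite (X :: nat set)" "card X \<le> l"
  shows "card (Embs X F (pverts G) (adj G)) = card (Embs X F (pverts H) (adj H))"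
proof -
  have "(card (pverts G) - card X) choose (l - card X) > 0" using l X by (intro zero_less_binomial) auto
  then show ?thesis using deck_sum[OF G X, of F] deck_sum[OF H X, of F] deck n by simp
qed

lemma iemb_o: "iemb F X E f \<Longrightarrow> f ` X \<subseteq> M \<Longrightarrow> iemb E M E' g \<Longrightarrow> iemb F X E' (g \<circ> f)"
  unfolding iemb_def by (auto simp: inj_on_def image_subset_iff)

text \<open>Counts from the deck are available for patterns on natural numbers, whereas
  \<open>deck_trees\<close> takes its patterns from the common vertex type of the two trees. Both
  graphs are therefore copied to natural numbers.\<close>

lemma nat_copy:
  assumes "sgraph V E"
  obtains f :: "'a \<Rightarrow> nat" and V' E' where "bij_betw f V V'" "iemb E V E' f" "sgraph V' E'"
proof -
  interpret sgraph V E by (rule assms)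
  obtain f :: "'a \<Rightarrow> nat" where f: "inj_on f V" using finite_imp_inj_to_nat_seg[OF finite_V] by auto
  define E' where "E' a b \<longleftrightarrow> (\<exists>x\<in>V. \<exists>y\<in>V. a = f x \<and> b = f y \<and> E x y)" for a b
  have "iemb E V E' f"
    unfolding iemb_def E'_def using f by (auto dest: inj_onD)
  moreover have "sgraph (f ` V) E'"
    by unfold_locales (use finite_V adj_sym adj_irrefl f in \<open>auto simp: E'_def dest: inj_onD\<close>)
  ultimately show ?thesis using that f by (auto simp: bij_betw_def)
qed

lemma iemb_digraph_iso:
  assumes G: "pair_graph G" and T: "pair_graph T" and f: "bij_betw f (pverts G) (pverts T)" "iemb (adj G) (pverts G) (adj T) f"
  shows "digraph_iso (with_proj G) (with_proj T)"
proof -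
  interpret G: pair_graph G by (rule G)
  interpret T: pair_graph T by (rule T)
  have "parcs T = map_prod f f ` parcs G"
  proof (intro set_eqI iffI)
    fix e assume e: "e \<in> parcs T"
    then have "fst e \<in> f ` pverts G" "snd e \<in> f ` pverts G"
      using f(1) T.in_arcsD1[of "fst e" "snd e"] T.in_arcsD2[of "fst e" "snd e"] unfolding bij_betw_def by simp_all
    then obtain x y where "x \<in> pverts G" "y \<in> pverts G" "fst e = f x" "snd e = f y" by blast
    then have xy: "x \<in> pverts G" "y \<in> pverts G" "e = (f x, f y)" by (simp_all add: prod_eq_iff)
    then have "(x, y) \<in> parcs G" using f(2) e by (auto simp: iemb_def)
    then show "e \<in> map_prod f f ` parcs G" using xy by force
  next
    fix e assume "e \<in> map_prod f f ` parcs G"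
    then obtain x y where "(x, y) \<in> parcs G" "e = (f x, f y)" by auto
    then show "e \<in> parcs T" using f(2) G.in_arcsD1 G.in_arcsD2 by (auto simp: iemb_def)
  qed
  then show ?thesis
    unfolding digraph_iso_with_proj_iff[OF G.pair_wf_digraph_axioms]
    using f(1) by (intro exI[of _ f]) (auto simp: bij_betw_def)
qed

theorem theorem1p3:
  fixes n l :: nat
    and T :: "'a pair_pre_digraph" and G :: "'b pair_pre_digraph"
  assumes "n \<ge> 3"
    and "8 * real n / 9 + 4 / 9 * sqrt (8 * real n + 5) + 1 < real l" and "l \<le> n"
    and "undirected_tree T" and "card (pverts T) = n"
    and "pair_graph G" and "card (pverts G) = n"
    and "deck l G = deck l T"
  shows "digraph_iso (with_proj G) (with_proj T)"
proof -
  have T: "pair_graph T" using assms(4) by (simp add: undirected_tree_def)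
  interpret G: pair_graph G by (rule assms(6))
  interpret T: pair_graph T by (rule T)
  \<comment> \<open>With the square root bounded below by 1, the hypothesis yields
    \<open>9 * (n - l) + 13 < n\<close>, from which the premises of \<open>recognise_tree\<close>
    and of \<open>trees_isomorphic\<close> follow.\<close>
  have "1 \<le> sqrt (8 * real n + 5)" by simp
  then have "8 * real n + 13 < 9 * real l" using assms(2) by linarith
  then have l: "8 * n + 13 < 9 * l" by linarith
  note embG = deck_Embs[OF assms(6) T _ assms(8)]
  obtain f V1 E1 where f: "bij_betw f (pverts G) V1" "iemb (adj G) (pverts G) E1 f" and G1: "sgraph V1 (E1 :: nat \<Rightarrow> nat \<Rightarrow> bool)"
    using nat_copy[OF pair_graph_sgraph[OF assms(6)]] .
  obtain h V2 E2 where h: "bij_betw h (pverts T) V2" "iemb (adj T) (pverts T) E2 h" and T1: "sgraph V2 (E2 :: nat \<Rightarrow> nat \<Rightarrow> bool)"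
    using nat_copy[OF pair_graph_sgraph[OF T]] .
  have cards: "card V1 = n" "card V2 = n" using bij_betw_same_card[OF f(1)] bij_betw_same_card[OF h(1)] assms by auto
  have emb2: "card (Embs X F (pverts T) (adj T)) = card (Embs X F V2 E2)" if "finite X" for X :: "nat set" and F
    using card_Embs_iso[OF that T.pair_finite_verts h] .
  have emb1: "card (Embs X F (pverts T) (adj T)) = card (Embs X F V1 E1)" if "finite X" "card X \<le> l" for X :: "nat set" and F
    using card_Embs_iso[OF that(1) G.pair_finite_verts f] embG[OF _ _ that] assms by simp
  note tree = undirected_tree_tree_graph[OF assms(4)]
  have 1: "tree_graph V1 E1"
    by (rule recognise_tree[OF tree G1 _ _ _ _ emb1]) (use cards assms l in auto)
  \<comment> \<open>The copy of \<open>T\<close> has the same counts as \<open>T\<close>, so it is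
    recognised like the copy of \<open>G\<close> instead of transporting the tree axioms along
    \<open>h\<close>.\<close>
  have 2: "tree_graph V2 E2"
    by (rule recognise_tree[OF tree T1 _ _ _ _ emb2]) (use cards assms l in auto)
  interpret deck_trees V1 E1 V2 E2 l
    using 1 2 emb1 emb2 cards by (intro deck_trees.intro two_trees.intro deck_trees_axioms.intro) auto
  obtain g where g: "bij_betw g V1 V2" "iemb E1 V1 E2 g"
    using trees_isomorphic[of "n - l"] cards assms(3) l by fastforce
  let ?h = "inv_into (pverts T) h"
  have "bij_betw (?h \<circ> (g \<circ> f)) (pverts G) (pverts T)"
    using bij_betw_trans[OF bij_betw_trans[OF f(1) g(1)] bij_betw_inv_into[OF h(1)]] .
  moreover have "iemb (adj G) (pverts G) (adj T) (?h \<circ> (g \<circ> f))"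
    by (intro iemb_o[OF iemb_o[OF f(2) _ g(2)] _ iemb_inv[OF h]])
      (use f(1) g(1) in \<open>auto simp: bij_betw_def\<close>)
  ultimately show ?thesis by (rule iemb_digraph_iso[OF assms(6) T])
qed

end
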